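(* Let $H\in C^1([0,T];\mathbb R^d)$ satisfy $H_0:=\min_{t\in[0,T]}|H(t)|>0$, and let $\{t_j\}_0^m$ be a partition of $[0,T]$ such that $$\frac{H(t)}{|H(t)|}\cdot\eta_j\ge S_*\qquad\text{for all } t\in[t_j,t_{j+1}],\ j=0,\ldots,m-1,\qquad\text{where }\eta_j:=\frac{H(t_j)}{|H(t_j)|}.$$ Let $Pu:=\partial_t u+H(t)\cdot\nabla u$, let $\varphi$ be the weight function defined in the context, and let $$\Sigma=\{(x,t)\in\partial\Omega\times(0,T):\ H(t)\cdot\nu(x)\ge 0\}.$$ Then there exist constants $s_0,C_0,C>0$, independent of $u$, such that for every $u\in H^1(Q)$ which is a solution of $Pu=0$ in $Q$ and for all $s>s_0$, $$s^2\int_Q|u|^2e^{2s\varphi}\,dx\,dt+se^{-C_0s}\sum_{j=0}^{m-1}\int_\Omega|u(x,t_j)|^2\,dx$$ $$\le C\int_Q|Pu|^2e^{2s\varphi}\,dx\,dt+Cse^{Cs}\int_\Sigma|u|^2\,d\gamma\,dt+Cse^{Cs}\int_\Omega|u(x,T)|^2\,dx.$$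
   Context: Setting: $d\in\mathbb N$, $T>0$, $\Omega\subset\mathbb R^d$ is a bounded domain with smooth boundary $\partial\Omega$ and with $\mathbf 0\in\overline\Omega$; $\nu(x)$ is the unit outward normal to $\partial\Omega$ at $x$; $d\gamma$ is surface measure on $\partial\Omega$; $Q=\Omega\times(0,T)$. Functions are real-valued; $u(\cdot,t)$ and $u|_{\partial\Omega\times(0,T)}$ are understood as traces of $u\in H^1(Q)$. A partition $\{t_j\}_0^m$ of $[0,T]$ is a strictly increasing finite sequence $0=t_0<t_1<\cdots<t_m=T$ for some $m\in\mathbb N$. Fixed parameters: $S_*\in(1/\sqrt2,1)$ and $r>0$. Put $\delta_\Omega=\sup_{x,y\in\overline\Omega}|x-y|$ and, for $j=0,\ldots,m-1$, $$R_0=\frac{1+S_*}{1-S_*}\,\delta_\Omega,\qquad R_j=2^jR_0+(2^j-1)(\delta_\Omega+r),\qquad x_j:=-R_j\eta_j,$$ with $\eta_j=H(t_j)/|H(t_j)|$. Let $d_\Omega(x_j):=\min_{x\in\overline\Omega}|x-x_j|$. Weight function: with $\beta:=(2S_*^2-1)H_0\,d_\Omega(x_0)$, define for $x\in\overline\Omega$ $$\varphi(x,t):=-\beta(t-t_j)+|x-x_j|^2,\qquad t\in[t_j,t_{j+1}),\ j=0,\ldots,m-1,$$ and extend $\varphi$ to $t=T$ by continuity (from the left). *)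

theory Defs
  imports "HOL-Analysis.Analysis"
begin

section \<open>Smooth functions and smooth boundaries\<close>

text \<open>On all of the space: continuity for \<open>k = 0\<close>; for \<open>Suc k\<close>, differentiability with all first
  partial derivatives of class \<open>k\<close>.\<close>

primrec Ck :: "nat \<Rightarrow> ('a::euclidean_space \<Rightarrow> real) \<Rightarrow> bool" where
  "Ck 0 f \<longleftrightarrow> continuous_on UNIV f"
| "Ck (Suc k) f \<longleftrightarrow>
     (\<forall>x. f differentiable (at x)) \<and> (\<forall>b\<in>Basis. Ck k (\<lambda>x. frechet_derivative f (at x) b))"

definition smooth :: "('a::euclidean_space \<Rightarrow> real) \<Rightarrow> bool" where
  "smooth f \<longleftrightarrow> (\<forall>k. Ck k f)"

definition grad :: "('a::euclidean_space \<Rightarrow> real) \<Rightarrow> 'a \<Rightarrow> 'a" where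
  "grad f x = (\<Sum>b\<in>Basis. frechet_derivative f (at x) b *\<^sub>R b)"

text \<open>Near \<open>x\<close>, the set \<open>\<Omega>\<close> is the region on the \<open>e\<close>-side of the graph of a smooth function \<open>f\<close> of the
  coordinates other than \<open>e\<close>, where \<open>e\<close> is plus or minus a coordinate vector (relabelling and
  reorienting of the axes). That \<open>f\<close> does not depend on the \<open>e\<close>-coordinate is expressed by
  invariance under translation along \<open>e\<close>.\<close>

definition graph_chart ::
    "'a::euclidean_space set \<Rightarrow> 'a \<Rightarrow> real \<Rightarrow> 'a \<Rightarrow> ('a \<Rightarrow> real) \<Rightarrow> bool" where
  "graph_chart \<Omega> x \<rho> e f \<longleftrightarrow>
     0 < \<rho> \<and> (e \<in> Basis \<or> - e \<in> Basis) \<and> smooth f \<and> (\<forall>y c. f (y + c *\<^sub>R e) = f y) \<and>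
     \<Omega> \<inter> ball x \<rho> = {y \<in> ball x \<rho>. f y < y \<bullet> e}"

definition smooth_boundary :: "'a::euclidean_space set \<Rightarrow> bool" where
  "smooth_boundary \<Omega> \<longleftrightarrow> (\<forall>x\<in>frontier \<Omega>. \<exists>\<rho> e f. graph_chart \<Omega> x \<rho> e f)"

text \<open>In a chart, \<open>\<Omega>\<close> is locally \<open>{y. f y - y \<bullet> e < 0}\<close>, so the outward normal points along
  \<open>grad f x - e\<close>, which is nonzero since \<open>grad f x\<close> is orthogonal to \<open>e\<close>; the direction does not
  depend on the chart.\<close>

definition outward_normal :: "'a::euclidean_space set \<Rightarrow> 'a \<Rightarrow> 'a" where
  "outward_normal \<Omega> x =
     (THE n. \<exists>\<rho> e f. graph_chart \<Omega> x \<rho> e f \<and> n = (grad f x - e) /\<^sub>R norm (grad f x - e))"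


section \<open>Surface measure\<close>

text \<open>The \<open>k\<close>-dimensional Hausdorff measure, normalised to agree with Lebesgue measure in dimension
  \<open>k\<close>. The exponent is a natural number, so that \<open>0 ^ 0 = 1\<close> and \<open>k = 0\<close> gives counting measure;
  empty members of a cover have to be discounted separately for the same reason. Since
  \<open>hausdorff_outer k\<close> is a metric outer measure, it is countably additive on the Borel sets, as
  \<^const>\<open>measure_of\<close> requires.\<close>

definition hausdorff_pre :: "nat \<Rightarrow> real \<Rightarrow> 'a::metric_space set \<Rightarrow> ennreal" where
  "hausdorff_pre k \<delta> A =
     (INF U \<in> {U :: nat \<Rightarrow> 'a set. A \<subseteq> (\<Union>i. U i) \<and> (\<forall>i. bounded (U i) \<and> diameter (U i) \<le> \<delta>)}.
        \<Sum>i. if U i = {} then 0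
             else ennreal (unit_ball_vol (real k) * (diameter (U i) / 2) ^ k))"

definition hausdorff_outer :: "nat \<Rightarrow> 'a::metric_space set \<Rightarrow> ennreal" where
  "hausdorff_outer k A = (SUP \<delta> \<in> {0<..}. hausdorff_pre k \<delta> A)"

definition hausdorff_measure :: "nat \<Rightarrow> 'a::metric_space measure" where
  "hausdorff_measure k = measure_of UNIV (sets borel) (hausdorff_outer k)"

definition surface_measure :: "'a::euclidean_space set \<Rightarrow> 'a measure" where
  "surface_measure \<Omega> = restrict_space (hausdorff_measure (DIM('a) - 1)) (frontier \<Omega>)"

definition lateral_measure :: "'a::euclidean_space set \<Rightarrow> real \<Rightarrow> ('a \<times> real) measure" where
  "lateral_measure \<Omega> T =
     completion (surface_measure \<Omega> \<Otimes>\<^sub>M restrict_space lborel {0<..<T})"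


section \<open>The Sobolev space of order one and traces\<close>

definition square_integrable :: "'a measure \<Rightarrow> ('a \<Rightarrow> 'b::euclidean_space) \<Rightarrow> bool" where
  "square_integrable M f \<longleftrightarrow> f \<in> borel_measurable M \<and> integrable M (\<lambda>x. (norm (f x))\<^sup>2)"

definition test_function :: "'a::euclidean_space set \<Rightarrow> ('a \<Rightarrow> real) \<Rightarrow> bool" where
  "test_function S \<psi> \<longleftrightarrow>
     smooth \<psi> \<and> compact (closure {x. \<psi> x \<noteq> 0}) \<and> closure {x. \<psi> x \<noteq> 0} \<subseteq> S"

definition has_weak_gradient ::
    "'a::euclidean_space set \<Rightarrow> ('a \<Rightarrow> real) \<Rightarrow> ('a \<Rightarrow> 'a) \<Rightarrow> bool" where
  "has_weak_gradient S u G \<longleftrightarrow>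
     square_integrable (lebesgue_on S) G \<and>
     (\<forall>\<psi>. test_function S \<psi> \<longrightarrow> (\<forall>b\<in>Basis.
        (LINT x|lebesgue_on S. u x * frechet_derivative \<psi> (at x) b)
          = - (LINT x|lebesgue_on S. (G x \<bullet> b) * \<psi> x)))"

definition H1 :: "'a::euclidean_space set \<Rightarrow> ('a \<Rightarrow> real) set" where
  "H1 S = {u. square_integrable (lebesgue_on S) u \<and> (\<exists>G. has_weak_gradient S u G)}"

text \<open>For \<open>u \<in> H1 S\<close> this is determined almost everywhere on \<open>S\<close>.\<close>

definition weak_grad :: "'a::euclidean_space set \<Rightarrow> ('a \<Rightarrow> real) \<Rightarrow> 'a \<Rightarrow> 'a" where
  "weak_grad S u = (SOME G. has_weak_gradient S u G)"

text \<open>A sequence of functions smooth up to the boundary of \<open>S\<close> (restrictions of smooth functions on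
  the whole space) that converges to \<open>u\<close> in the norm of \<open>H1 S\<close>.\<close>

definition H1_approx ::
    "'a::euclidean_space set \<Rightarrow> ('a \<Rightarrow> real) \<Rightarrow> (nat \<Rightarrow> 'a \<Rightarrow> real) \<Rightarrow> bool" where
  "H1_approx S u \<phi> \<longleftrightarrow>
     (\<forall>n. smooth (\<phi> n)) \<and>
     (\<lambda>n. LINT x|lebesgue_on S. (\<phi> n x - u x)\<^sup>2) \<longlonglongrightarrow> 0 \<and>
     (\<lambda>n. LINT x|lebesgue_on S. (norm (grad (\<phi> n) x - weak_grad S u x))\<^sup>2) \<longlonglongrightarrow> 0"

text \<open>Traces are extensions by continuity: \<open>g\<close> is a trace of \<open>u\<close> if it is the limit in the square
  mean of the restrictions of smooth functions approximating \<open>u\<close>. By the trace theorem, every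
  \<open>u\<close> in \<open>H1\<close> of the cylinder over a bounded domain with smooth boundary has such traces, and
  they are unique up to null sets.\<close>

definition cylinder :: "'a::euclidean_space set \<Rightarrow> real \<Rightarrow> ('a \<times> real) set" where
  "cylinder \<Omega> T = \<Omega> \<times> {0<..<T}"

definition lateral_trace ::
    "'a::euclidean_space set \<Rightarrow> real \<Rightarrow> ('a \<times> real \<Rightarrow> real) \<Rightarrow> ('a \<times> real \<Rightarrow> real) \<Rightarrow> bool" where
  "lateral_trace \<Omega> T u g \<longleftrightarrow>
     square_integrable (lateral_measure \<Omega> T) g \<and>
     (\<exists>\<phi>. H1_approx (cylinder \<Omega> T) u \<phi> \<and>
        (\<lambda>n. LINT p|lateral_measure \<Omega> T. (\<phi> n p - g p)\<^sup>2) \<longlonglongrightarrow> 0)"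

definition time_trace ::
    "'a::euclidean_space set \<Rightarrow> real \<Rightarrow> ('a \<times> real \<Rightarrow> real) \<Rightarrow> real \<Rightarrow> ('a \<Rightarrow> real) \<Rightarrow> bool" where
  "time_trace \<Omega> T u \<tau> h \<longleftrightarrow>
     square_integrable (lebesgue_on \<Omega>) h \<and>
     (\<exists>\<phi>. H1_approx (cylinder \<Omega> T) u \<phi> \<and>
        (\<lambda>n. LINT x|lebesgue_on \<Omega>. (\<phi> n (x, \<tau>) - h x)\<^sup>2) \<longlonglongrightarrow> 0)"


section \<open>The transport equation and the weight function\<close>

text \<open>One-sided derivatives at the end points.\<close>

definition C1_on_interval :: "real \<Rightarrow> (real \<Rightarrow> 'a::euclidean_space) \<Rightarrow> bool" where
  "C1_on_interval T H \<longleftrightarrow>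
     (\<exists>H'. continuous_on {0..T} H' \<and>
        (\<forall>\<tau>\<in>{0..T}. (H has_vector_derivative H' \<tau>) (at \<tau> within {0..T})))"

definition transport ::
    "'a::euclidean_space set \<Rightarrow> real \<Rightarrow> (real \<Rightarrow> 'a) \<Rightarrow> ('a \<times> real \<Rightarrow> real) \<Rightarrow> 'a \<times> real \<Rightarrow> real" where
  "transport \<Omega> T H u = (\<lambda>(x, \<tau>).
     snd (weak_grad (cylinder \<Omega> T) u (x, \<tau>)) + H \<tau> \<bullet> fst (weak_grad (cylinder \<Omega> T) u (x, \<tau>)))"

definition outflow_boundary ::
    "'a::euclidean_space set \<Rightarrow> real \<Rightarrow> (real \<Rightarrow> 'a) \<Rightarrow> ('a \<times> real) set" where
  "outflow_boundary \<Omega> T H =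
     {(x, \<tau>). x \<in> frontier \<Omega> \<and> \<tau> \<in> {0<..<T} \<and> H \<tau> \<bullet> outward_normal \<Omega> x \<ge> 0}"

definition is_partition :: "real \<Rightarrow> nat \<Rightarrow> (nat \<Rightarrow> real) \<Rightarrow> bool" where
  "is_partition T m t \<longleftrightarrow> t 0 = 0 \<and> t m = T \<and> (\<forall>j<m. t j < t (Suc j))"

definition min_speed :: "real \<Rightarrow> (real \<Rightarrow> 'a::euclidean_space) \<Rightarrow> real" where
  "min_speed T H = (INF \<tau>\<in>{0..T}. norm (H \<tau>))"

definition direction :: "(real \<Rightarrow> 'a::euclidean_space) \<Rightarrow> real \<Rightarrow> 'a" where
  "direction H \<tau> = H \<tau> /\<^sub>R norm (H \<tau>)"

definition radius :: "'a::euclidean_space set \<Rightarrow> real \<Rightarrow> real \<Rightarrow> nat \<Rightarrow> real" where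
  "radius \<Omega> S r j =
     2 ^ j * ((1 + S) / (1 - S) * diameter (closure \<Omega>))
       + (2 ^ j - 1) * (diameter (closure \<Omega>) + r)"

definition center ::
    "'a::euclidean_space set \<Rightarrow> (real \<Rightarrow> 'a) \<Rightarrow> (nat \<Rightarrow> real) \<Rightarrow> real \<Rightarrow> real \<Rightarrow> nat \<Rightarrow> 'a" where
  "center \<Omega> H t S r j = - (radius \<Omega> S r j *\<^sub>R direction H (t j))"

definition weight_slope ::
    "'a::euclidean_space set \<Rightarrow> real \<Rightarrow> (real \<Rightarrow> 'a) \<Rightarrow> (nat \<Rightarrow> real) \<Rightarrow> real \<Rightarrow> real \<Rightarrow> real" where
  "weight_slope \<Omega> T H t S r =
     (2 * S\<^sup>2 - 1) * min_speed T H * infdist (center \<Omega> H t S r 0) (closure \<Omega>)"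

text \<open>The index \<open>j < m\<close> with \<open>t j \<le> \<tau> < t (Suc j)\<close>; for \<open>\<tau> = T\<close> it is \<open>m - 1\<close>, which extends the
  weight to the final time by continuity from the left.\<close>

definition part_index :: "nat \<Rightarrow> (nat \<Rightarrow> real) \<Rightarrow> real \<Rightarrow> nat" where
  "part_index m t \<tau> = Max {j. j < m \<and> t j \<le> \<tau>}"

definition weight ::
    "'a::euclidean_space set \<Rightarrow> real \<Rightarrow> (real \<Rightarrow> 'a) \<Rightarrow> nat \<Rightarrow> (nat \<Rightarrow> real) \<Rightarrow> real \<Rightarrow> real \<Rightarrow>
      'a \<times> real \<Rightarrow> real" where
  "weight \<Omega> T H m t S r = (\<lambda>(x, \<tau>). let j = part_index m t \<tau> in
     - weight_slope \<Omega> T H t S r * (\<tau> - t j) + (norm (x - center \<Omega> H t S r j))\<^sup>2)"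

end

theory Submission
  imports Defs
begin

text \<open>Since \<open>P u = 0\<close> and the constants may depend on everything but \<open>u\<close>, the factors \<open>exp (C s)\<close> on the
  right absorb the weight, and the estimate reduces to bounding the \<open>L\<^sup>2\<close> norms of \<open>u\<close> and of \<open>u(\<cdot>, t\<^sub>j)\<close> by
  those of \<open>u\<close> on \<open>\<Sigma>\<close> and of \<open>u(\<cdot>, T)\<close>. This follows by tracing characteristics
  \<open>x + X(\<tau>)\<close>, \<open>X' = H\<close>, forward in time: a characteristic starting in \<open>\<Omega>\<close> either stays there up to time
  \<open>T\<close> or leaves through a point of \<open>\<Sigma>\<close>, because at a first exit point the velocity does not point
  inward. So no divergence theorem is needed, only that the map \<open>(y, \<tau>) \<mapsto> y - X(\<tau>)\<close> sends lateral sets to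
  sets of comparable Lebesgue measure; this is a covering argument from the definition of the
  Hausdorff measure. The inequality is proved for smooth functions and passed to the limit; since the
  traces at different times may come from different approximating sequences, it also needs the
  continuity of the trace on time slices.\<close>

subsection \<open>Hausdorff measure on Borel sets\<close>

text \<open>The exit point depends on the starting point in no controlled way, so nothing is
  substituted under an integral over the lateral boundary. Superlevel sets are compared instead:
  once the interior contributions are absorbed, every starting point whose value exceeds
  \<open>c\<close> lies in the sweep of the part of \<Sigma> where a multiple of the squared
  boundary values exceeds \<open>c\<close>. The layer cake formula turns this inclusion into an
  inequality of integrals. Only upper bounds on swept sets enter, and they are stated for the
  Lebesgue outer measure, so that measurability of images never arises. The surface measure is a
  restricted Hausdorff measure built by \<open>measure_of\<close>, whose values are the intended
  ones only after countable additivity on the Borel sets is established; hence the development opens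
  with Caratheodory's criterion. In the limit, the approximating sequence is the one supplied by the
  lateral trace. All time slices are made to follow this one sequence, because slices of two
  sequences with the same limit in H1 approach each other.\<close>

text \<open>Each new set has one positive distance from all its finitely many predecessors, hence
  from their union, and the two-set property applies in an induction.\<close>

lemma finite_separated_superadditive:
  fixes f :: "'a::metric_space set \<Rightarrow> ennreal" and R :: "nat \<Rightarrow> 'a set"
  assumes f_empty: "f {} = 0"
    and sep: "\<And>A B \<epsilon>. \<lbrakk>0 < \<epsilon>; \<And>a b. \<lbrakk>a \<in> A; b \<in> B\<rbrakk> \<Longrightarrow> \<epsilon> \<le> dist a b\<rbrakk> \<Longrightarrow> f A + f B \<le> f (A \<union> B)"
    and R: "\<And>n. \<exists>\<epsilon>>0. \<forall>k<n. \<forall>a\<in>R k. \<forall>b\<in>R n. \<epsilon> \<le> dist a b"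
  shows "(\<Sum>k<n. f (R k)) \<le> f (\<Union>k<n. R k)"
proof (induction n)
  case 0
  then show ?case by (simp add: f_empty)
next
  case (Suc n)
  obtain \<epsilon> where \<epsilon>: "\<epsilon> > 0" "\<And>k a b. \<lbrakk>k < n; a \<in> R k; b \<in> R n\<rbrakk> \<Longrightarrow> \<epsilon> \<le> dist a b"
    using R[of n] by blast
  have "(\<Sum>k<Suc n. f (R k)) \<le> f (\<Union>k<n. R k) + f (R n)"
    using Suc by (auto intro: add_right_mono)
  also have "\<dots> \<le> f ((\<Union>k<n. R k) \<union> R n)"
    by (rule sep[OF \<epsilon>(1)]) (auto intro: \<epsilon>(2))
  also have "(\<Union>k<n. R k) \<union> R n = (\<Union>k<Suc n. R k)"
    by (auto simp: less_Suc_eq)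
  finally show ?case .
qed

text \<open>Caratheodory's criterion for metric outer measures; \<open>lambda_system\<close>
  consists of the sets that split every set additively. The part of \<open>A\<close> far from
  \<open>C\<close> splits off by separation, and the layers approaching \<open>C\<close> have a
  summable measure.\<close>

lemma metric_outer_measure_lambda_closed:
  fixes f :: "'a::metric_space set \<Rightarrow> ennreal"
  assumes f_empty: "f {} = 0" and f_mono: "\<And>A B. A \<subseteq> B \<Longrightarrow> f A \<le> f B"
    and f_csub: "\<And>A. f (\<Union>i. A i) \<le> (\<Sum>i. f (A i))"
    and sep: "\<And>A B \<epsilon>. \<lbrakk>0 < \<epsilon>; \<And>a b. \<lbrakk>a \<in> A; b \<in> B\<rbrakk> \<Longrightarrow> \<epsilon> \<le> dist a b\<rbrakk> \<Longrightarrow> f A + f B \<le> f (A \<union> B)"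
    and "closed C"
  shows "C \<in> lambda_system UNIV UNIV f"
\<comment> \<open>\<open>infdist x {}\<close> is 0 by convention, so the argument that points
  outside \<open>C\<close> have positive distance from \<open>C\<close> does not cover the empty
  set.\<close>
proof (cases "C = {}")
  case True
  then show ?thesis by (simp add: lambda_system_def f_empty)
next
  case False
  have f_sub: "f (A \<union> B) \<le> f A + f B" for A B
  proof -
    have "f (A \<union> B) = f (\<Union>i. binaryset A B i)"
      by (simp add: UN_binaryset_eq)
    also have "\<dots> \<le> (\<Sum>i. f (binaryset A B i))"
      by (rule f_csub)
    also have "\<dots> = f A + f B"
      using f_empty by (intro suminf_binaryset_eq)
    finally show ?thesis .
  qed
  have "f (A \<inter> C) + f (A - C) \<le> f A" for A
  proof (cases "f A = top")
    case True
    then show ?thesis by simp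
  next
    case fin: False
    \<comment> \<open>Layers of \<open>A\<close> around \<open>C\<close>: those of equal parity are mutually separated, so their measures are
      summable and the tail of the layers next to \<open>C\<close> is negligible.\<close>
    define D where "D n = {x\<in>A. inverse (real (Suc n)) \<le> infdist x C}" for n
    define R where "R n = D (Suc n) - D n" for n
    have R: "inverse (real (Suc (Suc n))) \<le> infdist x C" "infdist x C < inverse (real (Suc n))" "x \<in> A"
      if "x \<in> R n" for x n
      using that unfolding R_def D_def by auto
    \<comment> \<open>The distance to \<open>C\<close> is 1-Lipschitz, so a gap between the distance
      ranges of two layers is a gap between the layers.\<close>
    have far: "inverse (real (Suc (Suc j))) - inverse (real (Suc i)) \<le> dist x y"
      if "x \<in> R j" "y \<in> R i" for x y i j
      using R[OF that(1)] R[OF that(2)] infdist_triangle[of x C y] by (auto simp: dist_commute)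
    have parity: "(\<Sum>k<n. f (R (2 * k + p))) \<le> f A" for n p
    proof -
      have "\<exists>\<epsilon>>0. \<forall>k<n. \<forall>a\<in>R (2 * k + p). \<forall>b\<in>R (2 * n + p). \<epsilon> \<le> dist a b" for n
      proof (cases "n = 0")
        case True
        then show ?thesis by (auto intro: exI[of _ 1])
      next
        case False
        have "inverse (real (2 * n + p)) - inverse (real (Suc (2 * n + p))) \<le> dist a b"
          if "k < n" "a \<in> R (2 * k + p)" "b \<in> R (2 * n + p)" for k a b
        proof -
          have "inverse (real (2 * n + p)) \<le> inverse (real (Suc (Suc (2 * k + p))))"
            using that(1) by (intro le_imp_inverse_le) auto
          then show ?thesis using far[OF that(2,3)] by linarith
        qed
        moreover have "0 < inverse (real (2 * n + p)) - inverse (real (Suc (2 * n + p)))"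
          using False by (simp only: diff_gt_0_iff_gt, intro less_imp_inverse_less) auto
        ultimately show ?thesis by blast
      qed
      then have "(\<Sum>k<n. f (R (2 * k + p))) \<le> f (\<Union>k<n. R (2 * k + p))"
        by (intro finite_separated_superadditive[of f "\<lambda>k. R (2 * k + p)"] f_empty sep) auto
      also have "\<dots> \<le> f A" by (intro f_mono) (use R in auto)
      finally show ?thesis .
    qed
    have partial: "(\<Sum>k<n. f (R k)) \<le> f A + f A" for n
    proof -
      have "(\<Sum>k<n. f (R k)) \<le> (\<Sum>k<2 * n. f (R k))"
        by (intro sum_mono2) auto
      also have "\<dots> = (\<Sum>k<n. f (R (2 * k))) + (\<Sum>k<n. f (R (2 * k + 1)))"
        by (induction n) (auto simp: algebra_simps)
      also have "\<dots> \<le> f A + f A"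
        using add_mono[OF parity[where n=n and p=0] parity[where n=n and p=1]] by simp
      finally show ?thesis .
    qed
    define S where "S = (\<Sum>k. f (R k))"
    have S_fin: "S \<noteq> top"
    proof -
      have "S \<le> f A + f A" unfolding S_def by (intro suminf_le_const partial) auto
      then show ?thesis using fin by (metis ennreal_add_eq_top top.extremum_uniqueI)
    qed
    \<comment> \<open>A form free of subtraction: the tail of the series beyond \<open>n\<close> is
      the error of replacing \<open>A - C\<close> by \<open>D n\<close>, and the head makes it up to
      the full sum \<open>S\<close>. Finiteness of \<open>S\<close> then allows cancelling
      it.\<close>
    have "S + (f (A \<inter> C) + f (A - C)) \<le> f A + S"
      unfolding S_def
    proof (rule ennreal_suminf_bound_add)
      fix n
      have "A - C \<subseteq> D n \<union> (\<Union>k. R (k + n))"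
      proof
        fix x assume x: "x \<in> A - C"
        then have "infdist x C > 0"
          using False \<open>closed C\<close> in_closed_iff_infdist_zero[of C x] infdist_nonneg[of x C] by auto
        then obtain N where "inverse (real (Suc N)) < infdist x C"
          using reals_Archimedean by blast
        then have ex: "x \<in> D N" using x by (auto simp: D_def)
        show "x \<in> D n \<union> (\<Union>k. R (k + n))"
        proof (cases "N \<le> n")
          case True
          have "inverse (real (Suc n)) \<le> inverse (real (Suc N))"
            using True by (intro le_imp_inverse_le) auto
          then have "inverse (real (Suc n)) \<le> infdist x C"
            using ex unfolding D_def mem_Collect_eq by linarith
          then show ?thesis using x by (simp add: D_def)
        next
          case nN: False
          show ?thesis
          proof (cases "x \<in> D n")
            case True
            then show ?thesis by simp
          next
            case nD: False
            \<comment> \<open>The first index from \<open>n\<close> on whose set contains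
              \<open>x\<close>; it is not \<open>n\<close> itself, so the set just before it misses
              \<open>x\<close> and \<open>x\<close> lies in the layer between the two.\<close>
            define M where "M = (LEAST M. x \<in> D M \<and> n \<le> M)"
            have M: "x \<in> D M \<and> n \<le> M"
              unfolding M_def by (rule LeastI[of _ N]) (use ex nN in auto)
            then obtain l where l: "M = Suc (l + n)"
              using nD by (metis le_add_diff_inverse2 le_neq_implies_less less_imp_Suc_add add.commute)
            have "x \<notin> D (l + n)"
              using not_less_Least[of "l + n" "\<lambda>M. x \<in> D M \<and> n \<le> M"] l unfolding M_def by auto
            then have "x \<in> R (l + n)" using M l by (auto simp: R_def)
            then show ?thesis by auto
          qed
        qed
      qed
      then have "f (A - C) \<le> f (D n \<union> (\<Union>k. R (k + n)))"
        by (rule f_mono)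
      also have "\<dots> \<le> f (D n) + f (\<Union>k. R (k + n))"
        by (rule f_sub)
      also have "\<dots> \<le> f (D n) + (\<Sum>k. f (R (k + n)))"
        by (rule add_left_mono[OF f_csub])
      finally have 1: "f (A - C) \<le> f (D n) + (\<Sum>k. f (R (k + n)))" .
      have 2: "f (A \<inter> C) + f (D n) \<le> f A"
      proof -
        have "f (A \<inter> C) + f (D n) \<le> f (A \<inter> C \<union> D n)"
        proof (rule sep)
          show "0 < inverse (real (Suc n))" by simp
          fix a b assume "a \<in> A \<inter> C" "b \<in> D n"
          then show "inverse (real (Suc n)) \<le> dist a b"
            using infdist_le[of a C b] by (auto simp: D_def dist_commute intro: order_trans)
        qed
        also have "\<dots> \<le> f A" by (rule f_mono) (auto simp: D_def)
        finally show ?thesis .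
      qed
      have 3: "(\<Sum>k. f (R k)) = (\<Sum>k. f (R (k + n))) + (\<Sum>k<n. f (R k))"
        by (rule suminf_offset) auto
      have "(\<Sum>k<n. f (R k)) + (f (A \<inter> C) + f (A - C))
          \<le> (\<Sum>k<n. f (R k)) + (f (A \<inter> C) + (f (D n) + (\<Sum>k. f (R (k + n)))))"
        by (intro add_left_mono 1)
      also have "\<dots> = (f (A \<inter> C) + f (D n)) + (\<Sum>k. f (R k))"
        unfolding 3 by (simp only: ac_simps)
      also have "\<dots> \<le> f A + (\<Sum>k. f (R k))"
        by (intro add_right_mono 2)
      finally show "(\<Sum>k<n. f (R k)) + (f (A \<inter> C) + f (A - C)) \<le> f A + (\<Sum>k. f (R k))" .
    qed
    then show ?thesis using S_fin by (simp add: add.commute)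
  qed
  moreover have "f A \<le> f (A \<inter> C) + f (A - C)" for A
    using f_sub[of "A \<inter> C" "A - C"] by (simp add: Int_Diff_Un)
  ultimately have "f (A \<inter> C) + f (A - C) = f A" for A
    by (rule antisym)
  then show ?thesis
    by (simp add: lambda_system_def Int_commute Diff_eq)
qed

section \<open>The Hausdorff set function is a metric outer measure\<close>

definition hausdorff_term :: "nat \<Rightarrow> 'a::metric_space set \<Rightarrow> ennreal" where
  "hausdorff_term k U =
     (if U = {} then 0 else ennreal (unit_ball_vol (real k) * (diameter U / 2) ^ k))"

lemma hausdorff_term_empty [simp]: "hausdorff_term k {} = 0"
  by (simp add: hausdorff_term_def)

lemma hausdorff_pre_le:
  assumes "A \<subseteq> (\<Union>i. U i)" "\<And>i. bounded (U i)" "\<And>i. diameter (U i) \<le> \<delta>"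
  shows "hausdorff_pre k \<delta> A \<le> (\<Sum>i. hausdorff_term k (U i))"
  unfolding hausdorff_pre_def hausdorff_term_def
  by (rule INF_lower2[of U]) (use assms in auto)

lemma hausdorff_pre_greatest:
  assumes "\<And>U. \<lbrakk>A \<subseteq> (\<Union>i. U i); \<And>i. bounded (U i); \<And>i. diameter (U i) \<le> \<delta>\<rbrakk>
    \<Longrightarrow> c \<le> (\<Sum>i. hausdorff_term k (U i))"
  shows "c \<le> hausdorff_pre k \<delta> A"
  unfolding hausdorff_pre_def
  by (rule INF_greatest) (use assms in \<open>auto simp: hausdorff_term_def\<close>)

lemma hausdorff_pre_close:
  assumes "hausdorff_pre k \<delta> A < c"
  shows "\<exists>U. A \<subseteq> (\<Union>i. U i) \<and> (\<forall>i. bounded (U i) \<and> diameter (U i) \<le> \<delta>) \<and>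
    (\<Sum>i. hausdorff_term k (U i)) < c"
  using assms unfolding hausdorff_pre_def INF_less_iff hausdorff_term_def by auto

text \<open>For negative \<open>\<delta>\<close> there is no admissible cover and the infimum over
  the empty family is \<open>top\<close>, whence the sign condition.\<close>

lemma hausdorff_pre_empty: "0 \<le> \<delta> \<Longrightarrow> hausdorff_pre k \<delta> {} = 0"
  using hausdorff_pre_le[of "{}" "\<lambda>_. {}" \<delta> k] by (simp add: diameter_def)

lemma hausdorff_pre_mono: "A \<subseteq> B \<Longrightarrow> hausdorff_pre k \<delta> A \<le> hausdorff_pre k \<delta> B"
  by (intro hausdorff_pre_greatest hausdorff_pre_le) auto

lemma hausdorff_pre_antimono: "\<delta> \<le> \<delta>' \<Longrightarrow> hausdorff_pre k \<delta>' A \<le> hausdorff_pre k \<delta> A"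
  by (intro hausdorff_pre_greatest hausdorff_pre_le) (auto intro: order_trans)

text \<open>Nearly optimal covers with errors \<open>e / 2 ^ (i + 1)\<close> are merged into a
  single cover.\<close>

lemma hausdorff_pre_countably_subadditive:
  fixes A :: "nat \<Rightarrow> 'a::metric_space set"
  shows "hausdorff_pre k \<delta> (\<Union>i. A i) \<le> (\<Sum>i. hausdorff_pre k \<delta> (A i))"
proof (cases "(\<Sum>i. hausdorff_pre k \<delta> (A i)) = top")
  case False
  then have fin: "hausdorff_pre k \<delta> (A i) < top" for i
    using ennreal_suminf_lessD[of "\<lambda>i. hausdorff_pre k \<delta> (A i)" top i] by (simp add: less_top)
  show ?thesis
  proof (rule ennreal_le_epsilon)
    fix e :: real assume "0 < e"
    have "\<exists>U. A i \<subseteq> (\<Union>j. U j) \<and> (\<forall>j. bounded (U j) \<and> diameter (U j) \<le> \<delta>) \<and>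
        (\<Sum>j. hausdorff_term k (U j)) \<le> hausdorff_pre k \<delta> (A i) + ennreal (e * (1/2) ^ Suc i)" for i
    proof -
      have "hausdorff_pre k \<delta> (A i) < hausdorff_pre k \<delta> (A i) + ennreal (e * (1/2) ^ Suc i)"
        using fin[of i] \<open>0 < e\<close>
          ennreal_add_left_cancel_less[of "hausdorff_pre k \<delta> (A i)" 0 "ennreal (e * (1/2) ^ Suc i)"]
        by (simp add: less_top)
      from hausdorff_pre_close[OF this] show ?thesis by (auto intro: less_imp_le)
    qed
    then obtain U where U: "\<And>i. A i \<subseteq> (\<Union>j. U i j)" "\<And>i j. bounded (U i j)"
      "\<And>i j. diameter (U i j) \<le> \<delta>"
      "\<And>i. (\<Sum>j. hausdorff_term k (U i j)) \<le> hausdorff_pre k \<delta> (A i) + ennreal (e * (1/2) ^ Suc i)"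
      by metis
    \<comment> \<open>The double sequence of covers is listed as one sequence through the pairing
      function on the natural numbers.\<close>
    define V where "V = (\<lambda>n. case prod_decode n of (i, j) \<Rightarrow> U i j)"
    have "hausdorff_pre k \<delta> (\<Union>i. A i) \<le> (\<Sum>n. hausdorff_term k (V n))"
    proof (rule hausdorff_pre_le)
      show "(\<Union>i. A i) \<subseteq> (\<Union>n. V n)"
      proof
        fix x assume "x \<in> (\<Union>i. A i)"
        then obtain i j where "x \<in> U i j" using U(1) by blast
        then have "x \<in> V (prod_encode (i, j))" by (simp add: V_def)
        then show "x \<in> (\<Union>n. V n)" by blast
      qed
    qed (auto simp: V_def U split: prod.split)
    also have "\<dots> = (\<Sum>i. \<Sum>j. hausdorff_term k (U i j))"
      by (subst suminf_ennreal_2dimen[of _ "\<lambda>(i, j). hausdorff_term k (U i j)", symmetric])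
        (auto simp: V_def o_def split_def)
    also have "\<dots> \<le> (\<Sum>i. hausdorff_pre k \<delta> (A i) + ennreal (e * (1/2) ^ Suc i))"
      by (intro suminf_le U(4)) auto
    also have "\<dots> = (\<Sum>i. hausdorff_pre k \<delta> (A i)) + (\<Sum>i. ennreal (e * (1/2) ^ Suc i))"
      by (intro suminf_add[symmetric]) auto
    also have "(\<Sum>i. ennreal (e * (1/2) ^ Suc i)) = ennreal e"
      using \<open>0 < e\<close> by (subst suminf_ennreal_eq[OF _ sums_mult[OF power_half_series, of e]]) auto
    finally show "hausdorff_pre k \<delta> (\<Union>i. A i) \<le> (\<Sum>i. hausdorff_pre k \<delta> (A i)) + ennreal e" .
  qed
qed simp

text \<open>A set of diameter at most \<open>\<delta> < \<epsilon>\<close> cannot meet both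
  \<open>A\<close> and \<open>B\<close>, so every cover of the union splits into a cover of
  \<open>A\<close> and a cover of \<open>B\<close> that share no nonempty member.\<close>

lemma hausdorff_pre_separated:
  assumes "\<And>a b. \<lbrakk>a \<in> A; b \<in> B\<rbrakk> \<Longrightarrow> \<epsilon> \<le> dist a b" "0 \<le> \<delta>" "\<delta> < \<epsilon>"
  shows "hausdorff_pre k \<delta> A + hausdorff_pre k \<delta> B \<le> hausdorff_pre k \<delta> (A \<union> B)"
proof (rule hausdorff_pre_greatest)
  fix U :: "nat \<Rightarrow> 'a set"
  assume U: "A \<union> B \<subseteq> (\<Union>i. U i)" "\<And>i. bounded (U i)" "\<And>i. diameter (U i) \<le> \<delta>"
  define V where "V D i = (if U i \<inter> D = {} then {} else U i)" for D i
  have *: "hausdorff_pre k \<delta> D \<le> (\<Sum>i. hausdorff_term k (V D i))" if "D \<subseteq> A \<union> B" for D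
    using U that \<open>0 \<le> \<delta>\<close> by (intro hausdorff_pre_le) (auto simp: V_def, blast)
  have "hausdorff_term k (V A i) + hausdorff_term k (V B i) \<le> hausdorff_term k (U i)" for i
  proof -
    have "U i \<inter> A = {} \<or> U i \<inter> B = {}"
    proof (rule ccontr)
      assume "\<not> ?thesis"
      then obtain a b where ab: "a \<in> U i" "a \<in> A" "b \<in> U i" "b \<in> B" by auto
      then have "dist a b \<le> \<delta>"
        using diameter_bounded_bound[OF U(2) ab(1,3)] U(3)[of i] by linarith
      then show False using assms(1)[OF ab(2,4)] assms(3) by linarith
    qed
    then show ?thesis by (auto simp: V_def)
  qed
  then have "(\<Sum>i. hausdorff_term k (V A i) + hausdorff_term k (V B i)) \<le> (\<Sum>i. hausdorff_term k (U i))"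
    by (intro suminf_le) auto
  then show "hausdorff_pre k \<delta> A + hausdorff_pre k \<delta> B \<le> (\<Sum>i. hausdorff_term k (U i))"
    using add_mono[OF *[of A] *[of B]] by (simp add: suminf_add) 
qed

lemma hausdorff_pre_le_outer: "0 < \<delta> \<Longrightarrow> hausdorff_pre k \<delta> A \<le> hausdorff_outer k A"
  unfolding hausdorff_outer_def by (auto intro: SUP_upper)

lemma hausdorff_outer_least:
  "(\<And>\<delta>. 0 < \<delta> \<Longrightarrow> hausdorff_pre k \<delta> A \<le> c) \<Longrightarrow> hausdorff_outer k A \<le> c"
  unfolding hausdorff_outer_def by (auto intro: SUP_least)

lemma hausdorff_outer_empty: "hausdorff_outer k {} = 0"
  by (metis hausdorff_outer_least hausdorff_pre_empty le_zero_eq less_imp_le order_refl)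

lemma hausdorff_outer_mono: "A \<subseteq> B \<Longrightarrow> hausdorff_outer k A \<le> hausdorff_outer k B"
  by (meson hausdorff_outer_least hausdorff_pre_le_outer hausdorff_pre_mono order_trans)

lemma hausdorff_outer_countably_subadditive:
  "hausdorff_outer k (\<Union>i. A i) \<le> (\<Sum>i. hausdorff_outer k (A i))"
proof (rule hausdorff_outer_least)
  fix \<delta> :: real assume "0 < \<delta>"
  have "hausdorff_pre k \<delta> (\<Union>i. A i) \<le> (\<Sum>i. hausdorff_pre k \<delta> (A i))"
    by (rule hausdorff_pre_countably_subadditive)
  also have "\<dots> \<le> (\<Sum>i. hausdorff_outer k (A i))"
    using \<open>0 < \<delta>\<close> by (intro suminf_le hausdorff_pre_le_outer) auto
  finally show "hausdorff_pre k \<delta> (\<Union>i. A i) \<le> (\<Sum>i. hausdorff_outer k (A i))" .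
qed

text \<open>The two suprema run over independent gauges. A gauge below both of them and below
  \<open>\<epsilon>\<close> reduces the claim to separated sets at one scale, since the pre-measure
  grows as the gauge shrinks.\<close>

lemma hausdorff_outer_separated:
  assumes "0 < \<epsilon>" "\<And>a b. \<lbrakk>a \<in> A; b \<in> B\<rbrakk> \<Longrightarrow> \<epsilon> \<le> dist a b"
  shows "hausdorff_outer k A + hausdorff_outer k B \<le> hausdorff_outer k (A \<union> B)"
proof -
  have "hausdorff_pre k \<delta> A + hausdorff_pre k \<delta>' B \<le> hausdorff_outer k (A \<union> B)"
    if "0 < \<delta>" "0 < \<delta>'" for \<delta> \<delta>'
  proof -
    define \<gamma> where "\<gamma> = min (min \<delta> \<delta>') (\<epsilon> / 2)"
    have \<gamma>: "0 < \<gamma>" "\<gamma> \<le> \<delta>" "\<gamma> \<le> \<delta>'" "\<gamma> < \<epsilon>" using that \<open>0 < \<epsilon>\<close> by (auto simp: \<gamma>_def)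
    have "hausdorff_pre k \<delta> A + hausdorff_pre k \<delta>' B \<le> hausdorff_pre k \<gamma> A + hausdorff_pre k \<gamma> B"
      using \<gamma> by (intro add_mono hausdorff_pre_antimono)
    also have "\<dots> \<le> hausdorff_pre k \<gamma> (A \<union> B)"
      using \<gamma> assms(2) by (intro hausdorff_pre_separated[of A B \<epsilon>]) auto
    also have "\<dots> \<le> hausdorff_outer k (A \<union> B)"
      using \<gamma>(1) by (rule hausdorff_pre_le_outer)
    finally show ?thesis .
  qed
  then have "(SUP \<delta>\<in>{0<..}. SUP \<delta>'\<in>{0<..}. hausdorff_pre k \<delta> A + hausdorff_pre k \<delta>' B)
      \<le> hausdorff_outer k (A \<union> B)"
    by (intro SUP_least) auto
  then show ?thesis
    by (simp add: hausdorff_outer_def[of k A] hausdorff_outer_def[of k B]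
        ennreal_SUP_add_left ennreal_SUP_add_right[symmetric])
qed

text \<open>\<open>measure_of\<close> yields the given set function only if it is a measure on the
  given sigma-algebra, and zero otherwise. Caratheodory's theorem supplies this: the measurable sets
  form a sigma-algebra containing the closed sets, hence the Borel sets.\<close>

lemma emeasure_hausdorff_measure:
  fixes A :: "'a::metric_space set"
  assumes "A \<in> sets borel"
  shows "emeasure (hausdorff_measure k) A = hausdorff_outer k A"
proof -
  let ?L = "lambda_system UNIV UNIV (hausdorff_outer k :: 'a set \<Rightarrow> ennreal)"
  have oms: "outer_measure_space UNIV (hausdorff_outer k :: 'a set \<Rightarrow> ennreal)"
    unfolding outer_measure_space_def positive_def increasing_def countably_subadditive_def
    by (auto simp: hausdorff_outer_empty hausdorff_outer_mono hausdorff_outer_countably_subadditive)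
  interpret sigma_algebra UNIV "UNIV :: 'a set set"
    using sigma_algebra_Pow[of "UNIV :: 'a set"] by simp
  have L: "measure_space UNIV ?L (hausdorff_outer k)"
    by (rule caratheodory_lemma[OF oms])
  then interpret L: sigma_algebra UNIV ?L
    by (simp add: measure_space_def)
  have "C \<in> ?L" if "closed C" for C
    by (rule metric_outer_measure_lambda_closed[OF hausdorff_outer_empty hausdorff_outer_mono
          hausdorff_outer_countably_subadditive hausdorff_outer_separated that])
  then have "sigma_sets UNIV (Collect closed) \<subseteq> ?L"
    by (intro L.sigma_sets_subset) auto
  then have "sets (borel :: 'a measure) \<subseteq> ?L"
    by (simp add: borel_eq_closed)
  then have "measure_space UNIV (sets borel) (hausdorff_outer k :: 'a set \<Rightarrow> ennreal)"
    by (intro measure_down[OF L]) (metis sets.sigma_algebra_axioms space_borel)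
  then show ?thesis
    unfolding hausdorff_measure_def measure_space_def
    using assms by (intro emeasure_measure_of_sigma) (auto simp: positive_def)
qed

lemma sets_hausdorff_measure [simp, measurable_cong]: "sets (hausdorff_measure k) = sets borel"
  unfolding hausdorff_measure_def by (metis sets.sets_measure_of_eq space_borel)

lemma space_hausdorff_measure [simp]: "space (hausdorff_measure k) = UNIV"
  using sets_eq_imp_space_eq[OF sets_hausdorff_measure] by simp

subsection \<open>Sweeping a hypersurface along a curve\<close>

text \<open>Every set has a measurable hull of the same outer measure, and subadditivity of the
  measure is applied to the hulls.\<close>

lemma outer_measure_of_UN:
  assumes "\<And>i. A i \<subseteq> space M"
  shows "outer_measure_of M (\<Union>i::nat. A i) \<le> (\<Sum>i. outer_measure_of M (A i))"
proof -
  obtain E where E: "\<And>i. E i \<in> sets M" "\<And>i. A i \<subseteq> E i" "\<And>i. outer_measure_of M (A i) = emeasure M (E i)"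
    using outer_measure_of_attain[OF assms] by metis
  have "outer_measure_of M (\<Union>i. A i) \<le> outer_measure_of M (\<Union>i. E i)"
    using E(2) by (intro outer_measure_of_mono) blast
  also have "\<dots> = emeasure M (\<Union>i. E i)"
    using E(1) by (intro outer_measure_of_eq) auto
  also have "\<dots> \<le> (\<Sum>i. outer_measure_of M (A i))"
    unfolding E(3) using E(1) by (intro emeasure_subadditive_countably) auto
  finally show ?thesis .
qed

lemma outer_measure_of_finite_UN:
  assumes "finite I" "\<And>i. i \<in> I \<Longrightarrow> A i \<subseteq> space M"
  shows "outer_measure_of M (\<Union>i\<in>I. A i) \<le> (\<Sum>i\<in>I. outer_measure_of M (A i))"
proof -
  have "\<exists>E\<in>sets M. A i \<subseteq> E \<and> outer_measure_of M (A i) = emeasure M E" if "i \<in> I" for i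
    using outer_measure_of_attain[OF assms(2)[OF that]] .
  then obtain E where E: "\<And>i. i \<in> I \<Longrightarrow> E i \<in> sets M" "\<And>i. i \<in> I \<Longrightarrow> A i \<subseteq> E i"
    "\<And>i. i \<in> I \<Longrightarrow> outer_measure_of M (A i) = emeasure M (E i)"
    by metis
  have "outer_measure_of M (\<Union>i\<in>I. A i) \<le> outer_measure_of M (\<Union>i\<in>I. E i)"
    using E(2) by (intro outer_measure_of_mono) blast
  also have "\<dots> = emeasure M (\<Union>i\<in>I. E i)"
    using E(1) assms(1) by (intro outer_measure_of_eq) auto
  also have "\<dots> \<le> (\<Sum>i\<in>I. emeasure M (E i))"
    using E(1) assms(1) by (intro emeasure_subadditive_finite) auto
  finally show ?thesis using E(3) by simp
qed

text \<open>Serves two limits: from \<open>d > diameter U\<close> to a diameter that may be 0, where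
  cutting time into pieces of length \<open>d\<close> is impossible, and from a positive gauge
  \<open>\<delta>\<close> to 0.\<close>

lemma ennreal_le_at_right:
  fixes g :: "real \<Rightarrow> real"
  assumes "\<And>d. D < d \<Longrightarrow> c \<le> ennreal (g d)" "isCont g D"
  shows "c \<le> ennreal (g D)"
proof (rule tendsto_lowerbound)
  show "((\<lambda>d. ennreal (g d)) \<longlongrightarrow> ennreal (g D)) (at_right D)"
    using assms(2) by (intro tendsto_ennrealI) (auto simp: isCont_def intro: filterlim_at_split[THEN iffD1, THEN conjunct2])
  show "\<forall>\<^sub>F d in at_right D. c \<le> ennreal (g d)"
    using assms(1) by (auto simp: eventually_at_filter)
qed simp

text \<open>Traces characteristics back: with \<open>X\<close> normalised to vanish at a reference
  time, the point of space-time is sent to the position that its characteristic has at that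
  time.\<close>

definition sweep :: "(real \<Rightarrow> 'a::euclidean_space) \<Rightarrow> 'a \<times> real \<Rightarrow> 'a" where
  "sweep X = (\<lambda>(y, \<tau>). y - X \<tau>)"

text \<open>Cutting the time interval into pieces of length \<open>d\<close>, each piece of the sweep lies in a ball of
  radius \<open>(1 + L) d\<close>; their number is of order \<open>1 / d\<close>, which turns \<open>d ^ DIM('a)\<close> into \<open>d ^ (DIM('a) - 1)\<close>.\<close>

lemma outer_measure_sweep_small:
  fixes X :: "real \<Rightarrow> 'a::euclidean_space"
  assumes "a \<le> b" "0 \<le> L" and lip: "\<And>\<sigma> \<tau>. \<lbrakk>\<sigma> \<in> {a..b}; \<tau> \<in> {a..b}\<rbrakk> \<Longrightarrow> norm (X \<sigma> - X \<tau>) \<le> L * \<bar>\<sigma> - \<tau>\<bar>"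
    and "bounded U" "diameter U \<le> d" "0 < d"
  shows "outer_measure_of lborel (sweep X ` (U \<times> {a..b}))
    \<le> ennreal ((b - a + d) * (unit_ball_vol (real DIM('a)) * (1 + L) ^ DIM('a) * d ^ (DIM('a) - 1)))"
proof (cases "U = {}")
  case True
  then show ?thesis by simp
next
  case False
  then obtain u0 where u0: "u0 \<in> U" by auto
  \<comment> \<open>One piece more than the number of full pieces, for the incomplete last one; this
    is the origin of the summand \<open>d\<close> in \<open>b - a + d\<close>.\<close>
  define N where "N = Suc (nat \<lfloor>(b - a) / d\<rfloor>)"
  \<comment> \<open>The \<open>min b\<close> keeps the sampling time inside the interval, where the
    Lipschitz bound is available. One \<open>d\<close> in the radius comes from the diameter of
    \<open>U\<close>, and \<open>L * d\<close> from the motion during a piece.\<close>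
  define B where "B l = cball (u0 - X (min b (a + real l * d))) ((1 + L) * d)" for l
  have N: "real N * d \<le> b - a + d"
  proof -
    have "real N \<le> (b - a) / d + 1"
      using assms by (simp add: N_def)
    then have "real N * d \<le> ((b - a) / d + 1) * d"
      using assms by (intro mult_right_mono) auto
    also have "\<dots> = b - a + d" using assms by (simp add: distrib_right)
    finally show ?thesis .
  qed
  have "sweep X ` (U \<times> {a..b}) \<subseteq> (\<Union>l<N. B l)"
  proof (clarsimp simp: sweep_def)
    fix y \<tau> assume y: "y \<in> U" and \<tau>: "a \<le> \<tau>" "\<tau> \<le> b"
    define l where "l = nat \<lfloor>(\<tau> - a) / d\<rfloor>"
    have "real l \<le> (\<tau> - a) / d" "(\<tau> - a) / d < real l + 1"
      using \<tau> \<open>0 < d\<close> by (auto simp: l_def)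
    then have l: "real l * d \<le> \<tau> - a" "\<tau> - a \<le> real l * d + d"
      using \<open>0 < d\<close> by (auto simp: field_simps)
    have "l < N" using \<tau> \<open>0 < d\<close>
      unfolding N_def l_def less_Suc_eq_le by (intro nat_mono floor_mono divide_right_mono) auto
    moreover have "y - X \<tau> \<in> B l"
    proof -
      have "norm (X \<tau> - X (min b (a + real l * d))) \<le> L * \<bar>\<tau> - min b (a + real l * d)\<bar>"
        using \<tau> \<open>0 < d\<close> assms(1) by (intro lip) auto
      also have "\<dots> \<le> L * d"
        using \<tau> l \<open>0 \<le> L\<close> by (intro mult_left_mono) auto
      finally have "norm (X \<tau> - X (min b (a + real l * d))) \<le> L * d" .
      moreover have "norm (y - u0) \<le> d"
        using diameter_bounded_bound[OF \<open>bounded U\<close> y u0] \<open>diameter U \<le> d\<close> by (simp add: dist_norm)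
      moreover have "norm ((u0 - X (min b (a + real l * d))) - (y - X \<tau>))
          \<le> norm (y - u0) + norm (X \<tau> - X (min b (a + real l * d)))"
        using norm_triangle_ineq4[of "X \<tau> - X (min b (a + real l * d))" "y - u0"]
        by (simp add: algebra_simps)
      ultimately show ?thesis by (simp add: B_def dist_norm algebra_simps)
    qed
    ultimately show "\<exists>l\<in>{..<N}. y - X \<tau> \<in> B l" by auto
  qed
  then have "outer_measure_of lborel (sweep X ` (U \<times> {a..b})) \<le> outer_measure_of lborel (\<Union>l<N. B l)"
    by (rule outer_measure_of_mono)
  also have "\<dots> \<le> (\<Sum>l<N. outer_measure_of lborel (B l))"
    by (intro outer_measure_of_finite_UN) auto
  also have "\<dots> = (\<Sum>l<N. ennreal (unit_ball_vol (real DIM('a)) * ((1 + L) * d) ^ DIM('a)))"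
    using assms by (intro sum.cong refl) (auto simp: B_def emeasure_cball)
  also have "\<dots> = ennreal (real N * (unit_ball_vol (real DIM('a)) * ((1 + L) * d) ^ DIM('a)))"
    using assms by (simp add: ennreal_mult ennreal_of_nat_eq_real_of_nat)
  also have "\<dots> \<le> ennreal ((b - a + d) * (unit_ball_vol (real DIM('a)) * (1 + L) ^ DIM('a) * d ^ (DIM('a) - 1)))"
  proof (rule ennreal_leI)
    have "d ^ DIM('a) = d * d ^ (DIM('a) - 1)"
      by (metis DIM_positive Suc_diff_1 power_Suc)
    then have "real N * (unit_ball_vol (real DIM('a)) * ((1 + L) * d) ^ DIM('a))
        = (real N * d) * (unit_ball_vol (real DIM('a)) * (1 + L) ^ DIM('a) * d ^ (DIM('a) - 1))"
      by (simp add: power_mult_distrib)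
    also have "\<dots> \<le> (b - a + d) * (unit_ball_vol (real DIM('a)) * (1 + L) ^ DIM('a) * d ^ (DIM('a) - 1))"
      using assms by (intro mult_right_mono[OF N]) auto
    finally show "real N * (unit_ball_vol (real DIM('a)) * ((1 + L) * d) ^ DIM('a))
      \<le> (b - a + d) * (unit_ball_vol (real DIM('a)) * (1 + L) ^ DIM('a) * d ^ (DIM('a) - 1))" .
  qed
  finally show ?thesis .
qed

text \<open>Volume of a ball of radius \<open>(1 + L) * d\<close> compared with \<open>d\<close>
  times the Hausdorff weight of a set of diameter \<open>d\<close> in codimension one; the power of
  2 undoes the halving of the diameter in that weight.\<close>

definition sweep_const :: "'a::euclidean_space itself \<Rightarrow> real \<Rightarrow> real" where
  "sweep_const _ L = unit_ball_vol (real DIM('a)) * (1 + L) ^ DIM('a) * 2 ^ (DIM('a) - 1)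
     / unit_ball_vol (real (DIM('a) - 1))"

lemma sweep_const_pos: "0 \<le> L \<Longrightarrow> 0 < sweep_const TYPE('a::euclidean_space) L"
  by (auto simp: sweep_const_def)

text \<open>In the length factor the diameter is enlarged to the gauge \<open>\<delta>\<close>, so
  that the same factor serves every member of a cover; in the power it is kept, which makes the
  Hausdorff summand appear.\<close>

lemma outer_measure_sweep_term:
  fixes X :: "real \<Rightarrow> 'a::euclidean_space"
  assumes "a \<le> b" "0 \<le> L" and lip: "\<And>\<sigma> \<tau>. \<lbrakk>\<sigma> \<in> {a..b}; \<tau> \<in> {a..b}\<rbrakk> \<Longrightarrow> norm (X \<sigma> - X \<tau>) \<le> L * \<bar>\<sigma> - \<tau>\<bar>"
    and "bounded U" "diameter U \<le> \<delta>"
  shows "outer_measure_of lborel (sweep X ` (U \<times> {a..b}))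
    \<le> ennreal ((b - a + \<delta>) * sweep_const TYPE('a) L) * hausdorff_term (DIM('a) - 1) U"
proof (cases "U = {}")
  case True
  then show ?thesis by simp
next
  case False
  have D: "0 \<le> diameter U" using \<open>bounded U\<close> by (rule diameter_ge_0)
  have "outer_measure_of lborel (sweep X ` (U \<times> {a..b}))
    \<le> ennreal ((b - a + diameter U) * (unit_ball_vol (real DIM('a)) * (1 + L) ^ DIM('a) * diameter U ^ (DIM('a) - 1)))"
  proof (rule ennreal_le_at_right[where g="\<lambda>d. (b - a + d) * (unit_ball_vol (real DIM('a)) * (1 + L) ^ DIM('a) * d ^ (DIM('a) - 1))"])
    fix d assume "diameter U < d"
    then show "outer_measure_of lborel (sweep X ` (U \<times> {a..b}))
      \<le> ennreal ((b - a + d) * (unit_ball_vol (real DIM('a)) * (1 + L) ^ DIM('a) * d ^ (DIM('a) - 1)))"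
      using D assms by (intro outer_measure_sweep_small) auto
  qed (intro continuous_intros)
  also have "\<dots> \<le> ennreal ((b - a + \<delta>) * (unit_ball_vol (real DIM('a)) * (1 + L) ^ DIM('a) * diameter U ^ (DIM('a) - 1)))"
    using assms D by (intro ennreal_leI mult_right_mono) auto
  also have "\<dots> = ennreal (((b - a + \<delta>) * sweep_const TYPE('a) L) *
      (unit_ball_vol (real (DIM('a) - 1)) * (diameter U / 2) ^ (DIM('a) - 1)))"
  proof -
    have v: "c * p * 2 ^ k / v * (v * (d / 2) ^ k) = c * p * d ^ k" if "0 < v" for c p v d :: real and k
      using that by (simp add: power_divide)
    show ?thesis
      unfolding sweep_const_def mult.assoc[of "b - a + \<delta>"] v[OF unit_ball_vol_pos[OF of_nat_0_le_iff]] ..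
  qed
  also have "\<dots> = ennreal ((b - a + \<delta>) * sweep_const TYPE('a) L) * hausdorff_term (DIM('a) - 1) U"
    unfolding hausdorff_term_def using False assms D sweep_const_pos[where 'a='a, of L]
    by (subst ennreal_mult) auto
  finally show ?thesis .
qed

text \<open>The factor common to all members of a cover leaves the sum, the infimum over covers
  gives the pre-measure, and the gauge tends to 0. With \<open>a = b\<close> the bound shows that a
  single time slice sweeps a null set.\<close>

lemma outer_measure_sweep_le:
  fixes X :: "real \<Rightarrow> 'a::euclidean_space"
  assumes "a \<le> b" "0 \<le> L" and lip: "\<And>\<sigma> \<tau>. \<lbrakk>\<sigma> \<in> {a..b}; \<tau> \<in> {a..b}\<rbrakk> \<Longrightarrow> norm (X \<sigma> - X \<tau>) \<le> L * \<bar>\<sigma> - \<tau>\<bar>"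
    and fin: "hausdorff_outer (DIM('a) - 1) B < top"
  shows "outer_measure_of lborel (sweep X ` (B \<times> {a..b}))
    \<le> ennreal ((b - a) * sweep_const TYPE('a) L) * hausdorff_outer (DIM('a) - 1) B"
proof -
  obtain h where h: "0 \<le> h" "hausdorff_outer (DIM('a) - 1) B = ennreal h"
    using fin by (cases "hausdorff_outer (DIM('a) - 1) B") auto
  have K: "0 < sweep_const TYPE('a) L" using sweep_const_pos assms by blast
  have "outer_measure_of lborel (sweep X ` (B \<times> {a..b}))
      \<le> ennreal ((b - a + \<delta>) * sweep_const TYPE('a) L * h)" if "0 < \<delta>" for \<delta>
  proof -
    let ?K = "(b - a + \<delta>) * sweep_const TYPE('a) L"
    have "?K > 0" using that assms K by auto
    \<comment> \<open>The factor is divided out because the pre-measure is an infimum: a lower bound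
      for each covering sum is a lower bound for it.\<close>
    have "outer_measure_of lborel (sweep X ` (B \<times> {a..b})) / ennreal ?K \<le> hausdorff_pre (DIM('a) - 1) \<delta> B"
    proof (rule hausdorff_pre_greatest)
      fix U :: "nat \<Rightarrow> 'a set"
      assume U: "B \<subseteq> (\<Union>i. U i)" "\<And>i. bounded (U i)" "\<And>i. diameter (U i) \<le> \<delta>"
      have "outer_measure_of lborel (sweep X ` (B \<times> {a..b})) \<le> outer_measure_of lborel (\<Union>i. sweep X ` (U i \<times> {a..b}))"
        unfolding image_UN[symmetric] using U(1) by (intro outer_measure_of_mono image_mono) auto
      also have "\<dots> \<le> (\<Sum>i. outer_measure_of lborel (sweep X ` (U i \<times> {a..b})))"
        by (intro outer_measure_of_UN) auto
      also have "\<dots> \<le> (\<Sum>i. ennreal ?K * hausdorff_term (DIM('a) - 1) (U i))"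
        using U assms by (intro suminf_le outer_measure_sweep_term) auto
      also have "\<dots> = ennreal ?K * (\<Sum>i. hausdorff_term (DIM('a) - 1) (U i))"
        by simp
      finally show "outer_measure_of lborel (sweep X ` (B \<times> {a..b})) / ennreal ?K
          \<le> (\<Sum>i. hausdorff_term (DIM('a) - 1) (U i))"
        using \<open>?K > 0\<close> by (intro divide_le_posI_ennreal) auto
    qed
    also have "\<dots> \<le> ennreal h" using hausdorff_pre_le_outer[OF that] h by metis
    finally have le: "outer_measure_of lborel (sweep X ` (B \<times> {a..b})) / ennreal ?K \<le> ennreal h" .
    moreover have "ennreal ?K / ennreal ?K = 1"
      using \<open>?K > 0\<close> by (intro ennreal_divide_self) auto
    ultimately have "outer_measure_of lborel (sweep X ` (B \<times> {a..b})) = outer_measure_of lborel (sweep X ` (B \<times> {a..b})) / ennreal ?K * ennreal ?K"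
      by (simp only: ennreal_divide_times mult_1_right)
    also have "\<dots> \<le> ennreal h * ennreal ?K"
      by (rule mult_right_mono[OF le]) simp
    also have "\<dots> = ennreal (?K * h)"
      using ennreal_mult[of ?K h] \<open>?K > 0\<close> h(1) by (simp only: mult.commute less_imp_le)
    finally show ?thesis .
  qed
  then have "outer_measure_of lborel (sweep X ` (B \<times> {a..b}))
      \<le> ennreal ((b - a + 0) * sweep_const TYPE('a) L * h)"
    by (rule ennreal_le_at_right) (assumption, intro continuous_intros)
  also have "\<dots> = ennreal ((b - a) * sweep_const TYPE('a) L) * ennreal h"
    using h(1) assms(1) K ennreal_mult[of "(b - a) * sweep_const TYPE('a) L" h] by simp
  finally show ?thesis
    using h(2) by simp
qed

subsection \<open>Smooth boundaries have finite surface measure\<close>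

lemma hausdorff_pre_finite_le:
  assumes "finite I" "A \<subseteq> (\<Union>i\<in>I. U i)" "\<And>i. i \<in> I \<Longrightarrow> bounded (U i)"
    "\<And>i. i \<in> I \<Longrightarrow> diameter (U i) \<le> \<delta>" "0 \<le> \<delta>"
  shows "hausdorff_pre k \<delta> A \<le> (\<Sum>i\<in>I. hausdorff_term k (U i))"
proof -
  obtain h where h: "bij_betw h {0..<card I} I"
    using ex_bij_betw_nat_finite[OF \<open>finite I\<close>] by blast
  define V where "V n = (if n < card I then U (h n) else {})" for n
  have hI: "h n \<in> I" if "n < card I" for n
    using bij_betwE[OF h] that by auto
  have "hausdorff_pre k \<delta> A \<le> (\<Sum>n. hausdorff_term k (V n))"
  proof (rule hausdorff_pre_le)
    show "A \<subseteq> (\<Union>n. V n)"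
    proof
      fix y assume "y \<in> A"
      then obtain i where "i \<in> I" "y \<in> U i" using assms(2) by auto
      moreover obtain n where "n < card I" "i = h n"
        using bij_betw_imp_surj_on[OF h] \<open>i \<in> I\<close> by (metis atLeastLessThan_iff imageE)
      ultimately have "y \<in> V n" by (simp add: V_def)
      then show "y \<in> (\<Union>n. V n)" by blast
    qed
  qed (use assms hI diameter_empty in \<open>auto simp: V_def\<close>)
  also have "\<dots> = (\<Sum>n\<in>{0..<card I}. hausdorff_term k (V n))"
    by (intro suminf_finite) (auto simp: V_def)
  also have "\<dots> = (\<Sum>n\<in>{0..<card I}. hausdorff_term k (U (h n)))"
    by (intro sum.cong) (auto simp: V_def)
  also have "\<dots> = (\<Sum>i\<in>I. hausdorff_term k (U i))"
    using h by (rule sum.reindex_bij_betw)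
  finally show ?thesis .
qed

text \<open>A grid of mesh \<open>1 / N\<close> in the coordinates other than \<open>e\<close> cuts
  the graph into pieces of diameter of order \<open>1 / N\<close>. There are of order
  \<open>N ^ k\<close> of them with \<open>k = DIM('a) - 1\<close>, so the covering sums stay
  bounded as the mesh shrinks.\<close>

lemma hausdorff_outer_lipschitz_graph:
  fixes A :: "'a::euclidean_space set" and f :: "'a \<Rightarrow> real"
  assumes R: "\<And>y. y \<in> A \<Longrightarrow> norm y \<le> R" and "0 \<le> R" "0 \<le> L"
    and lip: "\<And>y z. \<lbrakk>norm y \<le> R; norm z \<le> R\<rbrakk> \<Longrightarrow> \<bar>f y - f z\<bar> \<le> L * norm (y - z)"
    and e: "e \<in> Basis \<or> - e \<in> Basis" and inv: "\<And>y c. f (y + c *\<^sub>R e) = f y"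
    and graph: "\<And>y. y \<in> A \<Longrightarrow> f y = y \<bullet> e"
  shows "hausdorff_outer (DIM('a) - 1) A < top"
proof -
  define b0 where "b0 = (if e \<in> Basis then e else - e)"
  have b0: "b0 \<in> Basis" using e by (auto simp: b0_def)
  have e_b0: "e = b0 \<or> e = - b0" by (auto simp: b0_def)
  have norm_e: "norm e = 1" using e_b0 b0 by auto
  define J where "J = Basis - {b0}"
  have J: "finite J" "card J = DIM('a) - 1" using b0 by (auto simp: J_def)
  have ortho: "e \<bullet> b = 0" if "b \<in> J" for b
    using that b0 e_b0 by (auto simp: J_def inner_Basis)
  \<comment> \<open>Orthogonal projection along \<open>e\<close>. Translation invariance gives
    \<open>f (p y) = f y\<close>, so the height on the graph is controlled by the projected
    distance.\<close>
  define p where "p y = y - (y \<bullet> e) *\<^sub>R e" for y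
  have p_b0: "p y \<bullet> b0 = 0" for y
    using e_b0 b0 by (auto simp: p_def inner_diff_left)
  have p_J: "p y \<bullet> b = y \<bullet> b" if "b \<in> J" for y b
    using ortho[OF that] by (simp add: p_def inner_diff_left)
  have p_diff: "p y - p z = p (y - z)" for y z
    by (simp add: p_def inner_diff_left algebra_simps)
  have p_norm: "norm (p y) \<le> norm y" for y
  proof -
    have "(norm (p y))\<^sup>2 = (norm y)\<^sup>2 - (y \<bullet> e)\<^sup>2"
      using norm_e unfolding power2_norm_eq_inner p_def norm_eq_1
      by (simp add: inner_diff_left inner_diff_right inner_commute power2_eq_square)
    then have "(norm (p y))\<^sup>2 \<le> (norm y)\<^sup>2" by simp
    then show ?thesis by (rule power2_le_imp_le) simp
  qed
  have f_p: "f (p y) = f y" for y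
    using inv[of y "- (y \<bullet> e)"] by (simp add: p_def)
  define k where "k = DIM('a) - 1"
  \<comment> \<open>The projected distance within a cell is at most \<open>DIM('a) / N\<close> by
    the l1 norm, and the height differs by at most \<open>L\<close> times that.\<close>
  define D where "D = (1 + L) * DIM('a)"
  have "0 < D" using \<open>0 \<le> L\<close> by (simp add: D_def)
  \<comment> \<open>The number of cells is at most \<open>(N * (2 * R + 3)) ^ k\<close>, and a piece
    of diameter \<open>D / N\<close> weighs a multiple of \<open>N\<close> to the power
    \<open>- k\<close>; the powers of \<open>N\<close> cancel. The 3 covers rounding, using
    \<open>1 \<le> N\<close>.\<close>
  define C where "C = (2 * R + 3) ^ k * (unit_ball_vol (real k) * (D / 2) ^ k)"
  have "hausdorff_pre k \<delta> A \<le> ennreal C" if "0 < \<delta>" for \<delta>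
  proof -
    define N where "N = Suc (nat \<lceil>D / \<delta>\<rceil>)"
    have N: "1 \<le> real N" "0 < real N" by (auto simp: N_def)
    have "D / \<delta> \<le> real N" by (simp add: N_def) linarith
    then have ND: "D / real N \<le> \<delta>" using \<open>0 < \<delta>\<close> N by (simp add: field_simps)
    define M where "M = \<lceil>real N * R\<rceil>"
    define Z where "Z = (J \<rightarrow>\<^sub>E {- M..M})"
    \<comment> \<open>The part of \<open>A\<close> over one grid cell, which is named by the integer
      parts of the scaled coordinates.\<close>
    define U where "U z = {y \<in> A. \<forall>b\<in>J. \<lfloor>real N * (y \<bullet> b)\<rfloor> = z b}" for z
    have "finite Z" unfolding Z_def using J by (intro finite_PiE) auto
    have cov: "A \<subseteq> (\<Union>z\<in>Z. U z)"
    proof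
      fix y assume y: "y \<in> A"
      have "\<lfloor>real N * (y \<bullet> b)\<rfloor> \<in> {- M..M}" if "b \<in> J" for b
      proof -
        have "\<bar>y \<bullet> b\<bar> \<le> norm y" using that by (intro Basis_le_norm) (auto simp: J_def)
        then have "real N * \<bar>y \<bullet> b\<bar> \<le> real N * R"
          using R[OF y] by (intro mult_left_mono) auto
        then have "\<bar>real N * (y \<bullet> b)\<bar> \<le> real N * R" by (simp add: abs_mult)
        then show ?thesis by (auto simp: M_def) linarith+
      qed
      then have "restrict (\<lambda>b. \<lfloor>real N * (y \<bullet> b)\<rfloor>) J \<in> Z" by (auto simp: Z_def)
      moreover have "y \<in> U (restrict (\<lambda>b. \<lfloor>real N * (y \<bullet> b)\<rfloor>) J)" using y by (auto simp: U_def)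
      ultimately show "y \<in> (\<Union>z\<in>Z. U z)" by blast
    qed
    have bdd: "bounded (U z)" for z
      using R by (auto simp: U_def bounded_iff)
    have diam: "diameter (U z) \<le> D / real N" for z
    proof (rule diameter_le)
      show "U z \<noteq> {} \<or> 0 \<le> D / real N" using \<open>0 < D\<close> by simp
      fix x y assume x: "x \<in> U z" and y: "y \<in> U z"
      then have xA: "x \<in> A" "y \<in> A" by (auto simp: U_def)
      have "\<bar>(x - y) \<bullet> b\<bar> \<le> 1 / real N" if "b \<in> J" for b
      proof -
        have "\<lfloor>real N * (x \<bullet> b)\<rfloor> = \<lfloor>real N * (y \<bullet> b)\<rfloor>" using x y that by (auto simp: U_def)
        then have "\<bar>real N * (x \<bullet> b) - real N * (y \<bullet> b)\<bar> \<le> 1" by linarith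
        then have "real N * \<bar>(x - y) \<bullet> b\<bar> \<le> 1"
          by (simp add: inner_diff_left abs_mult right_diff_distrib[symmetric])
        then show ?thesis using N by (simp add: field_simps)
      qed
      then have "(\<Sum>b\<in>J. \<bar>p (x - y) \<bullet> b\<bar>) \<le> (\<Sum>b\<in>J. 1 / real N)"
        by (intro sum_mono) (auto simp: p_J)
      moreover have "(\<Sum>b\<in>Basis. \<bar>p (x - y) \<bullet> b\<bar>) = (\<Sum>b\<in>J. \<bar>p (x - y) \<bullet> b\<bar>)"
        using b0 p_b0 by (simp add: J_def sum.remove[of Basis b0])
      moreover have "norm (p (x - y)) \<le> (\<Sum>b\<in>Basis. \<bar>p (x - y) \<bullet> b\<bar>)" by (rule norm_le_l1)
      ultimately have "norm (p (x - y)) \<le> real (card J) / real N" by simp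
      also have "\<dots> \<le> DIM('a) / real N" using J by (intro divide_right_mono) auto
      finally have 1: "norm (p (x - y)) \<le> DIM('a) / real N" .
      have "\<bar>(x - y) \<bullet> e\<bar> = \<bar>f (p x) - f (p y)\<bar>"
        by (simp add: f_p graph xA inner_diff_left)
      also have "\<dots> \<le> L * norm (p x - p y)"
        using R[OF xA(1)] R[OF xA(2)] p_norm[of x] p_norm[of y] by (intro lip) auto
      also have "\<dots> \<le> L * (DIM('a) / real N)"
        unfolding p_diff using 1 \<open>0 \<le> L\<close> by (intro mult_left_mono)
      finally have 2: "\<bar>(x - y) \<bullet> e\<bar> \<le> L * (DIM('a) / real N)" .
      have "norm (x - y) = norm (p (x - y) + ((x - y) \<bullet> e) *\<^sub>R e)" by (simp add: p_def)
      also have "\<dots> \<le> norm (p (x - y)) + \<bar>(x - y) \<bullet> e\<bar>"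
        using norm_triangle_ineq[of "p (x - y)" "((x - y) \<bullet> e) *\<^sub>R e"] norm_e by simp
      also have "\<dots> \<le> D / real N" using add_mono[OF 1 2] by (simp add: D_def add_divide_distrib distrib_right)
      finally show "norm (x - y) \<le> D / real N" .
    qed
    have "hausdorff_pre k \<delta> A \<le> (\<Sum>z\<in>Z. hausdorff_term k (U z))"
      using \<open>finite Z\<close> cov bdd ND diam \<open>0 < \<delta>\<close>
      by (intro hausdorff_pre_finite_le) (auto intro: order_trans)
    also have "\<dots> \<le> (\<Sum>z\<in>Z. ennreal (unit_ball_vol (real k) * (D / real N / 2) ^ k))"
    proof (rule sum_mono)
      fix z
      show "hausdorff_term k (U z) \<le> ennreal (unit_ball_vol (real k) * (D / real N / 2) ^ k)"
        unfolding hausdorff_term_def using diam[of z] diameter_ge_0[OF bdd[of z]]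
        by (auto intro!: ennreal_leI mult_left_mono power_mono)
    qed
    also have "\<dots> = ennreal (real (card Z) * (unit_ball_vol (real k) * (D / real N / 2) ^ k))"
      using \<open>0 < D\<close> N by (simp add: ennreal_mult ennreal_of_nat_eq_real_of_nat)
    also have "\<dots> \<le> ennreal C"
    proof (rule ennreal_leI)
      have "0 \<le> real N * R" using \<open>0 \<le> R\<close> by simp
      then have "M \<ge> 0" by (simp add: M_def)
      have "real (card Z) = (real (nat (2 * M + 1))) ^ k"
        using J by (simp add: Z_def card_PiE k_def algebra_simps)
      also have "\<dots> \<le> (real N * (2 * R + 3)) ^ k"
      proof (rule power_mono)
        have "real_of_int M \<le> real N * R + 1" by (simp add: M_def)
        then have "real (nat (2 * M + 1)) \<le> 2 * real N * R + 3" using \<open>M \<ge> 0\<close> by simp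
        also have "\<dots> \<le> real N * (2 * R + 3)" using N by (simp add: algebra_simps)
        finally show "real (nat (2 * M + 1)) \<le> real N * (2 * R + 3)" .
      qed simp
      finally have "real (card Z) * (unit_ball_vol (real k) * (D / real N / 2) ^ k)
          \<le> (real N * (2 * R + 3)) ^ k * (unit_ball_vol (real k) * (D / real N / 2) ^ k)"
        using \<open>0 < D\<close> N by (intro mult_right_mono) auto
      also have "\<dots> = C"
        using N by (simp add: C_def power_mult_distrib power_divide)
      finally show "real (card Z) * (unit_ball_vol (real k) * (D / real N / 2) ^ k) \<le> C" .
    qed
    finally show ?thesis .
  qed
  then have "hausdorff_outer k A \<le> ennreal C"
    by (rule hausdorff_outer_least)
  also have "\<dots> < top" by simp
  finally show ?thesis by (simp add: k_def)
qed

section \<open>Smooth functions, and local charts of the boundary\<close>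

lemma smooth_differentiable: "smooth f \<Longrightarrow> f differentiable (at x)"
  unfolding smooth_def by (metis Ck.simps(2))

lemma smooth_continuous_partial:
  "smooth f \<Longrightarrow> b \<in> Basis \<Longrightarrow> continuous_on UNIV (\<lambda>x. frechet_derivative f (at x) b)"
  unfolding smooth_def by (metis Ck.simps)

lemma smooth_continuous: "smooth f \<Longrightarrow> continuous_on S f"
  unfolding smooth_def by (metis Ck.simps(1) continuous_on_subset subset_UNIV)

lemma continuous_on_grad: "smooth f \<Longrightarrow> continuous_on S (grad f)"
  unfolding grad_def[abs_def]
  by (intro continuous_intros continuous_on_subset[OF smooth_continuous_partial]) auto

lemma has_derivative_grad:
  fixes f :: "'a::euclidean_space \<Rightarrow> real"
  assumes "smooth f"
  shows "(f has_derivative (\<lambda>v. grad f x \<bullet> v)) (at x within S)"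
proof -
  have d: "(f has_derivative frechet_derivative f (at x)) (at x)"
    using smooth_differentiable[OF assms] by (simp add: frechet_derivative_works)
  then interpret linear "frechet_derivative f (at x)" by (rule has_derivative_linear)
  have "frechet_derivative f (at x) v = grad f x \<bullet> v" for v
  proof -
    have "frechet_derivative f (at x) v = frechet_derivative f (at x) (\<Sum>b\<in>Basis. (v \<bullet> b) *\<^sub>R b)"
      by (simp add: euclidean_representation)
    also have "\<dots> = grad f x \<bullet> v"
      by (simp add: sum scale grad_def inner_sum_left inner_sum_right inner_commute mult.commute)
    finally show ?thesis .
  qed
  then have "frechet_derivative f (at x) = (\<lambda>v. grad f x \<bullet> v)" by blast
  then show ?thesis using d has_derivative_at_withinI by metis
qed

text \<open>The gradient is bounded on the compact ball, and convexity of the ball gives the mean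
  value inequality.\<close>

lemma smooth_lipschitz_on_ball:
  fixes f :: "'a::euclidean_space \<Rightarrow> real"
  assumes "smooth f"
  obtains L where "0 \<le> L" "\<And>y z. \<lbrakk>norm y \<le> R; norm z \<le> R\<rbrakk> \<Longrightarrow> \<bar>f y - f z\<bar> \<le> L * norm (y - z)"
proof -
  have "compact (grad f ` cball 0 R)"
    by (intro compact_continuous_image continuous_on_grad assms compact_cball)
  then have "bounded (grad f ` cball 0 R)"
    by (rule compact_imp_bounded)
  then obtain L where L: "\<And>y. y \<in> cball 0 R \<Longrightarrow> norm (grad f y) \<le> L"
    unfolding bounded_iff by (metis imageI)
  have "\<bar>f y - f z\<bar> \<le> \<bar>L\<bar> * norm (y - z)" if "norm y \<le> R" "norm z \<le> R" for y z
  proof -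
    have "norm (f y - f z) \<le> \<bar>L\<bar> * norm (y - z)"
    proof (rule differentiable_bound)
      show "convex (cball (0::'a) R)" by simp
      show "(f has_derivative (\<lambda>v. grad f x \<bullet> v)) (at x within cball 0 R)" for x
        by (rule has_derivative_grad[OF assms])
      show "onorm (\<lambda>v. grad f x \<bullet> v) \<le> \<bar>L\<bar>" if "x \<in> cball 0 R" for x
      proof (rule onorm_le)
        fix v
        have "norm (grad f x \<bullet> v) \<le> norm (grad f x) * norm v" by (simp add: Cauchy_Schwarz_ineq2)
        also have "\<dots> \<le> \<bar>L\<bar> * norm v" using L[OF that] by (intro mult_right_mono) auto
        finally show "norm (grad f x \<bullet> v) \<le> \<bar>L\<bar> * norm v" .
      qed
    qed (use that in auto)
    then show ?thesis by simp
  qed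
  then show thesis by (intro that[of "\<bar>L\<bar>"]) auto
qed

text \<open>One inequality holds because a frontier point is outside the open set, the other because
  it is a limit of points of the set inside the chart.\<close>

lemma graph_chart_frontier:
  assumes "graph_chart \<Omega> x \<rho> e f" "open \<Omega>" "y \<in> frontier \<Omega>" "y \<in> ball x \<rho>"
  shows "f y = y \<bullet> e"
proof (rule antisym)
  have "smooth f" using assms(1) by (simp add: graph_chart_def)
  have eq: "\<Omega> \<inter> ball x \<rho> = {y \<in> ball x \<rho>. f y < y \<bullet> e}" using assms(1) by (simp add: graph_chart_def)
  have "y \<notin> \<Omega>" using assms(2,3) by (simp add: frontier_def interior_open)
  then show "y \<bullet> e \<le> f y" using eq assms(4) by force
  have "y \<in> closure (\<Omega> \<inter> ball x \<rho>)"
    using open_Int_closure_subset[OF open_ball, of x \<rho> \<Omega>] assms(3,4) by (auto simp: frontier_def Int_commute)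
  also have "\<dots> \<subseteq> {z. f z \<le> z \<bullet> e}"
    unfolding eq using smooth_continuous[OF \<open>smooth f\<close>, of UNIV]
    by (intro closure_minimal closed_Collect_le continuous_intros) auto
  finally show "f y \<le> y \<bullet> e" by simp
qed

text \<open>By compactness finitely many charts cover the frontier, and in each of them it lies on a
  Lipschitz graph.\<close>

lemma hausdorff_outer_frontier_finite:
  fixes \<Omega> :: "'a::euclidean_space set"
  assumes "open \<Omega>" "bounded \<Omega>" "smooth_boundary \<Omega>"
  shows "hausdorff_outer (DIM('a) - 1) (frontier \<Omega>) < top"
proof -
  have comp: "compact (frontier \<Omega>)" using assms(2) by (rule compact_frontier_bounded)
  obtain R where R: "0 < R" "\<And>y. y \<in> frontier \<Omega> \<Longrightarrow> norm y \<le> R"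
    using compact_imp_bounded[OF comp] by (auto simp: bounded_pos)
  have "\<exists>\<rho>>0. hausdorff_outer (DIM('a) - 1) (frontier \<Omega> \<inter> ball x \<rho>) < top" if x: "x \<in> frontier \<Omega>" for x
  proof -
    obtain \<rho> e f where c: "graph_chart \<Omega> x \<rho> e f"
      using assms(3) x unfolding smooth_boundary_def by blast
    then have f: "smooth f" "e \<in> Basis \<or> - e \<in> Basis" "\<And>y c. f (y + c *\<^sub>R e) = f y" "0 < \<rho>"
      by (auto simp: graph_chart_def)
    obtain L where L: "0 \<le> L" "\<And>y z. \<lbrakk>norm y \<le> R; norm z \<le> R\<rbrakk> \<Longrightarrow> \<bar>f y - f z\<bar> \<le> L * norm (y - z)"
      using smooth_lipschitz_on_ball[OF f(1)] by blast
    have "hausdorff_outer (DIM('a) - 1) (frontier \<Omega> \<inter> ball x \<rho>) < top"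
    proof (rule hausdorff_outer_lipschitz_graph[OF _ less_imp_le[OF R(1)] L(1) L(2) f(2) f(3)])
      show "norm y \<le> R" if "y \<in> frontier \<Omega> \<inter> ball x \<rho>" for y
        using R(2) that by blast
      show "f y = y \<bullet> e" if "y \<in> frontier \<Omega> \<inter> ball x \<rho>" for y
        using graph_chart_frontier[OF c \<open>open \<Omega>\<close>] that by blast
    qed
    then show ?thesis using f(4) by blast
  qed
  then obtain \<rho> where \<rho>: "\<And>x. x \<in> frontier \<Omega> \<Longrightarrow> 0 < \<rho> x"
    "\<And>x. x \<in> frontier \<Omega> \<Longrightarrow> hausdorff_outer (DIM('a) - 1) (frontier \<Omega> \<inter> ball x (\<rho> x)) < top"
    by metis
  have "frontier \<Omega> \<subseteq> (\<Union>x\<in>frontier \<Omega>. ball x (\<rho> x))" using \<rho>(1) by force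
  then obtain F where F: "F \<subseteq> frontier \<Omega>" "finite F" "frontier \<Omega> \<subseteq> (\<Union>x\<in>F. ball x (\<rho> x))"
    using compactE_image[OF comp, of "frontier \<Omega>" "\<lambda>x. ball x (\<rho> x)"] by auto
  have "frontier \<Omega> = (\<Union>x\<in>F. frontier \<Omega> \<inter> ball x (\<rho> x))" using F(3) by auto
  then have "hausdorff_outer (DIM('a) - 1) (frontier \<Omega>)
      = emeasure (hausdorff_measure (DIM('a) - 1)) (\<Union>x\<in>F. frontier \<Omega> \<inter> ball x (\<rho> x))"
    by (simp add: emeasure_hausdorff_measure)
  also have "\<dots> \<le> (\<Sum>x\<in>F. emeasure (hausdorff_measure (DIM('a) - 1)) (frontier \<Omega> \<inter> ball x (\<rho> x)))"
    using F(2) by (intro emeasure_subadditive_finite) auto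
  also have "\<dots> < top"
    using \<rho>(2) F(1) F(2) by (subst ennreal_sum_less_top) (auto simp: emeasure_hausdorff_measure)
  finally show ?thesis .
qed

subsection \<open>Outward normals and exit points\<close>

text \<open>\<open>f\<close> is constant along \<open>e\<close>, so its gradient is orthogonal to
  the unit vector \<open>e\<close>. In particular the normal field of a chart never
  vanishes.\<close>

lemma graph_chart_direction:
  assumes "graph_chart \<Omega> x \<rho> e f"
  shows "(grad f y - e) \<bullet> e = - 1"
proof -
  have f: "smooth f" "e \<in> Basis \<or> - e \<in> Basis" "\<And>y c. f (y + c *\<^sub>R e) = f y"
    using assms by (auto simp: graph_chart_def)
  have "e \<bullet> e = 1"
    using f(2) by (metis inner_minus_left inner_minus_right inner_same_Basis minus_minus)
  have "((\<lambda>c. f (y + c *\<^sub>R e)) has_derivative (\<lambda>c. grad f (y + 0 *\<^sub>R e) \<bullet> (0 + c *\<^sub>R e))) (at 0)"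
    by (rule has_derivative_compose[OF _ has_derivative_grad[OF f(1)]]) (auto intro!: derivative_eq_intros)
  then have "((\<lambda>c. f y) has_derivative (\<lambda>c. c * (grad f y \<bullet> e))) (at (0::real))"
    by (simp add: f(3))
  moreover have "((\<lambda>c. f y) has_derivative (\<lambda>c. 0)) (at (0::real))"
    by simp
  ultimately have "(\<lambda>c::real. c * (grad f y \<bullet> e)) = (\<lambda>c. 0)"
    by (rule has_derivative_unique)
  then have "grad f y \<bullet> e = 0" by (metis mult_1)
  then show ?thesis using \<open>e \<bullet> e = 1\<close> by (simp add: inner_diff_left)
qed

lemma graph_chart_nonzero: "graph_chart \<Omega> x \<rho> e f \<Longrightarrow> grad f y - e \<noteq> 0"
  using graph_chart_direction[of \<Omega> x \<rho> e f y] by auto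

text \<open>Lets one chart compute the outward normal at all frontier points near its
  centre.\<close>

lemma graph_chart_move:
  assumes "graph_chart \<Omega> x \<rho> e f" "y \<in> ball x \<rho>"
  shows "graph_chart \<Omega> y (\<rho> - dist x y) e f"
proof -
  have "ball y (\<rho> - dist x y) \<subseteq> ball x \<rho>"
    by (auto simp: subset_eq) (metis add.commute dist_triangle le_less_trans less_diff_eq)
  moreover have "\<Omega> \<inter> ball x \<rho> = {y \<in> ball x \<rho>. f y < y \<bullet> e}"
    using assms unfolding graph_chart_def by blast
  ultimately have "\<Omega> \<inter> ball y (\<rho> - dist x y) = {z \<in> ball y (\<rho> - dist x y). f z < z \<bullet> e}"
    by blast
  then show ?thesis using assms unfolding graph_chart_def by simp
qed

text \<open>\<open>f y - y \<bullet> e\<close> is the local defining function, negative exactly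
  inside the domain; its rate of change along a curve tells whether the curve moves in or
  out.\<close>

lemma graph_chart_derivative:
  assumes "graph_chart \<Omega> x \<rho> e f" "(p has_vector_derivative v) (at \<tau> within S)"
  shows "((\<lambda>\<sigma>. f (p \<sigma>) - p \<sigma> \<bullet> e) has_real_derivative (grad f (p \<tau>) - e) \<bullet> v) (at \<tau> within S)"
proof -
  have f: "smooth f" using assms by (auto simp: graph_chart_def)
  have p: "(p has_derivative (\<lambda>c. c *\<^sub>R v)) (at \<tau> within S)"
    using assms(2) by (simp add: has_vector_derivative_def)
  have "((\<lambda>\<sigma>. f (p \<sigma>)) has_derivative (\<lambda>c. grad f (p \<tau>) \<bullet> (c *\<^sub>R v))) (at \<tau> within S)"
    by (rule has_derivative_compose[OF p has_derivative_grad[OF f]])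
  moreover have "((\<lambda>\<sigma>. p \<sigma> \<bullet> e) has_derivative (\<lambda>c. (c *\<^sub>R v) \<bullet> e)) (at \<tau> within S)"
    using p by (auto intro!: derivative_eq_intros)
  ultimately have "((\<lambda>\<sigma>. f (p \<sigma>) - p \<sigma> \<bullet> e) has_derivative (\<lambda>c. grad f (p \<tau>) \<bullet> (c *\<^sub>R v) - (c *\<^sub>R v) \<bullet> e)) (at \<tau> within S)"
    by (rule has_derivative_diff)
  then show ?thesis
    by (rule has_derivative_imp_has_field_derivative) (simp add: inner_diff_left inner_commute algebra_simps)
qed

text \<open>If two charts gave distinct unit normals \<open>n\<close> and \<open>n'\<close>, a small
  step from \<open>x\<close> along \<open>n' - n\<close> would enter the domain according to the
  first chart and leave it according to the second.\<close>

lemma graph_chart_normal_unique: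
  assumes "open \<Omega>" "x \<in> frontier \<Omega>" and c: "graph_chart \<Omega> x \<rho> e f" and c': "graph_chart \<Omega> x \<rho>' e' f'"
  shows "(grad f x - e) /\<^sub>R norm (grad f x - e) = (grad f' x - e') /\<^sub>R norm (grad f' x - e')"
proof (rule ccontr)
  define g g' where "g = grad f x - e" and "g' = grad f' x - e'"
  define n n' where "n = g /\<^sub>R norm g" and "n' = g' /\<^sub>R norm g'"
  have g0: "g \<noteq> 0" "g' \<noteq> 0" using graph_chart_nonzero c c' unfolding g_def g'_def by blast+
  then have n1: "norm n = 1" "norm n' = 1" by (auto simp: n_def n'_def)
  assume "\<not> ?thesis"
  then have "n \<noteq> n'" by (simp add: n_def n'_def g_def g'_def)
  define v where "v = n' - n"
  have "0 < (norm v)\<^sup>2" using \<open>n \<noteq> n'\<close> by (simp add: v_def)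
  moreover have "(norm v)\<^sup>2 = 2 - 2 * (n \<bullet> n')"
    using n1 unfolding power2_norm_eq_inner v_def norm_eq_1
    by (simp add: inner_diff_left inner_diff_right inner_commute)
  ultimately have "n \<bullet> n' < 1" by simp
  then have "n \<bullet> v < 0" "0 < n' \<bullet> v"
    using n1 unfolding v_def norm_eq_1 by (auto simp: inner_diff_right inner_commute)
  then have gv: "g \<bullet> v < 0" "0 < g' \<bullet> v"
    using g0 by (auto simp: n_def n'_def mult_less_0_iff zero_less_mult_iff)
  define p where "p c = x + c *\<^sub>R v" for c
  have p: "(p has_vector_derivative v) (at 0 within UNIV)" "p 0 = x"
    unfolding p_def by (auto intro!: derivative_eq_intros)
  have rho: "0 < \<rho>" "0 < \<rho>'" using c c' by (auto simp: graph_chart_def)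
  have z: "f x = x \<bullet> e" "f' x = x \<bullet> e'"
    using graph_chart_frontier[OF c] graph_chart_frontier[OF c'] assms(1,2) rho by auto
  obtain d where d: "d > 0" "\<And>h. \<lbrakk>0 < h; h < d\<rbrakk> \<Longrightarrow> f (p h) - p h \<bullet> e < 0"
    using has_real_derivative_neg_dec_right[OF graph_chart_derivative[OF c p(1)]] gv(1)
    by (auto simp: p(2) g_def z)
  obtain d' where d': "d' > 0" "\<And>h. \<lbrakk>0 < h; h < d'\<rbrakk> \<Longrightarrow> 0 < f' (p h) - p h \<bullet> e'"
    using has_real_derivative_pos_inc_right[OF graph_chart_derivative[OF c' p(1)]] gv(2)
    by (auto simp: p(2) g'_def z)
  have "norm v > 0" using \<open>0 < (norm v)\<^sup>2\<close> by simp
  \<comment> \<open>Steps below \<open>m\<close> keep both signs valid and stay inside both chart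
    balls.\<close>
  define m where "m = min (min d d') (min (\<rho> / norm v) (\<rho>' / norm v))"
  have "0 < m" "m \<le> d" "m \<le> d'" "m \<le> \<rho> / norm v" "m \<le> \<rho>' / norm v"
    using d(1) d'(1) rho \<open>norm v > 0\<close> unfolding m_def by auto
  then obtain h where h: "0 < h" "h < d" "h < d'" "h < \<rho> / norm v" "h < \<rho>' / norm v"
    by (metis dense order_less_le_trans)
  then have "h * norm v < \<rho>" "h * norm v < \<rho>'" using \<open>norm v > 0\<close> by (auto simp: field_simps)
  then have ball: "p h \<in> ball x \<rho>" "p h \<in> ball x \<rho>'"
    using h(1) by (auto simp: p_def dist_norm)
  have "f (p h) < p h \<bullet> e" "\<not> f' (p h) < p h \<bullet> e'" using d(2)[of h] d'(2)[of h] h by auto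
  then show False using c c' ball unfolding graph_chart_def by blast
qed

lemma outward_normal_eq:
  assumes "open \<Omega>" "x \<in> frontier \<Omega>" "graph_chart \<Omega> x \<rho> e f"
  shows "outward_normal \<Omega> x = (grad f x - e) /\<^sub>R norm (grad f x - e)"
  unfolding outward_normal_def
  using assms graph_chart_normal_unique[OF assms(1,2)] by (intro the_equality) blast+

text \<open>Near \<open>x\<close> the recentred chart of \<open>x\<close> represents the normal at
  every frontier point by one continuous formula. This is what makes \<Sigma> a Borel set.\<close>

lemma continuous_on_outward_normal:
  assumes "open \<Omega>" "smooth_boundary \<Omega>"
  shows "continuous_on (frontier \<Omega>) (outward_normal \<Omega>)"
  unfolding continuous_on_eq_continuous_within
proof
  fix x assume x: "x \<in> frontier \<Omega>"
  then obtain \<rho> e f where c: "graph_chart \<Omega> x \<rho> e f"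
    using assms(2) unfolding smooth_boundary_def by blast
  then have f: "smooth f" "0 < \<rho>" by (auto simp: graph_chart_def)
  show "continuous (at x within frontier \<Omega>) (outward_normal \<Omega>)"
  proof (rule continuous_transform_within[OF _ f(2) x])
    have "continuous_on UNIV (\<lambda>y. (grad f y - e) /\<^sub>R norm (grad f y - e))"
      using graph_chart_nonzero[OF c] by (intro continuous_intros continuous_on_grad f) auto
    then show "continuous (at x within frontier \<Omega>) (\<lambda>y. (grad f y - e) /\<^sub>R norm (grad f y - e))"
      by (meson continuous_on_eq_continuous_within continuous_within_subset subset_UNIV UNIV_I)
    show "(grad f y - e) /\<^sub>R norm (grad f y - e) = outward_normal \<Omega> y"
      if "y \<in> frontier \<Omega>" "dist y x < \<rho>" for y
      using that graph_chart_move[OF c, of y] outward_normal_eq[OF assms(1) that(1)]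
      by (simp add: dist_commute)
  qed
qed

text \<open>The defining function is negative before \<open>\<tau>\<close> and zero at
  \<open>\<tau>\<close>, so its left derivative there, a positive multiple of the normal velocity,
  cannot be negative.\<close>

lemma exit_direction:
  assumes "open \<Omega>" "smooth_boundary \<Omega>" "\<tau>0 < \<tau>" and exit: "p \<tau> \<in> frontier \<Omega>"
    and before: "\<And>\<sigma>. \<tau>0 \<le> \<sigma> \<Longrightarrow> \<sigma> < \<tau> \<Longrightarrow> p \<sigma> \<in> \<Omega>"
    and deriv: "(p has_vector_derivative v) (at \<tau> within {\<tau>0..\<tau>})"
  shows "0 \<le> v \<bullet> outward_normal \<Omega> (p \<tau>)"
proof -
  obtain \<rho> e f where c: "graph_chart \<Omega> (p \<tau>) \<rho> e f"
    using assms(2) exit unfolding smooth_boundary_def by blast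
  then have f: "smooth f" "0 < \<rho>" by (auto simp: graph_chart_def)
  have z: "f (p \<tau>) = p \<tau> \<bullet> e" using graph_chart_frontier[OF c assms(1) exit] f(2) by auto
  have "0 \<le> (grad f (p \<tau>) - e) \<bullet> v"
  proof (rule ccontr)
    assume "\<not> ?thesis"
    then obtain d where d: "d > 0"
      "\<And>h. \<lbrakk>0 < h; \<tau> - h \<in> {\<tau>0..\<tau>}; h < d\<rbrakk> \<Longrightarrow> 0 < f (p (\<tau> - h)) - p (\<tau> - h) \<bullet> e"
      using has_real_derivative_neg_dec_left[OF graph_chart_derivative[OF c deriv]] by (auto simp: z)
    have "continuous (at \<tau> within {\<tau>0..\<tau>}) p"
      using deriv has_vector_derivative_continuous by blast
    then obtain d' where d': "d' > 0" "\<And>\<sigma>. \<lbrakk>\<sigma> \<in> {\<tau>0..\<tau>}; dist \<sigma> \<tau> < d'\<rbrakk> \<Longrightarrow> dist (p \<sigma>) (p \<tau>) < \<rho>"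
      using f(2) unfolding continuous_within_eps_delta by blast
    define h where "h = min (min d d') (\<tau> - \<tau>0) / 2"
    have h: "0 < h" "h < d" "h < d'" "h < \<tau> - \<tau>0"
      using d(1) d'(1) assms(3) unfolding h_def by (auto simp: min_def)
    have "p (\<tau> - h) \<in> \<Omega>" using before[of "\<tau> - h"] h by auto
    moreover have "p (\<tau> - h) \<in> ball (p \<tau>) \<rho>"
      using d'(2)[of "\<tau> - h"] h by (auto simp: dist_commute dist_real_def)
    ultimately have "f (p (\<tau> - h)) < p (\<tau> - h) \<bullet> e" using c unfolding graph_chart_def by blast
    then show False using d(2)[of h] h by auto
  qed
  then show ?thesis
    unfolding outward_normal_eq[OF assms(1) exit c] by (simp add: inner_commute)
qed

text \<open>The times spent outside the open set form a closed set, and its infimum is attained; at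
  that time the curve is outside but is a limit of earlier points inside.\<close>

lemma first_exit:
  fixes p :: "real \<Rightarrow> 'a::real_normed_vector"
  assumes "open \<Omega>" "continuous_on {a..b} p" "p a \<in> \<Omega>" "\<sigma> \<in> {a..b}" "p \<sigma> \<notin> \<Omega>"
  obtains \<tau> where "a < \<tau>" "\<tau> \<le> b" "p \<tau> \<in> frontier \<Omega>" "\<And>\<sigma>. a \<le> \<sigma> \<Longrightarrow> \<sigma> < \<tau> \<Longrightarrow> p \<sigma> \<in> \<Omega>"
proof -
  define S where "S = {\<sigma> \<in> {a..b}. p \<sigma> \<in> - \<Omega>}"
  have "closed S"
  proof -
    have "S = {a..b} \<inter> p -` (- \<Omega>)" by (auto simp: S_def)
    then show ?thesis
      using assms(1,2) by (simp add: continuous_closed_preimage closed_Compl)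
  qed
  moreover have "S \<noteq> {}" "bdd_below S" using assms(4,5) by (auto simp: S_def)
  ultimately have inS: "Inf S \<in> S" by (intro closed_contains_Inf)
  have before: "p \<sigma> \<in> \<Omega>" if "a \<le> \<sigma>" "\<sigma> < Inf S" for \<sigma>
  proof (rule ccontr)
    assume "p \<sigma> \<notin> \<Omega>"
    then have "\<sigma> \<in> S" using that inS by (simp add: S_def)
    then show False using cInf_lower[OF _ \<open>bdd_below S\<close>, of \<sigma>] that(2) by simp
  qed
  have "a \<le> Inf S" "p (Inf S) \<notin> \<Omega>" using inS by (simp_all add: S_def)
  then have a: "a < Inf S" using assms(3) by (metis order_le_less)
  have "p (Inf S) \<in> closure \<Omega>"
  proof -
    have "(p \<longlongrightarrow> p (Inf S)) (at (Inf S) within {a..<Inf S})"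
    proof (rule tendsto_within_subset)
      show "(p \<longlongrightarrow> p (Inf S)) (at (Inf S) within {a..b})"
        using assms(2) inS unfolding continuous_on_def by (simp add: S_def)
      show "{a..<Inf S} \<subseteq> {a..b}" using inS by (auto simp: S_def)
    qed
    moreover have "at (Inf S) within {a..<Inf S} \<noteq> bot"
      using a by (simp add: trivial_limit_within islimpt_Ico)
    moreover have "\<forall>\<^sub>F \<sigma> in at (Inf S) within {a..<Inf S}. p \<sigma> \<in> closure \<Omega>"
      unfolding eventually_at using before by (intro exI[of _ 1]) (auto intro!: subsetD[OF closure_subset])
    ultimately show ?thesis
      by (intro Lim_in_closed_set[where f=p and F="at (Inf S) within {a..<Inf S}" and S="closure \<Omega>"]) auto
  qed
  then have "p (Inf S) \<in> frontier \<Omega>"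
    using \<open>p (Inf S) \<notin> \<Omega>\<close> assms(1) by (simp add: frontier_def interior_open)
  moreover have "Inf S \<le> b" using inS by (simp add: S_def)
  ultimately show thesis using that a before by blast
qed

subsection \<open>Sweeping and the lateral measure\<close>

lemma space_surface_measure [simp]: "space (surface_measure \<Omega>) = frontier \<Omega>"
  by (simp add: surface_measure_def space_restrict_space)

lemma sets_surface_measure [measurable_cong]:
  "sets (surface_measure \<Omega>) = sets (restrict_space borel (frontier \<Omega>))"
  unfolding surface_measure_def by (intro sets_restrict_space_cong) simp

lemma emeasure_surface_measure:
  fixes \<Omega> :: "'a::euclidean_space set"
  assumes "A \<subseteq> frontier \<Omega>" "A \<in> sets borel"
  shows "emeasure (surface_measure \<Omega>) A = hausdorff_outer (DIM('a) - 1) A"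
  unfolding surface_measure_def using assms
  by (subst emeasure_restrict_space) (auto simp: emeasure_hausdorff_measure)

lemma finite_measure_surface_measure:
  fixes \<Omega> :: "'a::euclidean_space set"
  assumes "open \<Omega>" "bounded \<Omega>" "smooth_boundary \<Omega>"
  shows "finite_measure (surface_measure \<Omega>)"
proof
  show "emeasure (surface_measure \<Omega>) (space (surface_measure \<Omega>)) \<noteq> \<infinity>"
    using hausdorff_outer_frontier_finite[OF assms] by (simp add: emeasure_surface_measure)
qed

abbreviation lateral_product :: "'a::euclidean_space set \<Rightarrow> real \<Rightarrow> ('a \<times> real) measure" where
  "lateral_product \<Omega> T \<equiv> surface_measure \<Omega> \<Otimes>\<^sub>M restrict_space lborel {0<..<T}"

lemma space_lateral_product: "space (lateral_product \<Omega> T) = frontier \<Omega> \<times> {0<..<T}"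
  by (simp add: space_pair_measure space_restrict_space)

lemma finite_measure_time: "finite_measure (restrict_space lborel {0<..<T::real})"
proof
  show "emeasure (restrict_space lborel {0<..<T}) (space (restrict_space lborel {0<..<T})) \<noteq> \<infinity>"
    by (cases "0 \<le> T") (auto simp: emeasure_restrict_space space_restrict_space)
qed

lemma finite_measure_lateral_product:
  fixes \<Omega> :: "'a::euclidean_space set"
  assumes "open \<Omega>" "bounded \<Omega>" "smooth_boundary \<Omega>"
  shows "finite_measure (lateral_product \<Omega> T)"
  by (intro finite_measure_pair_measure finite_measure_surface_measure assms finite_measure_time)

text \<open>The inclusion of the lateral boundary into the whole space is measurable, hence so are
  restrictions of Borel functions.\<close>

lemma measurable_lateral_product_borel:
  "f \<in> borel \<rightarrow>\<^sub>M N \<Longrightarrow> f \<in> lateral_product \<Omega> T \<rightarrow>\<^sub>M N"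
proof -
  assume f: "f \<in> borel \<rightarrow>\<^sub>M N"
  have fst: "fst \<in> lateral_product \<Omega> T \<rightarrow>\<^sub>M borel"
    unfolding surface_measure_def
    by (rule measurable_compose[OF measurable_fst]) (auto intro: measurable_restrict_space1 simp: measurable_cong_sets[OF sets_hausdorff_measure refl])
  have snd: "snd \<in> lateral_product \<Omega> T \<rightarrow>\<^sub>M borel"
    by (rule measurable_compose[OF measurable_snd]) (auto intro: measurable_restrict_space1)
  have "(\<lambda>p. (fst p, snd p)) \<in> lateral_product \<Omega> T \<rightarrow>\<^sub>M borel"
    unfolding borel_prod[symmetric] using fst snd by (rule measurable_Pair)
  then show ?thesis using measurable_compose[OF _ f] by simp
qed

lemma sets_lateral_product:
  assumes "E \<in> sets borel" "E \<subseteq> frontier \<Omega> \<times> {0<..<T}"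
  shows "E \<in> sets (lateral_product \<Omega> T)"
proof -
  have "(\<lambda>p. p) \<in> lateral_product \<Omega> T \<rightarrow>\<^sub>M borel"
    by (rule measurable_lateral_product_borel) simp
  from measurable_sets[OF this assms(1)]
  have "E \<inter> space (lateral_product \<Omega> T) \<in> sets (lateral_product \<Omega> T)" by simp
  then show ?thesis using assms(2) unfolding space_lateral_product by (simp add: Int_absorb2)
qed

lemma emeasure_lateral_product_Times:
  assumes "B \<in> sets borel" "B \<subseteq> frontier \<Omega>" "{a<..<b} \<subseteq> {0<..<T}" "a \<le> b"
  shows "emeasure (lateral_product \<Omega> T) (B \<times> {a<..<b}) = emeasure (surface_measure \<Omega>) B * ennreal (b - a)"
proof -
  interpret finite_measure "restrict_space lborel {0<..<T}" by (rule finite_measure_time)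
  have "B \<in> sets (surface_measure \<Omega>)"
    using assms by (auto simp: sets_surface_measure sets_restrict_space_iff)
  moreover have "{a<..<b} \<in> sets (restrict_space lborel {0<..<T})"
    using assms by (auto simp: sets_restrict_space_iff)
  ultimately show ?thesis
    using assms by (simp add: emeasure_pair_measure_Times emeasure_restrict_space)
qed

text \<open>The tube lemma: the complement is the projection of a closed set along the compact
  factor.\<close>

lemma open_fiber_contains:
  fixes W :: "('a::euclidean_space \<times> 'b::euclidean_space) set"
  assumes "open W" "compact K"
  shows "open {y. {y} \<times> K \<subseteq> W}"
proof -
  have "closed ((\<lambda>(\<tau>, y). (y, \<tau>)) -` (- W))"
    using assms(1) by (intro closed_vimage) (auto intro!: continuous_intros simp: split_beta)
  from closed_compact_projection[OF assms(2) this]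
  have "open (- {y. \<exists>\<tau>. \<tau> \<in> K \<and> (\<tau>, y) \<in> (\<lambda>(\<tau>, y). (y, \<tau>)) -` (- W)})"
    by (rule open_Compl)
  also have "- {y. \<exists>\<tau>. \<tau> \<in> K \<and> (\<tau>, y) \<in> (\<lambda>(\<tau>, y). (y, \<tau>)) -` (- W)} = {y. {y} \<times> K \<subseteq> W}"
    by auto
  finally show ?thesis .
qed

text \<open>For a product of a Borel part of the frontier with a time interval, the sweep bound and
  the product measure match exactly. A relatively open set is exhausted by finite unions of such
  products.\<close>

lemma outer_measure_sweep_open:
  fixes \<Omega> :: "'a::euclidean_space set" and X :: "real \<Rightarrow> 'a"
  assumes \<Omega>: "open \<Omega>" "bounded \<Omega>" "smooth_boundary \<Omega>" and "0 < T" "0 \<le> L"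
    and lip: "\<And>\<sigma> \<tau>. \<lbrakk>\<sigma> \<in> {0..T}; \<tau> \<in> {0..T}\<rbrakk> \<Longrightarrow> norm (X \<sigma> - X \<tau>) \<le> L * \<bar>\<sigma> - \<tau>\<bar>"
    and "open W"
  defines "E \<equiv> W \<inter> frontier \<Omega> \<times> {0<..<T}"
  shows "outer_measure_of lborel (sweep X ` E)
    \<le> ennreal (sweep_const TYPE('a) L) * emeasure (lateral_product \<Omega> T) E"
proof -
  let ?S = "surface_measure \<Omega>" and ?M = "lateral_product \<Omega> T"
  \<comment> \<open>Restricting to the open time interval ensures that a product contained in
    \<open>V\<close> also stays within the time range of the lateral measure.\<close>
  define V where "V = W \<inter> UNIV \<times> {0<..<T}"
  have "open V" unfolding V_def using \<open>open W\<close> by (intro open_Int open_Times) auto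
  have E: "E = V \<inter> frontier \<Omega> \<times> UNIV" by (auto simp: E_def V_def)
  have closed_fr: "closed (frontier \<Omega>)" by simp
  have E_sets: "E \<in> sets ?M"
  proof (rule sets_lateral_product)
    show "E \<in> sets borel" unfolding E using \<open>open V\<close>
      by (intro sets.Int borel_open borel_closed closed_Times) auto
  qed (auto simp: E_def)
  \<comment> \<open>\<open>E\<close> is the lower limit of the unions \<open>F N\<close> of the products, over the \<open>N\<close>-th partition of \<open>[0, T]\<close>, that
    it contains.\<close>
  define a where "a N k = T * real k / real (Suc N)" for N k :: nat
  have a_mono: "a N k \<le> a N l" if "k \<le> l" for N k l
    using that \<open>0 < T\<close> by (auto simp: a_def intro!: divide_right_mono mult_left_mono)
  have a_step: "a N (Suc k) - a N k = T / real (Suc N)" for N k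
    by (simp only: a_def diff_divide_distrib[symmetric] right_diff_distrib[symmetric] of_nat_Suc) simp
  have a_range: "{a N k..a N (Suc k)} \<subseteq> {0..T}" if "k < Suc N" for N k
  proof -
    have "0 \<le> a N k" using \<open>0 < T\<close> by (simp add: a_def)
    moreover have "a N (Suc k) \<le> a N (Suc N)" using that by (intro a_mono) auto
    moreover have "a N (Suc N) = T" by (simp add: a_def)
    ultimately show ?thesis by auto
  qed
  define B where "B N k = {y. {y} \<times> {a N k..a N (Suc k)} \<subseteq> V} \<inter> frontier \<Omega>" for N k
  have B_borel: "B N k \<in> sets borel" for N k
    unfolding B_def using open_fiber_contains[OF \<open>open V\<close> compact_Icc]
    by (intro sets.Int borel_open borel_closed) auto
  have B_sub: "B N k \<subseteq> frontier \<Omega>" for N k by (simp add: B_def)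
  define F where "F N = (\<Union>k<Suc N. B N k \<times> {a N k..a N (Suc k)})" for N
  have F_le: "outer_measure_of lborel (sweep X ` F N) \<le> ennreal (sweep_const TYPE('a) L) * emeasure ?M E" for N
  proof -
    let ?K = "sweep_const TYPE('a) L"
    have K: "0 < ?K" using sweep_const_pos[OF \<open>0 \<le> L\<close>] .
    \<comment> \<open>Open time intervals make the products disjoint; they have the same length as
      the closed ones, so their measures still match the sweep bounds.\<close>
    let ?G = "\<lambda>k. B N k \<times> {a N k<..<a N (Suc k)}"
    have Ioo: "{a N k<..<a N (Suc k)} \<subseteq> {0<..<T}" if "k < Suc N" for k
    proof -
      have "0 \<le> a N k" using \<open>0 < T\<close> by (simp add: a_def)
      moreover have "a N (Suc k) \<le> a N (Suc N)" using that by (intro a_mono) auto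
      moreover have "a N (Suc N) = T" by (simp add: a_def)
      ultimately show ?thesis by auto
    qed
    have emG: "emeasure ?M (?G k) = ennreal (T / real (Suc N)) * emeasure ?S (B N k)" if "k < Suc N" for k
      using emeasure_lateral_product_Times[OF B_borel B_sub Ioo[OF that] a_mono]
      by (simp add: a_step mult.commute)
    have G_sets: "?G k \<in> sets ?M" if "k < Suc N" for k
    proof (rule sets_lateral_product)
      show "?G k \<in> sets borel"
        unfolding borel_prod[symmetric] using B_borel by (intro pair_measureI) auto
      show "?G k \<subseteq> frontier \<Omega> \<times> {0<..<T}"
        by (intro Sigma_mono B_sub Ioo that)
    qed
    have "outer_measure_of lborel (sweep X ` F N)
        = outer_measure_of lborel (\<Union>k<Suc N. sweep X ` (B N k \<times> {a N k..a N (Suc k)}))"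
      by (simp only: F_def image_UN)
    also have "\<dots> \<le> (\<Sum>k<Suc N. outer_measure_of lborel (sweep X ` (B N k \<times> {a N k..a N (Suc k)})))"
      by (intro outer_measure_of_finite_UN) auto
    also have "\<dots> \<le> (\<Sum>k<Suc N. ennreal ?K * emeasure ?M (?G k))"
    proof (rule sum_mono)
      fix k assume "k \<in> {..<Suc N}"
      then have k: "k < Suc N" by simp
      have "outer_measure_of lborel (sweep X ` (B N k \<times> {a N k..a N (Suc k)}))
          \<le> ennreal ((a N (Suc k) - a N k) * ?K) * hausdorff_outer (DIM('a) - 1) (B N k)"
      proof (rule outer_measure_sweep_le)
        show "a N k \<le> a N (Suc k)" by (intro a_mono) simp
        show "norm (X \<sigma> - X \<tau>) \<le> L * \<bar>\<sigma> - \<tau>\<bar>"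
          if "\<sigma> \<in> {a N k..a N (Suc k)}" "\<tau> \<in> {a N k..a N (Suc k)}" for \<sigma> \<tau>
          using that a_range[OF k] by (intro lip) blast+
        show "hausdorff_outer (DIM('a) - 1) (B N k) < top"
          using hausdorff_outer_mono[OF B_sub] hausdorff_outer_frontier_finite[OF \<Omega>] by (rule le_less_trans)
      qed fact
      also have "\<dots> = ennreal ?K * emeasure ?M (?G k)"
        unfolding emG[OF k] a_step emeasure_surface_measure[OF B_sub B_borel]
        using ennreal_mult[of "T / real (Suc N)" ?K] K \<open>0 < T\<close> by (simp only: mult_ac) (simp add: mult_ac)
      finally show "outer_measure_of lborel (sweep X ` (B N k \<times> {a N k..a N (Suc k)}))
          \<le> ennreal ?K * emeasure ?M (?G k)" .
    qed
    also have "\<dots> = ennreal ?K * (\<Sum>k<Suc N. emeasure ?M (?G k))"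
      by (rule sum_distrib_left[symmetric])
    also have "(\<Sum>k<Suc N. emeasure ?M (?G k)) = emeasure ?M (\<Union>k<Suc N. ?G k)"
    proof (rule sum_emeasure)
      show "disjoint_family_on ?G {..<Suc N}"
        unfolding disjoint_family_on_def
      proof (intro ballI impI)
        fix k l :: nat assume "k \<noteq> l"
        then consider "Suc k \<le> l" | "Suc l \<le> k" by linarith
        then show "?G k \<inter> ?G l = {}"
          by cases (use a_mono[of "Suc k" l N] a_mono[of "Suc l" k N] in auto)
      qed
    qed (use G_sets in auto)
    also have "\<dots> \<le> emeasure ?M E"
      using E_sets by (intro emeasure_mono) (auto simp: E B_def)
    finally show ?thesis by (simp add: mult_left_mono)
  qed
  \<comment> \<open>The partitions for successive \<open>N\<close> are not nested, so
    \<open>F\<close> need not increase; the intersections of its tails do.\<close>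
  define D where "D n = (\<Inter>N\<in>{n..}. F N)" for n
  have "incseq D" unfolding D_def by (intro monoI INF_superset_mono) auto
  have "E \<subseteq> (\<Union>n. D n)"
  proof
    fix p assume p: "p \<in> E"
    obtain y \<tau> where p_eq: "p = (y, \<tau>)" by force
    have y: "y \<in> frontier \<Omega>" "(y, \<tau>) \<in> V" and \<tau>: "0 < \<tau>" "\<tau> < T"
      using p by (auto simp: E V_def p_eq)
    obtain \<epsilon> where \<epsilon>: "0 < \<epsilon>" "ball (y, \<tau>) \<epsilon> \<subseteq> V"
      using \<open>open V\<close> y(2) open_contains_ball by blast
    \<comment> \<open>From this index on the mesh is smaller than \<open>\<epsilon>\<close>, so the
      cell around \<open>\<tau>\<close> stays inside the ball.\<close>
    obtain n :: nat where n: "T / \<epsilon> < real n" using reals_Archimedean2 by blast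
    have "(y, \<tau>) \<in> F N" if "n \<le> N" for N
    proof -
      define k where "k = nat \<lfloor>\<tau> * real (Suc N) / T\<rfloor>"
      have "real k \<le> \<tau> * real (Suc N) / T" "\<tau> * real (Suc N) / T < real k + 1"
        using \<tau> \<open>0 < T\<close> by (auto simp: k_def)
      then have k: "a N k \<le> \<tau>" "\<tau> < a N (Suc k)"
        using \<open>0 < T\<close> by (auto simp: a_def field_simps)
      have "k < Suc N"
      proof (rule ccontr)
        assume "\<not> ?thesis"
        then have "a N (Suc N) \<le> a N k" by (intro a_mono) auto
        then show False using k \<tau> by (simp add: a_def)
      qed
      moreover have "y \<in> B N k"
      proof -
        have "T / \<epsilon> < real (Suc N)" using n that by linarith
        then have "T / real (Suc N) < \<epsilon>" using \<epsilon>(1) by (simp add: field_simps)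
        then have "(y, \<sigma>) \<in> ball (y, \<tau>) \<epsilon>" if "\<sigma> \<in> {a N k..a N (Suc k)}" for \<sigma>
          using that k a_step[of N k] by (auto simp: dist_Pair_Pair dist_real_def)
        then show ?thesis using \<epsilon>(2) y(1) by (auto simp: B_def)
      qed
      ultimately show ?thesis using k unfolding F_def by auto
    qed
    then have "p \<in> D n" by (simp add: D_def p_eq)
    then show "p \<in> (\<Union>n. D n)" by blast
  qed
  then have "outer_measure_of lborel (sweep X ` E) \<le> outer_measure_of lborel (\<Union>n. sweep X ` D n)"
    unfolding image_UN[symmetric] by (intro outer_measure_of_mono image_mono)
  also have "\<dots> = (SUP n. outer_measure_of lborel (sweep X ` D n))"
    using \<open>incseq D\<close> by (intro SUP_outer_measure_of_incseq[symmetric]) (auto simp: incseq_def image_mono)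
  also have "\<dots> \<le> ennreal (sweep_const TYPE('a) L) * emeasure ?M E"
  proof (rule SUP_least)
    fix n
    have "outer_measure_of lborel (sweep X ` D n) \<le> outer_measure_of lborel (sweep X ` F n)"
      by (intro outer_measure_of_mono image_mono) (auto simp: D_def)
    then show "outer_measure_of lborel (sweep X ` D n) \<le> ennreal (sweep_const TYPE('a) L) * emeasure ?M E"
      using F_le[of n] by (rule order_trans)
  qed
  finally show ?thesis .
qed

text \<open>Outer regularity of the finite lateral measure carries the bound from relatively open
  sets to Borel sets.\<close>

lemma outer_measure_sweep_borel:
  fixes \<Omega> :: "'a::euclidean_space set" and X :: "real \<Rightarrow> 'a"
  assumes \<Omega>: "open \<Omega>" "bounded \<Omega>" "smooth_boundary \<Omega>" and "0 < T" "0 \<le> L"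
    and lip: "\<And>\<sigma> \<tau>. \<lbrakk>\<sigma> \<in> {0..T}; \<tau> \<in> {0..T}\<rbrakk> \<Longrightarrow> norm (X \<sigma> - X \<tau>) \<le> L * \<bar>\<sigma> - \<tau>\<bar>"
    and E: "E \<in> sets borel" "E \<subseteq> frontier \<Omega> \<times> {0<..<T}"
  shows "outer_measure_of lborel (sweep X ` E)
    \<le> ennreal (sweep_const TYPE('a) L) * emeasure (lateral_product \<Omega> T) E"
proof -
  let ?M = "lateral_product \<Omega> T" and ?K = "ennreal (sweep_const TYPE('a) L)"
  interpret finite_measure ?M by (rule finite_measure_lateral_product[OF \<Omega>])
  have K: "0 < ?K" using sweep_const_pos[OF \<open>0 \<le> L\<close>, where 'a='a] by simp
  \<comment> \<open>The lateral measure pushed forward to the whole space, where outer regularity by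
    open sets is applied.\<close>
  define N where "N = distr ?M borel (\<lambda>p. p)"
  have id: "(\<lambda>p. p) \<in> ?M \<rightarrow>\<^sub>M borel"
    by (rule measurable_lateral_product_borel) simp
  have N: "emeasure N U = emeasure ?M (U \<inter> frontier \<Omega> \<times> {0<..<T})" if "U \<in> sets borel" for U
    unfolding N_def using that by (subst emeasure_distr[OF id]) (auto simp: space_lateral_product)
  have "outer_measure_of lborel (sweep X ` E) / ?K \<le> emeasure N U" if "E \<subseteq> U" "open U" for U
  proof -
    have "outer_measure_of lborel (sweep X ` E) \<le> outer_measure_of lborel (sweep X ` (U \<inter> frontier \<Omega> \<times> {0<..<T}))"
      using that E(2) by (intro outer_measure_of_mono image_mono) auto
    also have "\<dots> \<le> ?K * emeasure ?M (U \<inter> frontier \<Omega> \<times> {0<..<T})"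
      using assms that by (intro outer_measure_sweep_open) auto
    also have "\<dots> = ?K * emeasure N U" using that by (simp add: N)
    finally show ?thesis using K by (intro divide_le_posI_ennreal) auto
  qed
  then have "outer_measure_of lborel (sweep X ` E) / ?K \<le> (INF U \<in> {U. E \<subseteq> U \<and> open U}. emeasure N U)"
    by (intro INF_greatest) auto
  also have "\<dots> = emeasure N E"
  proof (rule outer_regular[symmetric])
    show "sets N = sets borel" by (simp add: N_def)
    have "emeasure N (space N) = emeasure N UNIV" by (simp add: N_def)
    also have "\<dots> \<noteq> \<infinity>" by (subst N) (auto simp: space_lateral_product[symmetric])
    finally show "emeasure N (space N) \<noteq> \<infinity>" .
  qed fact
  also have "\<dots> = emeasure ?M E" using E by (simp add: N Int_absorb2)
  finally have le: "outer_measure_of lborel (sweep X ` E) / ?K \<le> emeasure ?M E" .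
  have "outer_measure_of lborel (sweep X ` E) = outer_measure_of lborel (sweep X ` E) / ?K * ?K"
    using K by (simp only: ennreal_divide_times) (subst ennreal_divide_self, auto)
  also have "\<dots> \<le> emeasure ?M E * ?K" by (rule mult_right_mono[OF le]) simp
  finally show ?thesis by (simp only: mult.commute)
qed

subsection \<open>Energy along characteristics\<close>

text \<open>The weights \<open>exp (\<sigma> - a)\<close> and \<open>exp (a - \<sigma>)\<close> add
  a term \<open>(w \<sigma>)\<^sup>2\<close> of the right sign to the derivative of the square;
  together with the mixed term it is compared with \<open>(w' \<sigma>)\<^sup>2\<close> by
  completing the square. The two parts are the backward and the forward estimate.\<close>

lemma energy_interval:
  fixes w w' :: "real \<Rightarrow> real"
  assumes "a \<le> b" and w: "\<And>\<sigma>. \<sigma> \<in> {a..b} \<Longrightarrow> (w has_real_derivative w' \<sigma>) (at \<sigma> within {a..b})"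
    and I: "((\<lambda>\<sigma>. (w' \<sigma>)\<^sup>2) has_integral I) {a..b}"
  shows "(w a)\<^sup>2 \<le> exp (b - a) * ((w b)\<^sup>2 + I)" and "(w b)\<^sup>2 \<le> exp (b - a) * ((w a)\<^sup>2 + I)"
proof -
  have "((\<lambda>\<sigma>. exp (\<sigma> - a) * (w \<sigma>)\<^sup>2) has_real_derivative exp (\<sigma> - a) * ((w \<sigma>)\<^sup>2 + 2 * w \<sigma> * w' \<sigma>))
      (at \<sigma> within {a..b})" if "\<sigma> \<in> {a..b}" for \<sigma>
    by (auto intro!: derivative_eq_intros w[OF that] simp: algebra_simps)
  then have 1: "((\<lambda>\<sigma>. exp (\<sigma> - a) * ((w \<sigma>)\<^sup>2 + 2 * w \<sigma> * w' \<sigma>)) has_integral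
      exp (b - a) * (w b)\<^sup>2 - exp (a - a) * (w a)\<^sup>2) {a..b}"
    using assms(1) by (intro fundamental_theorem_of_calculus) (auto simp: has_real_derivative_iff_has_vector_derivative)
  have "- (exp (b - a) * I) \<le> exp (b - a) * (w b)\<^sup>2 - exp (a - a) * (w a)\<^sup>2"
  proof (rule has_integral_le[OF _ 1])
    show "((\<lambda>\<sigma>. - (exp (b - a) * (w' \<sigma>)\<^sup>2)) has_integral - (exp (b - a) * I)) {a..b}"
      by (intro has_integral_neg has_integral_mult_right I)
    fix \<sigma> assume \<sigma>: "\<sigma> \<in> {a..b}"
    have "0 \<le> (w \<sigma> + w' \<sigma>)\<^sup>2" by simp
    then have "- ((w \<sigma>)\<^sup>2 + 2 * w \<sigma> * w' \<sigma>) \<le> (w' \<sigma>)\<^sup>2" by (simp add: power2_sum)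
    then have "exp (\<sigma> - a) * - ((w \<sigma>)\<^sup>2 + 2 * w \<sigma> * w' \<sigma>) \<le> exp (\<sigma> - a) * (w' \<sigma>)\<^sup>2"
      by (intro mult_left_mono) auto
    also have "\<dots> \<le> exp (b - a) * (w' \<sigma>)\<^sup>2" using \<sigma> by (intro mult_right_mono) auto
    finally show "- (exp (b - a) * (w' \<sigma>)\<^sup>2) \<le> exp (\<sigma> - a) * ((w \<sigma>)\<^sup>2 + 2 * w \<sigma> * w' \<sigma>)"
      unfolding mult_minus_right by linarith
  qed
  then show "(w a)\<^sup>2 \<le> exp (b - a) * ((w b)\<^sup>2 + I)" by (simp add: algebra_simps)
  have "((\<lambda>\<sigma>. exp (a - \<sigma>) * (w \<sigma>)\<^sup>2) has_real_derivative exp (a - \<sigma>) * (2 * w \<sigma> * w' \<sigma> - (w \<sigma>)\<^sup>2))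
      (at \<sigma> within {a..b})" if "\<sigma> \<in> {a..b}" for \<sigma>
    by (auto intro!: derivative_eq_intros w[OF that] simp: algebra_simps)
  then have 2: "((\<lambda>\<sigma>. exp (a - \<sigma>) * (2 * w \<sigma> * w' \<sigma> - (w \<sigma>)\<^sup>2)) has_integral
      exp (a - b) * (w b)\<^sup>2 - exp (a - a) * (w a)\<^sup>2) {a..b}"
    using assms(1) by (intro fundamental_theorem_of_calculus) (auto simp: has_real_derivative_iff_has_vector_derivative)
  have "exp (a - b) * (w b)\<^sup>2 - exp (a - a) * (w a)\<^sup>2 \<le> I"
  proof (rule has_integral_le[OF 2 I])
    fix \<sigma> assume \<sigma>: "\<sigma> \<in> {a..b}"
    have "0 \<le> (w \<sigma> - w' \<sigma>)\<^sup>2" by simp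
    then have "2 * w \<sigma> * w' \<sigma> - (w \<sigma>)\<^sup>2 \<le> (w' \<sigma>)\<^sup>2" by (simp add: power2_diff)
    then have "exp (a - \<sigma>) * (2 * w \<sigma> * w' \<sigma> - (w \<sigma>)\<^sup>2) \<le> exp (a - \<sigma>) * (w' \<sigma>)\<^sup>2"
      by (intro mult_left_mono) auto
    also have "\<dots> \<le> 1 * (w' \<sigma>)\<^sup>2" using \<sigma> by (intro mult_right_mono) auto
    finally show "exp (a - \<sigma>) * (2 * w \<sigma> * w' \<sigma> - (w \<sigma>)\<^sup>2) \<le> (w' \<sigma>)\<^sup>2" by simp
  qed
  then have "exp (b - a) * (exp (a - b) * (w b)\<^sup>2) \<le> exp (b - a) * ((w a)\<^sup>2 + I)"
    by (intro mult_left_mono) auto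
  also have "exp (b - a) * (exp (a - b) * (w b)\<^sup>2) = (w b)\<^sup>2"
    by (simp add: mult.assoc[symmetric] exp_add[symmetric])
  finally show "(w b)\<^sup>2 \<le> exp (b - a) * ((w a)\<^sup>2 + I)" .
qed

text \<open>A nonnegative number is the length of the set of levels in \<open>{0..}\<close> below
  it, and Tonelli exchanges the integrals. It reduces the comparison of two integrals to that of
  superlevel sets.\<close>

lemma nn_integral_layer_cake:
  fixes f :: "'a \<Rightarrow> real"
  assumes "sigma_finite_measure M" and [measurable]: "f \<in> borel_measurable M" and nonneg: "\<And>x. 0 \<le> f x"
  shows "(\<integral>\<^sup>+x. ennreal (f x) \<partial>M) = (\<integral>\<^sup>+c. emeasure M {x\<in>space M. c < f x} * indicator {0..} c \<partial>lborel)"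
proof -
  interpret sigma_finite_measure M by fact
  interpret pair_sigma_finite M lborel ..
  have "(\<integral>\<^sup>+x. ennreal (f x) \<partial>M) = (\<integral>\<^sup>+x. \<integral>\<^sup>+c. indicator {0..<f x} c \<partial>lborel \<partial>M)"
    using nonneg by (intro nn_integral_cong) simp
  also have "\<dots> = (\<integral>\<^sup>+x. \<integral>\<^sup>+c. indicator {y\<in>space M. c < f y} x * indicator {0..} c \<partial>lborel \<partial>M)"
    by (intro nn_integral_cong) (auto simp: indicator_def)
  also have "\<dots> = (\<integral>\<^sup>+c. \<integral>\<^sup>+x. indicator {y\<in>space M. c < f y} x * indicator {0..} c \<partial>M \<partial>lborel)"
    by (rule Fubini'[symmetric]) measurable
  also have "\<dots> = (\<integral>\<^sup>+c. emeasure M {x\<in>space M. c < f x} * indicator {0..} c \<partial>lborel)"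
    by (intro nn_integral_cong) (subst nn_integral_multc, auto)
  finally show ?thesis .
qed

lemma nn_integral_lborel_plus:
  fixes c :: "'a::euclidean_space"
  assumes [measurable]: "f \<in> borel_measurable borel"
  shows "(\<integral>\<^sup>+x. f (x + c) \<partial>lborel) = (\<integral>\<^sup>+x. f x \<partial>lborel)"
  by (subst (2) lborel_distr_plus[of c, symmetric], subst nn_integral_distr) (auto simp: add.commute)

section \<open>The transport operator as differentiation along characteristics\<close>

definition transport_of :: "(real \<Rightarrow> 'a::euclidean_space) \<Rightarrow> ('a \<times> real \<Rightarrow> real) \<Rightarrow> 'a \<times> real \<Rightarrow> real" where
  "transport_of H \<phi> = (\<lambda>(x, \<tau>). snd (grad \<phi> (x, \<tau>)) + H \<tau> \<bullet> fst (grad \<phi> (x, \<tau>)))"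

lemma continuous_on_transport_of:
  assumes "smooth \<phi>" "continuous_on UNIV H"
  shows "continuous_on UNIV (transport_of H \<phi>)"
  unfolding transport_of_def split_beta
  by (intro continuous_intros continuous_on_compose2[OF assms(2)] continuous_on_compose2[OF continuous_on_grad[OF assms(1), of UNIV]]) auto

lemma has_real_derivative_along:
  fixes q :: "real \<Rightarrow> 'a::euclidean_space"
  assumes "smooth \<phi>" "(q has_vector_derivative H \<tau>) (at \<tau> within S)"
  shows "((\<lambda>\<sigma>. \<phi> (q \<sigma>, \<sigma>)) has_real_derivative transport_of H \<phi> (q \<tau>, \<tau>)) (at \<tau> within S)"
proof -
  have "((\<lambda>\<sigma>. (q \<sigma>, \<sigma>)) has_derivative (\<lambda>c. (c *\<^sub>R H \<tau>, c))) (at \<tau> within S)"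
    using assms(2) unfolding has_vector_derivative_def by (intro has_derivative_Pair) auto
  from has_derivative_compose[OF this has_derivative_grad[OF assms(1)]]
  show ?thesis
    by (rule has_derivative_imp_has_field_derivative)
      (simp add: transport_of_def inner_prod_def algebra_simps inner_commute)
qed

lemma energy_along:
  fixes q :: "real \<Rightarrow> 'a::euclidean_space"
  assumes "smooth \<phi>" "continuous_on UNIV H" "a \<le> b"
    and q: "\<And>\<tau>. \<tau> \<in> {a..b} \<Longrightarrow> (q has_vector_derivative H \<tau>) (at \<tau> within {a..b})"
  defines "J \<equiv> \<integral>\<^sup>+\<sigma>. ennreal ((transport_of H \<phi> (q \<sigma>, \<sigma>))\<^sup>2) * indicator {a..b} \<sigma> \<partial>lborel"
  shows "ennreal ((\<phi> (q a, a))\<^sup>2) \<le> ennreal (exp (b - a)) * (ennreal ((\<phi> (q b, b))\<^sup>2) + J)"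
    and "ennreal ((\<phi> (q b, b))\<^sup>2) \<le> ennreal (exp (b - a)) * (ennreal ((\<phi> (q a, a))\<^sup>2) + J)"
proof -
  have cont: "continuous_on {a..b} (\<lambda>\<sigma>. (transport_of H \<phi> (q \<sigma>, \<sigma>))\<^sup>2)"
  proof -
    have "continuous_on {a..b} q"
      using q by (intro continuous_on_eq_continuous_within[THEN iffD2] ballI has_vector_derivative_continuous)
    then show ?thesis
      by (intro continuous_intros continuous_on_compose2[OF continuous_on_transport_of[OF assms(1,2)]]) auto
  qed
  obtain I where I: "((\<lambda>\<sigma>. (transport_of H \<phi> (q \<sigma>, \<sigma>))\<^sup>2) has_integral I) {a..b}"
    using integrable_continuous_real[OF cont] by blast
  have "0 \<le> I" using I by (rule has_integral_nonneg) simp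
  have J: "J = ennreal I"
    unfolding J_def by (rule nn_integral_has_integral_lebesgue'[OF _ I]) simp
  note E = energy_interval[OF \<open>a \<le> b\<close> has_real_derivative_along[OF assms(1) q] I]
  have 1: "(\<phi> (q a, a))\<^sup>2 \<le> exp (b - a) * ((\<phi> (q b, b))\<^sup>2 + I)" using E(1) by blast
  have 2: "(\<phi> (q b, b))\<^sup>2 \<le> exp (b - a) * ((\<phi> (q a, a))\<^sup>2 + I)" using E(2) by blast
  show "ennreal ((\<phi> (q a, a))\<^sup>2) \<le> ennreal (exp (b - a)) * (ennreal ((\<phi> (q b, b))\<^sup>2) + J)"
    using ennreal_leI[OF 1] \<open>0 \<le> I\<close> unfolding J by (simp add: ennreal_mult)
  show "ennreal ((\<phi> (q b, b))\<^sup>2) \<le> ennreal (exp (b - a)) * (ennreal ((\<phi> (q a, a))\<^sup>2) + J)"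
    using ennreal_leI[OF 2] \<open>0 \<le> I\<close> unfolding J by (simp add: ennreal_mult)
qed

text \<open>Continuity of \<open>H\<close> and of the normal makes it relatively closed in the open
  lateral boundary.\<close>

lemma outflow_boundary_borel:
  fixes \<Omega> :: "'a::euclidean_space set"
  assumes "open \<Omega>" "smooth_boundary \<Omega>" "continuous_on {0..T} H"
  shows "outflow_boundary \<Omega> T H \<in> sets borel"
proof -
  let ?S = "frontier \<Omega> \<times> {0<..<T}"
  have "continuous_on ?S (\<lambda>p. H (snd p) \<bullet> outward_normal \<Omega> (fst p))"
    using assms by (intro continuous_intros continuous_on_compose2[OF assms(3)]
        continuous_on_compose2[OF continuous_on_outward_normal]) auto
  from continuous_closedin_preimage[OF this closed_atLeast[of 0]]
  obtain C where "closed C" "?S \<inter> (\<lambda>p. H (snd p) \<bullet> outward_normal \<Omega> (fst p)) -` {0..} = ?S \<inter> C"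
    unfolding closedin_closed by blast
  moreover have "outflow_boundary \<Omega> T H = ?S \<inter> (\<lambda>p. H (snd p) \<bullet> outward_normal \<Omega> (fst p)) -` {0..}"
    by (auto simp: outflow_boundary_def)
  moreover have "?S \<in> sets borel"
    unfolding borel_prod[symmetric] by (intro pair_measureI) auto
  ultimately show ?thesis by auto
qed

lemma outer_measure_of_Un:
  assumes "A \<subseteq> space M" "B \<subseteq> space M"
  shows "outer_measure_of M (A \<union> B) \<le> outer_measure_of M A + outer_measure_of M B"
proof -
  have "A \<union> B = (\<Union>b\<in>{True, False}. if b then A else B)" by auto
  then have "outer_measure_of M (A \<union> B) \<le> (\<Sum>b\<in>{True, False}. outer_measure_of M (if b then A else B))"
    using outer_measure_of_finite_UN[of "{True, False}" "\<lambda>b. if b then A else B" M] assms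
    by (simp del: UN_insert)
  then show ?thesis by simp
qed

lemma measurable_along:
  fixes X :: "real \<Rightarrow> 'a::euclidean_space"
  assumes "h \<in> borel_measurable borel" "continuous_on UNIV X"
  shows "(\<lambda>(x, \<sigma>). h (x + (X \<sigma> - c), \<sigma>)) \<in> borel_measurable (lborel \<Otimes>\<^sub>M lborel)"
proof -
  have "continuous_on UNIV (\<lambda>p :: 'a \<times> real. (fst p + (X (snd p) - c), snd p))"
    by (intro continuous_intros continuous_on_compose2[OF assms(2)]) auto
  then have "(\<lambda>p :: 'a \<times> real. (fst p + (X (snd p) - c), snd p)) \<in> borel \<rightarrow>\<^sub>M borel"
    by (rule borel_measurable_continuous_onI)
  from measurable_compose[OF this assms(1)] show ?thesis
    unfolding lborel_prod split_beta by simp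
qed

text \<open>At each fixed time the flow is a translation, so after exchanging the integrals the
  shift disappears.\<close>

lemma nn_integral_along:
  fixes X :: "real \<Rightarrow> 'a::euclidean_space"
  assumes h: "h \<in> borel_measurable borel" and X: "continuous_on UNIV X"
  shows "(\<integral>\<^sup>+x. \<integral>\<^sup>+\<sigma>. h (x + (X \<sigma> - c), \<sigma>) \<partial>lborel \<partial>lborel) = (\<integral>\<^sup>+p. h p \<partial>lborel)"
proof -
  have "(\<integral>\<^sup>+x. \<integral>\<^sup>+\<sigma>. h (x + (X \<sigma> - c), \<sigma>) \<partial>lborel \<partial>lborel)
      = (\<integral>\<^sup>+\<sigma>. \<integral>\<^sup>+x. h (x + (X \<sigma> - c), \<sigma>) \<partial>lborel \<partial>lborel)"
    by (rule lborel_pair.Fubini'[symmetric, OF measurable_along[OF assms]])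
  also have "\<dots> = (\<integral>\<^sup>+\<sigma>. \<integral>\<^sup>+x. h (x, \<sigma>) \<partial>lborel \<partial>lborel)"
  proof (rule nn_integral_cong)
    fix \<sigma> :: real
    have "(\<lambda>x :: 'a. (x, \<sigma>)) \<in> borel \<rightarrow>\<^sub>M borel"
      by (intro borel_measurable_continuous_onI continuous_intros)
    from measurable_compose[OF this h]
    show "(\<integral>\<^sup>+x. h (x + (X \<sigma> - c), \<sigma>) \<partial>lborel) = (\<integral>\<^sup>+x. h (x, \<sigma>) \<partial>lborel)"
      by (rule nn_integral_lborel_plus)
  qed
  also have "\<dots> = (\<integral>\<^sup>+p. h p \<partial>(lborel \<Otimes>\<^sub>M lborel))"
    by (rule lborel_pair.nn_integral_snd) (simp add: lborel_prod h)
  finally show ?thesis by (simp add: lborel_prod)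
qed

text \<open>With \<open>A = exp T\<close>, the squared value at a starting point is at most
  \<open>A\<close> times the squared value where its characteristic is stopped plus the energy
  \<open>J\<close> collected on the way. The stop is either at time \<open>T\<close> inside the
  domain or at an exit point. The factor 2 in the constant pays for absorbing
  \<open>J\<close>.\<close>

lemma smooth_energy_estimate:
  fixes \<Omega> :: "'a::euclidean_space set" and H X :: "real \<Rightarrow> 'a"
  assumes \<Omega>: "open \<Omega>" "bounded \<Omega>" "smooth_boundary \<Omega>" and "0 < T"
    and H: "continuous_on UNIV H" and "0 \<le> L" and HL: "\<And>\<tau>. \<tau> \<in> {0..T} \<Longrightarrow> norm (H \<tau>) \<le> L"
    and X: "continuous_on UNIV X"
    and X': "\<And>\<tau>. \<tau> \<in> {0..T} \<Longrightarrow> (X has_vector_derivative H \<tau>) (at \<tau> within {0..T})"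
    and \<phi>: "smooth \<phi>" and \<tau>0: "\<tau>0 \<in> {0..T}"
  shows "(\<integral>\<^sup>+x. ennreal ((\<phi> (x, \<tau>0))\<^sup>2) * indicator \<Omega> x \<partial>lborel)
    \<le> ennreal (2 * exp T * (1 + sweep_const TYPE('a) L)) *
      ((\<integral>\<^sup>+p. ennreal ((transport_of H \<phi> p)\<^sup>2) * indicator (cylinder \<Omega> T) p \<partial>lborel)
        + (\<integral>\<^sup>+x. ennreal ((\<phi> (x, T))\<^sup>2) * indicator \<Omega> x \<partial>lborel)
        + (\<integral>\<^sup>+p. ennreal ((\<phi> p)\<^sup>2) * indicator (outflow_boundary \<Omega> T H) p \<partial>lateral_product \<Omega> T))"
proof -
  let ?M = "lateral_product \<Omega> T" and ?K = "sweep_const TYPE('a) L"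
  define A where "A = exp T"
  have "0 < A" by (simp add: A_def)
  have K: "0 < ?K" using sweep_const_pos[OF \<open>0 \<le> L\<close>] .
  interpret M: finite_measure ?M by (rule finite_measure_lateral_product[OF \<Omega>])
  have [measurable]: "\<Omega> \<in> sets borel" using \<Omega>(1) by simp
  have \<phi>_meas: "\<phi> \<in> borel_measurable borel"
    using smooth_continuous[OF \<phi>] by (rule borel_measurable_continuous_onI)
  have slice_meas: "(\<lambda>x. \<phi> (x, \<sigma>)) \<in> borel_measurable borel" for \<sigma>
    by (rule measurable_compose[OF _ \<phi>_meas]) (intro borel_measurable_continuous_onI continuous_intros)
  have cyl: "cylinder \<Omega> T \<in> sets borel"
    unfolding cylinder_def borel_prod[symmetric] by (intro pair_measureI) auto
  have out: "outflow_boundary \<Omega> T H \<in> sets borel"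
    using outflow_boundary_borel[OF \<Omega>(1,3) continuous_on_subset[OF H]] by simp
  have out_sub: "outflow_boundary \<Omega> T H \<subseteq> frontier \<Omega> \<times> {0<..<T}"
    by (auto simp: outflow_boundary_def)
  \<comment> \<open>Normalised to vanish at \<open>\<tau>0\<close>, so that \<open>sweep Y\<close>
    leads back to the position at that time.\<close>
  define Y where "Y \<sigma> = X \<sigma> - X \<tau>0" for \<sigma>
  define h where "h p = ennreal ((transport_of H \<phi> p)\<^sup>2) * indicator (cylinder \<Omega> T) p" for p
  have h_meas: "h \<in> borel_measurable borel"
  proof -
    have "transport_of H \<phi> \<in> borel_measurable borel"
      using continuous_on_transport_of[OF \<phi> H] by (rule borel_measurable_continuous_onI)
    then show ?thesis unfolding h_def using cyl by measurable
  qed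
  have lip: "norm (Y \<sigma> - Y \<tau>) \<le> L * \<bar>\<sigma> - \<tau>\<bar>" if "\<sigma> \<in> {0..T}" "\<tau> \<in> {0..T}" for \<sigma> \<tau>
  proof -
    have "norm (X \<sigma> - X \<tau>) \<le> L * norm (\<sigma> - \<tau>)"
    proof (rule differentiable_bound[of "{0..T}"])
      show "(X has_derivative (\<lambda>c. c *\<^sub>R H \<rho>)) (at \<rho> within {0..T})" if "\<rho> \<in> {0..T}" for \<rho>
        using X'[OF that] by (simp add: has_vector_derivative_def)
      show "onorm (\<lambda>c. c *\<^sub>R H \<rho>) \<le> L" if "\<rho> \<in> {0..T}" for \<rho>
        using HL[OF that] by (intro onorm_le) (simp add: mult.commute[of L] mult_left_mono)
    qed (use that in auto)
    then show ?thesis by (simp add: Y_def)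
  qed
  define q where "q x \<sigma> = x + Y \<sigma>" for x \<sigma>
  have q_start: "q x \<tau>0 = x" for x by (simp add: q_def Y_def)
  have q_sweep: "x = sweep Y (q x \<sigma>, \<sigma>)" for x \<sigma> by (simp add: sweep_def q_def)
  have q': "(q x has_vector_derivative H \<tau>) (at \<tau> within S)" if "S \<subseteq> {0..T}" "\<tau> \<in> S" for x \<tau> S
    unfolding q_def[abs_def] Y_def
    using has_vector_derivative_within_subset[OF X' that(1), of \<tau>] that by (auto intro!: derivative_eq_intros)
  define J where "J x = (\<integral>\<^sup>+\<sigma>. h (x + (X \<sigma> - X \<tau>0), \<sigma>) \<partial>lborel)" for x
  have J_meas: "J \<in> borel_measurable borel"
  proof -
    have "J \<in> borel_measurable lborel"
      unfolding J_def[abs_def] by (rule lborel.borel_measurable_nn_integral[OF measurable_along[OF h_meas X]])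
    then show ?thesis by simp
  qed
  define F where "F x = (\<phi> (x, \<tau>0))\<^sup>2" for x
  \<comment> \<open>The indicator discards characteristics that are outside the domain at the final
    time, so that the integral of \<open>G\<close> is the one over \<open>\<Omega>\<close>.\<close>
  define G where "G x = (\<phi> (q x T, T))\<^sup>2 * indicator \<Omega> (q x T)" for x
  have F_meas: "F \<in> borel_measurable borel"
    unfolding F_def[abs_def] using slice_meas by measurable
  have G_meas: "G \<in> borel_measurable borel"
  proof -
    have "(\<lambda>y. (\<phi> (y, T))\<^sup>2 * indicator \<Omega> y) \<in> borel_measurable borel"
      using slice_meas by measurable
    moreover have "(\<lambda>x. q x T) \<in> borel \<rightarrow>\<^sub>M borel"
      unfolding q_def by measurable
    ultimately show ?thesis unfolding G_def[abs_def] by (rule measurable_compose[rotated])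
  qed
  have along: "ennreal (F x) \<le> ennreal A * (ennreal ((\<phi> (q x b, b))\<^sup>2) + J x)"
    if b: "b \<in> {\<tau>0..T}" and inside: "\<And>\<sigma>. \<tau>0 \<le> \<sigma> \<Longrightarrow> \<sigma> < b \<Longrightarrow> q x \<sigma> \<in> \<Omega>" for x b
  proof -
    have "ennreal (F x) \<le> ennreal (exp (b - \<tau>0)) * (ennreal ((\<phi> (q x b, b))\<^sup>2)
        + (\<integral>\<^sup>+\<sigma>. ennreal ((transport_of H \<phi> (q x \<sigma>, \<sigma>))\<^sup>2) * indicator {\<tau>0..b} \<sigma> \<partial>lborel))"
      using energy_along(1)[OF \<phi> H, of \<tau>0 b "q x"] q'[of "{\<tau>0..b}"] b \<tau>0
      by (auto simp: F_def q_start)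
    also have "\<dots> \<le> ennreal A * (ennreal ((\<phi> (q x b, b))\<^sup>2) + J x)"
    proof (intro mult_mono add_left_mono)
      show "ennreal (exp (b - \<tau>0)) \<le> ennreal A" using b \<tau>0 by (intro ennreal_leI) (auto simp: A_def)
      \<comment> \<open>The end points are excluded because the cylinder is open in time and the
        characteristic may lie on the frontier at time \<open>b\<close>.\<close>
      have "AE \<sigma> in lborel. \<sigma> \<noteq> \<tau>0 \<and> \<sigma> \<noteq> b"
        using AE_lborel_singleton[of \<tau>0] AE_lborel_singleton[of b] by eventually_elim auto
      then show "(\<integral>\<^sup>+\<sigma>. ennreal ((transport_of H \<phi> (q x \<sigma>, \<sigma>))\<^sup>2) * indicator {\<tau>0..b} \<sigma> \<partial>lborel) \<le> J x"
        unfolding J_def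
      proof (intro nn_integral_mono_AE, eventually_elim)
        fix \<sigma> assume "\<sigma> \<noteq> \<tau>0 \<and> \<sigma> \<noteq> b"
        then have "(q x \<sigma>, \<sigma>) \<in> cylinder \<Omega> T" if "\<sigma> \<in> {\<tau>0..b}"
          using that inside[of \<sigma>] b \<tau>0 by (auto simp: cylinder_def)
        then show "ennreal ((transport_of H \<phi> (q x \<sigma>, \<sigma>))\<^sup>2) * indicator {\<tau>0..b} \<sigma> \<le> h (x + (X \<sigma> - X \<tau>0), \<sigma>)"
          by (auto simp: h_def q_def Y_def indicator_def)
      qed
    qed auto
    finally show ?thesis .
  qed
  \<comment> \<open>Outside \<open>W\<close> the value at \<open>(x, \<tau>0)\<close> is controlled by \<open>J\<close> and \<open>G\<close>; on \<open>W\<close> the characteristic has to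
    leave \<open>\<Omega>\<close>, and the value at the exit point dominates.\<close>
  define W where "W = {x \<in> \<Omega>. ennreal (2 * A) * J x < ennreal (F x) \<and> 2 * A * G x < F x}"
  have W_meas: "W \<in> sets borel"
    unfolding W_def using J_meas F_meas G_meas by measurable
  define v where "v x = F x * indicator W x" for x
  have v_meas: "v \<in> borel_measurable borel" unfolding v_def[abs_def] using F_meas W_meas by measurable
  have v_nonneg: "0 \<le> v x" for x by (simp add: v_def F_def)
  define g where "g p = 2 * A * (\<phi> p)\<^sup>2 * indicator (outflow_boundary \<Omega> T H) p" for p
  have g_meas: "g \<in> borel_measurable borel"
    unfolding g_def[abs_def] using \<phi>_meas out by measurable
  have g_nonneg: "0 \<le> g p" for p using \<open>0 < A\<close> by (simp add: g_def)
  \<comment> \<open>An exit exactly at time \<open>T\<close> is not a point of \<Sigma>, whose times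
    are strictly before \<open>T\<close>; these starting points are collected in a separate sweep,
    which is null.\<close>
  have level: "{x. c < v x} \<subseteq> sweep Y ` (frontier \<Omega> \<times> {T..T}) \<union> sweep Y ` {p \<in> outflow_boundary \<Omega> T H. c < g p}"
    if "0 \<le> c" for c
  proof
    fix x assume "x \<in> {x. c < v x}"
    then have x: "x \<in> W" "c < F x" using \<open>0 \<le> c\<close> by (cases "x \<in> W"; simp add: v_def)+
    then have "x \<in> \<Omega>" "ennreal (2 * A) * J x < ennreal (F x)" "2 * A * G x < F x" by (auto simp: W_def)
    then have "J x \<noteq> top" using \<open>0 < A\<close> by (auto simp: ennreal_mult_top)
    then obtain j where j: "J x = ennreal j" "0 \<le> j" by (cases "J x") auto
    have jF: "2 * A * j < F x"
      using \<open>ennreal (2 * A) * J x < ennreal (F x)\<close> j \<open>0 < A\<close>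
      by (simp add: ennreal_mult[symmetric] ennreal_less_iff)
    have along': "F x \<le> A * ((\<phi> (q x b, b))\<^sup>2 + j)"
      if "b \<in> {\<tau>0..T}" "\<And>\<sigma>. \<tau>0 \<le> \<sigma> \<Longrightarrow> \<sigma> < b \<Longrightarrow> q x \<sigma> \<in> \<Omega>" for b
    proof -
      have "ennreal (F x) \<le> ennreal (A * ((\<phi> (q x b, b))\<^sup>2 + j))"
        using along[OF that] j \<open>0 < A\<close> by (simp add: ennreal_mult)
      then show ?thesis using j \<open>0 < A\<close> by (subst (asm) ennreal_le_iff) auto
    qed
    have cont_q: "continuous_on {\<tau>0..T} (q x)"
      unfolding q_def[abs_def] Y_def using continuous_on_subset[OF X] by (intro continuous_intros) auto
    have "\<exists>\<sigma>\<in>{\<tau>0..T}. q x \<sigma> \<notin> \<Omega>"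
    proof (rule ccontr)
      assume "\<not> ?thesis"
      then have inside: "\<And>\<sigma>. \<sigma> \<in> {\<tau>0..T} \<Longrightarrow> q x \<sigma> \<in> \<Omega>" by blast
      have "F x \<le> A * ((\<phi> (q x T, T))\<^sup>2 + j)"
        using \<tau>0 by (intro along' inside) auto
      moreover have "G x = (\<phi> (q x T, T))\<^sup>2" using inside[of T] \<tau>0 by (simp add: G_def)
      ultimately show False using \<open>2 * A * G x < F x\<close> jF by (simp add: distrib_left)
    qed
    then obtain \<sigma> where "\<sigma> \<in> {\<tau>0..T}" "q x \<sigma> \<notin> \<Omega>" by blast
    moreover have "q x \<tau>0 \<in> \<Omega>" using \<open>x \<in> \<Omega>\<close> by (simp add: q_start)
    ultimately obtain \<tau> where \<tau>: "\<tau>0 < \<tau>" "\<tau> \<le> T" "q x \<tau> \<in> frontier \<Omega>"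
      and before: "\<And>\<sigma>. \<tau>0 \<le> \<sigma> \<Longrightarrow> \<sigma> < \<tau> \<Longrightarrow> q x \<sigma> \<in> \<Omega>"
      using first_exit[OF \<Omega>(1) cont_q] by metis
    show "x \<in> sweep Y ` (frontier \<Omega> \<times> {T..T}) \<union> sweep Y ` {p \<in> outflow_boundary \<Omega> T H. c < g p}"
    proof (cases "\<tau> = T")
      case True
      then have "(q x \<tau>, \<tau>) \<in> frontier \<Omega> \<times> {T..T}" using \<tau> by simp
      then have "sweep Y (q x \<tau>, \<tau>) \<in> sweep Y ` (frontier \<Omega> \<times> {T..T})" by (rule imageI)
      then show ?thesis by (simp only: q_sweep[symmetric] Un_iff simp_thms)
    next
      case False
      have "0 \<le> H \<tau> \<bullet> outward_normal \<Omega> (q x \<tau>)"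
        by (rule exit_direction[OF \<Omega>(1,3) \<tau>(1,3) before q']) (use \<tau> \<tau>0 in auto)
      then have out_pt: "(q x \<tau>, \<tau>) \<in> outflow_boundary \<Omega> T H"
        using \<tau> \<tau>0 False by (auto simp: outflow_boundary_def)
      have "F x \<le> A * ((\<phi> (q x \<tau>, \<tau>))\<^sup>2 + j)"
        using \<tau> by (intro along' before) auto
      then have "F x < g (q x \<tau>, \<tau>)" using jF out_pt by (simp add: g_def distrib_left)
      then have "(q x \<tau>, \<tau>) \<in> {p \<in> outflow_boundary \<Omega> T H. c < g p}" using out_pt x(2) by simp
      then have "sweep Y (q x \<tau>, \<tau>) \<in> sweep Y ` {p \<in> outflow_boundary \<Omega> T H. c < g p}" by (rule imageI)
      then show ?thesis by (simp only: q_sweep[symmetric] Un_iff simp_thms)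
    qed
  qed
  \<comment> \<open>The sweep bound for a time interval of length zero, which applies because the
    frontier has finite measure.\<close>
  have null: "outer_measure_of lborel (sweep Y ` (frontier \<Omega> \<times> {T..T})) = 0"
  proof -
    have "outer_measure_of lborel (sweep Y ` (frontier \<Omega> \<times> {T..T}))
        \<le> ennreal ((T - T) * ?K) * hausdorff_outer (DIM('a) - 1) (frontier \<Omega>)"
      using \<open>0 < T\<close> by (intro outer_measure_sweep_le[OF _ \<open>0 \<le> L\<close> lip] hausdorff_outer_frontier_finite[OF \<Omega>]) auto
    then show ?thesis by simp
  qed
  have v_int: "(\<integral>\<^sup>+x. ennreal (v x) \<partial>lborel) \<le> ennreal ?K * (\<integral>\<^sup>+p. ennreal (g p) \<partial>?M)"
  proof -
    have g_meas': "g \<in> borel_measurable ?M" by (rule measurable_lateral_product_borel[OF g_meas])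
    have "(\<integral>\<^sup>+x. ennreal (v x) \<partial>lborel)
        = (\<integral>\<^sup>+c. emeasure lborel {x \<in> space lborel. c < v x} * indicator {0..} c \<partial>lborel)"
      using v_meas v_nonneg by (intro nn_integral_layer_cake lborel.sigma_finite_measure_axioms) auto
    also have "\<dots> \<le> (\<integral>\<^sup>+c. ennreal ?K * (emeasure ?M {p \<in> space ?M. c < g p} * indicator {0..} c) \<partial>lborel)"
    proof (rule nn_integral_mono)
      fix c :: real
      have "emeasure lborel {x \<in> space lborel. c < v x} \<le> ennreal ?K * emeasure ?M {p \<in> space ?M. c < g p}" if "0 \<le> c"
      proof -
        \<comment> \<open>A level \<open>c \<ge> 0\<close> can be exceeded only where the indicator
          in \<open>g\<close> is 1, that is, on \<Sigma>.\<close>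
        have eq: "{p \<in> outflow_boundary \<Omega> T H. c < g p} = {p \<in> space ?M. c < g p}"
          using that out_sub unfolding space_lateral_product by (auto simp: g_def indicator_def split: if_splits)
        have "emeasure lborel {x \<in> space lborel. c < v x} = outer_measure_of lborel {x. c < v x}"
          using v_meas by (subst outer_measure_of_eq) auto
        also have "\<dots> \<le> outer_measure_of lborel (sweep Y ` (frontier \<Omega> \<times> {T..T}) \<union> sweep Y ` {p \<in> outflow_boundary \<Omega> T H. c < g p})"
          by (rule outer_measure_of_mono[OF level[OF that]])
        also have "\<dots> \<le> outer_measure_of lborel (sweep Y ` (frontier \<Omega> \<times> {T..T}))
            + outer_measure_of lborel (sweep Y ` {p \<in> outflow_boundary \<Omega> T H. c < g p})"
          by (rule outer_measure_of_Un) auto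
        also have "\<dots> \<le> ennreal ?K * emeasure ?M {p \<in> outflow_boundary \<Omega> T H. c < g p}"
          unfolding null add_0
        proof (rule outer_measure_sweep_borel[OF \<Omega> \<open>0 < T\<close> \<open>0 \<le> L\<close> lip])
          have "{p \<in> outflow_boundary \<Omega> T H. c < g p} = outflow_boundary \<Omega> T H \<inter> {p \<in> space borel. c < g p}"
            by auto
          also have "\<dots> \<in> sets borel" using out g_meas by measurable
          finally show "{p \<in> outflow_boundary \<Omega> T H. c < g p} \<in> sets borel" .
        qed (use out_sub in auto)
        finally show ?thesis unfolding eq .
      qed
      then show "emeasure lborel {x \<in> space lborel. c < v x} * indicator {0..} c
          \<le> ennreal ?K * (emeasure ?M {p \<in> space ?M. c < g p} * indicator {0..} c)"
        by (cases "0 \<le> c") (auto simp: indicator_def)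
    qed
    also have "\<dots> = ennreal ?K * (\<integral>\<^sup>+c. emeasure ?M {p \<in> space ?M. c < g p} * indicator {0..} c \<partial>lborel)"
    proof (rule nn_integral_cmult)
      have "case_prod (\<lambda>c p. indicator {p \<in> space ?M. c < g p} p :: ennreal) \<in> borel_measurable (lborel \<Otimes>\<^sub>M ?M)"
        using g_meas' by measurable
      from M.borel_measurable_nn_integral[OF this]
      have "(\<lambda>c. emeasure ?M {p \<in> space ?M. c < g p}) \<in> borel_measurable lborel"
        using g_meas' by (subst (asm) nn_integral_indicator) auto
      then show "(\<lambda>c. emeasure ?M {p \<in> space ?M. c < g p} * indicator {0..} c) \<in> borel_measurable lborel"
        by measurable
    qed
    also have "(\<integral>\<^sup>+c. emeasure ?M {p \<in> space ?M. c < g p} * indicator {0..} c \<partial>lborel) = (\<integral>\<^sup>+p. ennreal (g p) \<partial>?M)"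
      using g_meas' g_nonneg by (intro nn_integral_layer_cake[symmetric] M.sigma_finite_measure_axioms) auto
    finally show ?thesis .
  qed
  \<comment> \<open>Outside \<open>W\<close> one of the first two terms already dominates by the
    definition of \<open>W\<close>; on \<open>W\<close> the last term equals the left-hand
    side.\<close>
  have split: "ennreal (F x) * indicator \<Omega> x \<le> ennreal (2 * A) * J x + ennreal (2 * A * G x) + ennreal (v x)" for x
  proof (cases "x \<in> \<Omega>")
    case True
    then consider "x \<in> W" | "ennreal (F x) \<le> ennreal (2 * A) * J x" | "F x \<le> 2 * A * G x"
      unfolding W_def by fastforce
    then show ?thesis
    proof cases
      case 1
      then show ?thesis using True by (simp add: v_def)
    next
      case 2
      then show ?thesis using True by (simp add: add.assoc add_increasing2)
    next
      case 3
      then have "ennreal (F x) \<le> ennreal (2 * A * G x)" by (rule ennreal_leI)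
      then show ?thesis using True by (simp add: add_increasing add_increasing2)
    qed
  qed simp
  have J_int: "(\<integral>\<^sup>+x. J x \<partial>lborel) = (\<integral>\<^sup>+p. h p \<partial>lborel)"
    unfolding J_def by (rule nn_integral_along[OF h_meas X])
  have G_int: "(\<integral>\<^sup>+x. ennreal (G x) \<partial>lborel) = (\<integral>\<^sup>+x. ennreal ((\<phi> (x, T))\<^sup>2) * indicator \<Omega> x \<partial>lborel)"
  proof -
    have "(\<integral>\<^sup>+x. ennreal (G x) \<partial>lborel) = (\<integral>\<^sup>+x. ennreal ((\<phi> (x + Y T, T))\<^sup>2) * indicator \<Omega> (x + Y T) \<partial>lborel)"
      by (intro nn_integral_cong) (simp add: G_def q_def indicator_def)
    also have "\<dots> = (\<integral>\<^sup>+x. ennreal ((\<phi> (x, T))\<^sup>2) * indicator \<Omega> x \<partial>lborel)"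
    proof (rule nn_integral_lborel_plus)
      show "(\<lambda>x. ennreal ((\<phi> (x, T))\<^sup>2) * indicator \<Omega> x) \<in> borel_measurable borel"
        using slice_meas[of T] by measurable
    qed
    finally show ?thesis .
  qed
  have g_int: "(\<integral>\<^sup>+p. ennreal (g p) \<partial>?M)
      = ennreal (2 * A) * (\<integral>\<^sup>+p. ennreal ((\<phi> p)\<^sup>2) * indicator (outflow_boundary \<Omega> T H) p \<partial>?M)"
  proof -
    have "(\<integral>\<^sup>+p. ennreal (g p) \<partial>?M) = (\<integral>\<^sup>+p. ennreal (2 * A) * (ennreal ((\<phi> p)\<^sup>2) * indicator (outflow_boundary \<Omega> T H) p) \<partial>?M)"
      using \<open>0 < A\<close> by (intro nn_integral_cong) (auto simp: g_def ennreal_mult indicator_def)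
    also have "\<dots> = ennreal (2 * A) * (\<integral>\<^sup>+p. ennreal ((\<phi> p)\<^sup>2) * indicator (outflow_boundary \<Omega> T H) p \<partial>?M)"
      by (rule nn_integral_cmult, rule measurable_lateral_product_borel) (use \<phi>_meas out in measurable)
    finally show ?thesis .
  qed
  let ?IP = "\<integral>\<^sup>+p. h p \<partial>lborel" and ?IT = "\<integral>\<^sup>+x. ennreal ((\<phi> (x, T))\<^sup>2) * indicator \<Omega> x \<partial>lborel"
    and ?IS = "\<integral>\<^sup>+p. ennreal ((\<phi> p)\<^sup>2) * indicator (outflow_boundary \<Omega> T H) p \<partial>?M"
  have "(\<integral>\<^sup>+x. ennreal (F x) * indicator \<Omega> x \<partial>lborel)
      \<le> (\<integral>\<^sup>+x. ennreal (2 * A) * J x + ennreal (2 * A * G x) + ennreal (v x) \<partial>lborel)"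
    by (intro nn_integral_mono split)
  also have "\<dots> = ennreal (2 * A) * (\<integral>\<^sup>+x. J x \<partial>lborel) + (\<integral>\<^sup>+x. ennreal (2 * A * G x) \<partial>lborel) + (\<integral>\<^sup>+x. ennreal (v x) \<partial>lborel)"
    using J_meas G_meas v_meas by (simp add: nn_integral_add nn_integral_cmult)
  also have "(\<integral>\<^sup>+x. ennreal (2 * A * G x) \<partial>lborel) = ennreal (2 * A) * ?IT"
  proof -
    have "(\<integral>\<^sup>+x. ennreal (2 * A * G x) \<partial>lborel) = (\<integral>\<^sup>+x. ennreal (2 * A) * ennreal (G x) \<partial>lborel)"
      using \<open>0 < A\<close> by (intro nn_integral_cong ennreal_mult) (auto simp: G_def)
    also have "\<dots> = ennreal (2 * A) * (\<integral>\<^sup>+x. ennreal (G x) \<partial>lborel)"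
      using G_meas by (intro nn_integral_cmult) simp
    finally show ?thesis unfolding G_int .
  qed
  also have "ennreal (2 * A) * (\<integral>\<^sup>+x. J x \<partial>lborel) + ennreal (2 * A) * ?IT + (\<integral>\<^sup>+x. ennreal (v x) \<partial>lborel)
      \<le> ennreal (2 * A) * ?IP + ennreal (2 * A) * ?IT + ennreal ?K * (ennreal (2 * A) * ?IS)"
    unfolding J_int using v_int unfolding g_int by (rule add_left_mono)
  also have "\<dots> \<le> ennreal (2 * A * (1 + ?K)) * (?IP + ?IT + ?IS)"
  proof -
    have "ennreal (2 * A) \<le> ennreal (2 * A * (1 + ?K))" "ennreal (2 * A * ?K) \<le> ennreal (2 * A * (1 + ?K))"
      using \<open>0 < A\<close> K by (auto intro!: ennreal_leI mult_left_mono)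
    moreover have "ennreal ?K * (ennreal (2 * A) * ?IS) = ennreal (2 * A * ?K) * ?IS"
      using \<open>0 < A\<close> K by (simp add: ennreal_mult mult_ac)
    ultimately show ?thesis
      unfolding distrib_left by (intro add_mono) (auto intro: mult_right_mono)
  qed
  finally show ?thesis by (simp add: F_def h_def A_def)
qed

subsection \<open>Integration over slices and over the cylinder\<close>

lemma nn_integral_lebesgue_on:
  fixes \<Omega> :: "'a::euclidean_space set"
  assumes "\<Omega> \<in> sets borel"
  shows "(\<integral>\<^sup>+x. f x \<partial>lebesgue_on \<Omega>) = (\<integral>\<^sup>+x. f x * indicator \<Omega> x \<partial>lborel)"
proof -
  have "(\<integral>\<^sup>+x. f x \<partial>lebesgue_on \<Omega>) = (\<integral>\<^sup>+x. f x * indicator \<Omega> x \<partial>lebesgue)"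
    using assms(1) by (intro nn_integral_restrict_space) auto
  also have "\<dots> = (\<integral>\<^sup>+x. f x * indicator \<Omega> x \<partial>lborel)"
    by (rule nn_integral_completion)
  finally show ?thesis .
qed

lemma cylinder_borel: "open \<Omega> \<Longrightarrow> cylinder \<Omega> T \<in> sets borel"
  unfolding cylinder_def borel_prod[symmetric] by (intro pair_measureI) auto

lemma smooth_measurable: "smooth \<phi> \<Longrightarrow> \<phi> \<in> borel_measurable borel"
  using smooth_continuous by (rule borel_measurable_continuous_onI)

lemma smooth_slice_measurable:
  assumes "smooth \<phi>"
  shows "(\<lambda>x. \<phi> (x, \<tau>)) \<in> borel_measurable borel"
  by (rule measurable_compose[OF _ smooth_measurable[OF assms]])
    (intro borel_measurable_continuous_onI continuous_intros)

text \<open>Clamping time to \<open>{0..T}\<close> extends the velocity and its primitive, the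
  displacement \<open>X\<close>, continuously to all times. \<open>K\<close> depends on
  \<open>T\<close>, the dimension and a bound for the speed, but neither on \<open>\<phi>\<close>
  nor on \<open>\<tau>\<close>.\<close>

lemma energy_estimate_smooth:
  fixes \<Omega> :: "'a::euclidean_space set" and H :: "real \<Rightarrow> 'a"
  assumes \<Omega>: "open \<Omega>" "bounded \<Omega>" "smooth_boundary \<Omega>" and "0 < T" and H: "continuous_on {0..T} H"
  obtains K where "0 < K" "\<And>\<phi> \<tau>. \<lbrakk>smooth \<phi>; \<tau> \<in> {0..T}\<rbrakk> \<Longrightarrow>
    (\<integral>\<^sup>+x. ennreal ((\<phi> (x, \<tau>))\<^sup>2) \<partial>lebesgue_on \<Omega>) \<le> ennreal K *
      ((\<integral>\<^sup>+p. ennreal ((transport_of H \<phi> p)\<^sup>2) \<partial>lebesgue_on (cylinder \<Omega> T))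
        + (\<integral>\<^sup>+x. ennreal ((\<phi> (x, T))\<^sup>2) \<partial>lebesgue_on \<Omega>)
        + (\<integral>\<^sup>+p. ennreal ((\<phi> p)\<^sup>2) * indicator (outflow_boundary \<Omega> T H) p \<partial>lateral_measure \<Omega> T))"
proof -
  define cl where "cl \<tau> = max 0 (min T \<tau>)" for \<tau>
  have cl: "cl \<tau> \<in> {0..T}" for \<tau> using \<open>0 < T\<close> by (auto simp: cl_def)
  have cl_id: "cl \<tau> = \<tau>" if "\<tau> \<in> {0..T}" for \<tau> using that by (auto simp: cl_def)
  have cl_cont: "continuous_on UNIV cl" unfolding cl_def by (intro continuous_intros)
  define Hc where "Hc \<tau> = H (cl \<tau>)" for \<tau>
  define X where "X \<tau> = integral {0..cl \<tau>} H" for \<tau>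
  have Hc: "continuous_on UNIV Hc"
    unfolding Hc_def by (rule continuous_on_compose2[OF H cl_cont]) (use cl in auto)
  have X: "continuous_on UNIV X"
    unfolding X_def
    by (rule continuous_on_compose2[OF indefinite_integral_continuous_1[OF integrable_continuous_real[OF H]] cl_cont])
      (use cl in auto)
  have X': "(X has_vector_derivative Hc \<tau>) (at \<tau> within {0..T})" if "\<tau> \<in> {0..T}" for \<tau>
  proof (rule has_vector_derivative_transform[OF that])
    show "((\<lambda>u. integral {0..u} H) has_vector_derivative Hc \<tau>) (at \<tau> within {0..T})"
      using integral_has_vector_derivative[OF H that] by (simp add: Hc_def cl_id[OF that])
  qed (simp add: X_def cl_id)
  have "bounded (H ` {0..T})" by (intro compact_imp_bounded compact_continuous_image H compact_Icc)
  then obtain L where L: "0 < L" "\<And>\<tau>. \<tau> \<in> {0..T} \<Longrightarrow> norm (H \<tau>) \<le> L"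
    unfolding bounded_pos by (metis imageI)
  have HL: "norm (Hc \<tau>) \<le> L" for \<tau> using L(2)[OF cl] by (simp add: Hc_def)
  define K where "K = 2 * exp T * (1 + sweep_const TYPE('a) L)"
  have "0 < K" using sweep_const_pos[of L, where 'a='a] L(1) by (auto simp: K_def intro!: mult_pos_pos add_pos_pos)
  have out: "outflow_boundary \<Omega> T Hc = outflow_boundary \<Omega> T H"
    by (auto simp: outflow_boundary_def Hc_def cl_id)
  have \<Omega>_borel: "\<Omega> \<in> sets borel" using \<Omega>(1) by simp
  have "(\<integral>\<^sup>+x. ennreal ((\<phi> (x, \<tau>))\<^sup>2) \<partial>lebesgue_on \<Omega>) \<le> ennreal K *
      ((\<integral>\<^sup>+p. ennreal ((transport_of H \<phi> p)\<^sup>2) \<partial>lebesgue_on (cylinder \<Omega> T))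
        + (\<integral>\<^sup>+x. ennreal ((\<phi> (x, T))\<^sup>2) \<partial>lebesgue_on \<Omega>)
        + (\<integral>\<^sup>+p. ennreal ((\<phi> p)\<^sup>2) * indicator (outflow_boundary \<Omega> T H) p \<partial>lateral_measure \<Omega> T))"
    if \<phi>: "smooth \<phi>" and \<tau>: "\<tau> \<in> {0..T}" for \<phi> \<tau>
  proof -
    have 1: "(\<integral>\<^sup>+x. ennreal ((\<phi> (x, \<tau>))\<^sup>2) \<partial>lebesgue_on \<Omega>) = (\<integral>\<^sup>+x. ennreal ((\<phi> (x, \<tau>))\<^sup>2) * indicator \<Omega> x \<partial>lborel)" for \<tau>
      by (rule nn_integral_lebesgue_on[OF \<Omega>_borel])
    have "(\<integral>\<^sup>+p. ennreal ((transport_of H \<phi> p)\<^sup>2) \<partial>lebesgue_on (cylinder \<Omega> T))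
        = (\<integral>\<^sup>+p. ennreal ((transport_of Hc \<phi> p)\<^sup>2) \<partial>lebesgue_on (cylinder \<Omega> T))"
      by (intro nn_integral_cong) (auto simp: transport_of_def cylinder_def Hc_def cl_id)
    also have "\<dots> = (\<integral>\<^sup>+p. ennreal ((transport_of Hc \<phi> p)\<^sup>2) * indicator (cylinder \<Omega> T) p \<partial>lborel)"
      by (rule nn_integral_lebesgue_on[OF cylinder_borel[OF \<Omega>(1)]])
    finally have 2: "(\<integral>\<^sup>+p. ennreal ((transport_of H \<phi> p)\<^sup>2) \<partial>lebesgue_on (cylinder \<Omega> T))
      = (\<integral>\<^sup>+p. ennreal ((transport_of Hc \<phi> p)\<^sup>2) * indicator (cylinder \<Omega> T) p \<partial>lborel)" .
    have 3: "(\<integral>\<^sup>+p. ennreal ((\<phi> p)\<^sup>2) * indicator (outflow_boundary \<Omega> T H) p \<partial>lateral_measure \<Omega> T)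
      = (\<integral>\<^sup>+p. ennreal ((\<phi> p)\<^sup>2) * indicator (outflow_boundary \<Omega> T H) p \<partial>lateral_product \<Omega> T)"
      unfolding lateral_measure_def
      by (rule nn_integral_completion)
    show ?thesis
      unfolding 1 2 3 K_def
      using smooth_energy_estimate[OF \<Omega> \<open>0 < T\<close> Hc less_imp_le[OF L(1)] HL X X' \<phi> \<tau>] by (simp add: out)
  qed
  then show thesis using that \<open>0 < K\<close> by blast
qed

text \<open>The trace inequality for time slices. With velocity zero, \<open>transport_of\<close> is
  the time derivative, so the energy estimate compares the slice at \<open>\<tau>\<close> with any
  slice \<open>\<rho>\<close>; averaging over \<open>\<rho>\<close> gives the factor
  \<open>1 / T\<close>.\<close>

lemma time_slice_estimate:
  fixes \<Omega> :: "'a::euclidean_space set" and \<psi> :: "'a \<times> real \<Rightarrow> real"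
  assumes "open \<Omega>" "0 < T" "smooth \<psi>" "\<tau> \<in> {0..T}"
  shows "(\<integral>\<^sup>+x. ennreal ((\<psi> (x, \<tau>))\<^sup>2) \<partial>lebesgue_on \<Omega>) \<le> ennreal (exp T * (1 + 1 / T)) *
      ((\<integral>\<^sup>+p. ennreal ((\<psi> p)\<^sup>2) \<partial>lebesgue_on (cylinder \<Omega> T))
        + (\<integral>\<^sup>+p. ennreal ((norm (grad \<psi> p))\<^sup>2) \<partial>lebesgue_on (cylinder \<Omega> T)))"
proof -
  let ?Q = "cylinder \<Omega> T"
  have Q: "?Q \<in> sets borel" by (rule cylinder_borel[OF assms(1)])
  have \<Omega>_borel: "\<Omega> \<in> sets borel" using assms(1) by simp
  have \<psi>_meas: "\<psi> \<in> borel_measurable borel" by (rule smooth_measurable[OF assms(3)])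
  have grad_meas: "grad \<psi> \<in> borel_measurable borel"
    using continuous_on_grad[OF assms(3)] by (rule borel_measurable_continuous_onI)
  define h1 where "h1 p = ennreal ((\<psi> p)\<^sup>2) * indicator ?Q p" for p
  define h2 where "h2 p = ennreal ((norm (grad \<psi> p))\<^sup>2) * indicator ?Q p" for p
  have h1_meas: "h1 \<in> borel_measurable (lborel \<Otimes>\<^sub>M lborel)"
    unfolding h1_def[abs_def] lborel_prod using \<psi>_meas Q by measurable
  have h2_meas: "h2 \<in> borel_measurable (lborel \<Otimes>\<^sub>M lborel)"
    unfolding h2_def[abs_def] lborel_prod using grad_meas Q by measurable
  have fiber: "(\<lambda>\<sigma>. h (x, \<sigma>)) \<in> borel_measurable lborel" if "h \<in> borel_measurable (lborel \<Otimes>\<^sub>M lborel)"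
    for h :: "'a \<times> real \<Rightarrow> ennreal" and x
    using measurable_compose[OF measurable_Pair1' that] by simp
  have fiber_int: "(\<lambda>x. \<integral>\<^sup>+\<sigma>. h (x, \<sigma>) \<partial>lborel) \<in> borel_measurable lborel"
    if "h \<in> borel_measurable (lborel \<Otimes>\<^sub>M lborel)" for h :: "'a \<times> real \<Rightarrow> ennreal"
    using lborel.borel_measurable_nn_integral_fst[OF that] .
  have pt: "ennreal ((\<psi> (x, \<tau>))\<^sup>2) \<le> ennreal (exp T) * (ennreal ((\<psi> (x, \<rho>))\<^sup>2) + (\<integral>\<^sup>+\<sigma>. h2 (x, \<sigma>) \<partial>lborel))"
    if "x \<in> \<Omega>" "\<rho> \<in> {0<..<T}" for x \<rho>
  proof -
    \<comment> \<open>The time \<open>\<rho>\<close> may lie on either side of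
      \<open>\<tau>\<close>, which is why both directions of the energy estimate are used.\<close>
    define a b where "a = min \<tau> \<rho>" and "b = max \<tau> \<rho>"
    have ab: "a \<le> b" "0 \<le> a" "b \<le> T" using assms(4) that by (auto simp: a_def b_def)
    define J where "J = (\<integral>\<^sup>+\<sigma>. ennreal ((transport_of (\<lambda>_. 0) \<psi> (x, \<sigma>))\<^sup>2) * indicator {a..b} \<sigma> \<partial>lborel)"
    have E: "ennreal ((\<psi> (x, a))\<^sup>2) \<le> ennreal (exp (b - a)) * (ennreal ((\<psi> (x, b))\<^sup>2) + J)"
      "ennreal ((\<psi> (x, b))\<^sup>2) \<le> ennreal (exp (b - a)) * (ennreal ((\<psi> (x, a))\<^sup>2) + J)"
      using energy_along[OF assms(3) _ ab(1), of "\<lambda>_. 0" "\<lambda>_. x"] unfolding J_def by auto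
    have "ennreal ((\<psi> (x, \<tau>))\<^sup>2) \<le> ennreal (exp (b - a)) * (ennreal ((\<psi> (x, \<rho>))\<^sup>2) + J)"
      using E unfolding a_def b_def by (cases "\<tau> \<le> \<rho>") (auto simp: min_def max_def)
    also have "\<dots> \<le> ennreal (exp T) * (ennreal ((\<psi> (x, \<rho>))\<^sup>2) + (\<integral>\<^sup>+\<sigma>. h2 (x, \<sigma>) \<partial>lborel))"
    proof (intro mult_mono add_left_mono)
      show "ennreal (exp (b - a)) \<le> ennreal (exp T)" using ab by (intro ennreal_leI) auto
      have "AE \<sigma> in lborel. \<sigma> \<noteq> 0 \<and> \<sigma> \<noteq> T"
        using AE_lborel_singleton[of 0] AE_lborel_singleton[of T] by eventually_elim auto
      then show "J \<le> (\<integral>\<^sup>+\<sigma>. h2 (x, \<sigma>) \<partial>lborel)"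
        unfolding J_def
      proof (intro nn_integral_mono_AE, eventually_elim)
        fix \<sigma> assume \<sigma>: "\<sigma> \<noteq> 0 \<and> \<sigma> \<noteq> T"
        have "(snd (grad \<psi> (x, \<sigma>)))\<^sup>2 \<le> (norm (grad \<psi> (x, \<sigma>)))\<^sup>2"
          using norm_snd_le[of "snd (grad \<psi> (x, \<sigma>))" "fst (grad \<psi> (x, \<sigma>))"] by (simp add: power2_le_iff_abs_le)
        then have "ennreal ((transport_of (\<lambda>_. 0) \<psi> (x, \<sigma>))\<^sup>2) \<le> ennreal ((norm (grad \<psi> (x, \<sigma>)))\<^sup>2)"
          by (intro ennreal_leI) (simp add: transport_of_def)
        moreover have "(x, \<sigma>) \<in> ?Q" if "\<sigma> \<in> {a..b}"
          using that \<sigma> ab \<open>x \<in> \<Omega>\<close> by (auto simp: cylinder_def)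
        ultimately show "ennreal ((transport_of (\<lambda>_. 0) \<psi> (x, \<sigma>))\<^sup>2) * indicator {a..b} \<sigma> \<le> h2 (x, \<sigma>)"
          by (auto simp: h2_def indicator_def)
      qed
    qed auto
    finally show ?thesis .
  qed
  have avg: "ennreal T * (ennreal ((\<psi> (x, \<tau>))\<^sup>2) * indicator \<Omega> x)
      \<le> ennreal (exp T) * ((\<integral>\<^sup>+\<sigma>. h1 (x, \<sigma>) \<partial>lborel) + ennreal T * (\<integral>\<^sup>+\<sigma>. h2 (x, \<sigma>) \<partial>lborel))" for x
  proof (cases "x \<in> \<Omega>")
    case True
    let ?c = "\<integral>\<^sup>+\<sigma>. h2 (x, \<sigma>) \<partial>lborel"
    have "ennreal T * ennreal ((\<psi> (x, \<tau>))\<^sup>2) = (\<integral>\<^sup>+\<rho>. ennreal ((\<psi> (x, \<tau>))\<^sup>2) * indicator {0<..<T} \<rho> \<partial>lborel)"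
      using \<open>0 < T\<close> by (subst nn_integral_cmult_indicator) (auto simp: mult.commute)
    also have "\<dots> \<le> (\<integral>\<^sup>+\<rho>. ennreal (exp T) * (h1 (x, \<rho>) + ?c * indicator {0<..<T} \<rho>) \<partial>lborel)"
    proof (rule nn_integral_mono)
      fix \<rho>
      show "ennreal ((\<psi> (x, \<tau>))\<^sup>2) * indicator {0<..<T} \<rho> \<le> ennreal (exp T) * (h1 (x, \<rho>) + ?c * indicator {0<..<T} \<rho>)"
        using pt[OF True, of \<rho>] True by (cases "\<rho> \<in> {0<..<T}") (auto simp: h1_def cylinder_def)
    qed
    also have "\<dots> = ennreal (exp T) * ((\<integral>\<^sup>+\<rho>. h1 (x, \<rho>) \<partial>lborel) + (\<integral>\<^sup>+\<rho>. ?c * indicator {0<..<T} \<rho> \<partial>lborel))"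
      using fiber[OF h1_meas] by (simp add: nn_integral_cmult nn_integral_add)
    also have "(\<integral>\<^sup>+\<rho>. ?c * indicator {0<..<T} \<rho> \<partial>lborel) = ennreal T * ?c"
      using \<open>0 < T\<close> by (subst nn_integral_cmult_indicator) (auto simp: mult.commute)
    finally show ?thesis using True by simp
  qed simp
  have "ennreal T * (\<integral>\<^sup>+x. ennreal ((\<psi> (x, \<tau>))\<^sup>2) * indicator \<Omega> x \<partial>lborel)
      = (\<integral>\<^sup>+x. ennreal T * (ennreal ((\<psi> (x, \<tau>))\<^sup>2) * indicator \<Omega> x) \<partial>lborel)"
  proof (rule nn_integral_cmult[symmetric])
    note [measurable] = \<Omega>_borel smooth_slice_measurable[OF assms(3), of \<tau>]
    show "(\<lambda>x. ennreal ((\<psi> (x, \<tau>))\<^sup>2) * indicator \<Omega> x) \<in> borel_measurable lborel"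
      by measurable
  qed
  also have "\<dots> \<le> (\<integral>\<^sup>+x. ennreal (exp T) * ((\<integral>\<^sup>+\<sigma>. h1 (x, \<sigma>) \<partial>lborel) + ennreal T * (\<integral>\<^sup>+\<sigma>. h2 (x, \<sigma>) \<partial>lborel)) \<partial>lborel)"
    by (intro nn_integral_mono avg)
  also have "\<dots> = ennreal (exp T) * ((\<integral>\<^sup>+x. \<integral>\<^sup>+\<sigma>. h1 (x, \<sigma>) \<partial>lborel \<partial>lborel) + ennreal T * (\<integral>\<^sup>+x. \<integral>\<^sup>+\<sigma>. h2 (x, \<sigma>) \<partial>lborel \<partial>lborel))"
    using fiber_int[OF h1_meas] fiber_int[OF h2_meas] by (simp add: nn_integral_cmult nn_integral_add)
  also have "(\<integral>\<^sup>+x. \<integral>\<^sup>+\<sigma>. h1 (x, \<sigma>) \<partial>lborel \<partial>lborel) = (\<integral>\<^sup>+p. ennreal ((\<psi> p)\<^sup>2) \<partial>lebesgue_on ?Q)"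
    unfolding nn_integral_lebesgue_on[OF Q] h1_def[symmetric]
    using lborel.nn_integral_fst[OF h1_meas] by (simp add: lborel_prod)
  also have "(\<integral>\<^sup>+x. \<integral>\<^sup>+\<sigma>. h2 (x, \<sigma>) \<partial>lborel \<partial>lborel) = (\<integral>\<^sup>+p. ennreal ((norm (grad \<psi> p))\<^sup>2) \<partial>lebesgue_on ?Q)"
    unfolding nn_integral_lebesgue_on[OF Q] h2_def[symmetric]
    using lborel.nn_integral_fst[OF h2_meas] by (simp add: lborel_prod)
  finally have main: "ennreal T * (\<integral>\<^sup>+x. ennreal ((\<psi> (x, \<tau>))\<^sup>2) * indicator \<Omega> x \<partial>lborel)
    \<le> ennreal (exp T) * ((\<integral>\<^sup>+p. ennreal ((\<psi> p)\<^sup>2) \<partial>lebesgue_on ?Q) + ennreal T * (\<integral>\<^sup>+p. ennreal ((norm (grad \<psi> p))\<^sup>2) \<partial>lebesgue_on ?Q))"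
    (is "ennreal T * ?I \<le> ennreal (exp T) * (?A + ennreal T * ?B)") .
  have "?I = ennreal (1 / T) * (ennreal T * ?I)"
    using \<open>0 < T\<close> by (simp add: mult.assoc[symmetric] ennreal_mult[symmetric])
  also have "\<dots> \<le> ennreal (1 / T) * (ennreal (exp T) * (?A + ennreal T * ?B))"
    by (intro mult_left_mono main) simp
  also have "\<dots> = ennreal (exp T / T) * ?A + ennreal (exp T) * ?B"
    using \<open>0 < T\<close> by (simp add: distrib_left mult.assoc[symmetric] ennreal_mult[symmetric])
  also have "\<dots> \<le> ennreal (exp T * (1 + 1 / T)) * ?A + ennreal (exp T * (1 + 1 / T)) * ?B"
    using \<open>0 < T\<close> by (intro add_mono mult_right_mono ennreal_leI) (auto simp: field_simps)
  finally have "?I \<le> ennreal (exp T * (1 + 1 / T)) * (?A + ?B)" by (simp add: distrib_left)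
  moreover have "(\<integral>\<^sup>+x. ennreal ((\<psi> (x, \<tau>))\<^sup>2) \<partial>lebesgue_on \<Omega>) = ?I"
    by (rule nn_integral_lebesgue_on[OF \<Omega>_borel])
  ultimately show ?thesis by simp
qed

subsection \<open>Traces\<close>

lemma Ck_diff:
  fixes f g :: "'a::euclidean_space \<Rightarrow> real"
  assumes "Ck k f" "Ck k g"
  shows "Ck k (\<lambda>x. f x - g x)"
  using assms
proof (induction k arbitrary: f g)
  case 0
  then show ?case by (auto intro: continuous_intros)
next
  case (Suc k)
  then have d: "f differentiable (at x)" "g differentiable (at x)" for x by auto
  have "frechet_derivative (\<lambda>x. f x - g x) (at x)
      = (\<lambda>v. frechet_derivative f (at x) v - frechet_derivative g (at x) v)" for x
    using has_derivative_diff[OF d[of x, unfolded frechet_derivative_works]]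
    by (rule frechet_derivative_at[symmetric])
  then show ?case using Suc by (auto intro: differentiable_diff)
qed

lemma smooth_diff: "smooth f \<Longrightarrow> smooth g \<Longrightarrow> smooth (\<lambda>x. f x - g x)"
  by (simp add: smooth_def Ck_diff)

lemma grad_diff:
  assumes "smooth f" "smooth g"
  shows "grad (\<lambda>x. f x - g x) x = grad f x - grad g x"
proof -
  have "frechet_derivative (\<lambda>x. f x - g x) (at x)
      = (\<lambda>v. frechet_derivative f (at x) v - frechet_derivative g (at x) v)"
    using has_derivative_diff[OF smooth_differentiable[OF assms(1), unfolded frechet_derivative_works]
        smooth_differentiable[OF assms(2), unfolded frechet_derivative_works]]
    by (rule frechet_derivative_at[symmetric])
  then show ?thesis by (simp add: grad_def scaleR_diff_left sum_subtractf)
qed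

section \<open>Convergence in the square mean\<close>

lemma norm_diff_square_le:
  fixes a b :: "'a::real_inner"
  shows "(norm (a - b))\<^sup>2 \<le> 2 * (norm a)\<^sup>2 + 2 * (norm b)\<^sup>2"
proof -
  have "0 \<le> (norm (a + b))\<^sup>2" by simp
  moreover have "(norm (a + b))\<^sup>2 + (norm (a - b))\<^sup>2 = 2 * (norm a)\<^sup>2 + 2 * (norm b)\<^sup>2"
    unfolding power2_norm_eq_inner by (simp add: inner_add_left inner_add_right inner_diff_left inner_diff_right)
  ultimately show ?thesis by linarith
qed

lemma nn_integral_square_triangle:
  fixes f g h :: "'a \<Rightarrow> 'b::euclidean_space"
  assumes "f \<in> borel_measurable M" "g \<in> borel_measurable M" "h \<in> borel_measurable M"
  shows "(\<integral>\<^sup>+x. ennreal ((norm (f x - h x))\<^sup>2) \<partial>M)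
    \<le> 2 * (\<integral>\<^sup>+x. ennreal ((norm (f x - g x))\<^sup>2) \<partial>M) + 2 * (\<integral>\<^sup>+x. ennreal ((norm (h x - g x))\<^sup>2) \<partial>M)"
proof -
  have "(\<integral>\<^sup>+x. ennreal ((norm (f x - h x))\<^sup>2) \<partial>M)
      \<le> (\<integral>\<^sup>+x. 2 * ennreal ((norm (f x - g x))\<^sup>2) + 2 * ennreal ((norm (h x - g x))\<^sup>2) \<partial>M)"
  proof (rule nn_integral_mono)
    fix x
    have "ennreal ((norm (f x - h x))\<^sup>2) \<le> ennreal (2 * (norm (f x - g x))\<^sup>2 + 2 * (norm (h x - g x))\<^sup>2)"
      using norm_diff_square_le[of "f x - g x" "h x - g x"] by (intro ennreal_leI) simp
    then show "ennreal ((norm (f x - h x))\<^sup>2) \<le> 2 * ennreal ((norm (f x - g x))\<^sup>2) + 2 * ennreal ((norm (h x - g x))\<^sup>2)"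
      by (simp add: ennreal_mult')
  qed
  also have "\<dots> = 2 * (\<integral>\<^sup>+x. ennreal ((norm (f x - g x))\<^sup>2) \<partial>M) + 2 * (\<integral>\<^sup>+x. ennreal ((norm (h x - g x))\<^sup>2) \<partial>M)"
    using assms by (simp add: nn_integral_add nn_integral_cmult)
  finally show ?thesis .
qed

lemma square_integrable_bounded:
  fixes f :: "'a \<Rightarrow> 'b::euclidean_space"
  assumes "finite_measure M" "f \<in> borel_measurable M" "\<And>x. x \<in> space M \<Longrightarrow> norm (f x) \<le> B"
  shows "square_integrable M f"
proof -
  interpret finite_measure M by fact
  have "integrable M (\<lambda>x. (norm (f x))\<^sup>2)"
  proof (rule integrable_const_bound[where B="B\<^sup>2"])
    show "AE x in M. norm ((norm (f x))\<^sup>2) \<le> B\<^sup>2"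
      using assms(3) by (intro AE_I2) (simp add: power_mono)
  qed (use assms(2) in measurable)
  then show ?thesis using assms(2) by (simp add: square_integrable_def)
qed

lemma square_integrable_diff:
  fixes f g :: "'a \<Rightarrow> 'b::euclidean_space"
  assumes "square_integrable M f" "square_integrable M g"
  shows "integrable M (\<lambda>x. (norm (f x - g x))\<^sup>2)"
proof (rule Bochner_Integration.integrable_bound)
  show "integrable M (\<lambda>x. 2 * (norm (f x))\<^sup>2 + 2 * (norm (g x))\<^sup>2)"
    using assms by (auto simp: square_integrable_def)
  show "(\<lambda>x. (norm (f x - g x))\<^sup>2) \<in> borel_measurable M"
  proof -
    have [measurable]: "f \<in> borel_measurable M" "g \<in> borel_measurable M"
      using assms by (auto simp: square_integrable_def)
    show ?thesis by measurable
  qed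
  show "AE x in M. norm ((norm (f x - g x))\<^sup>2) \<le> norm (2 * (norm (f x))\<^sup>2 + 2 * (norm (g x))\<^sup>2)"
    using norm_diff_square_le by (intro AE_I2) auto
qed

text \<open>A Bochner integral is 0 for a non-integrable function, so its convergence to 0 is
  informative only together with integrability; the nonnegative integral used from here on has no
  such default.\<close>

lemma square_integral_tendsto_0:
  fixes g :: "'a \<Rightarrow> 'b::euclidean_space"
  assumes "\<And>n. square_integrable M (f n)" "square_integrable M g"
    and "(\<lambda>n. LINT x|M. (norm (f n x - g x))\<^sup>2) \<longlonglongrightarrow> 0"
  shows "(\<lambda>n. \<integral>\<^sup>+x. ennreal ((norm (f n x - g x))\<^sup>2) \<partial>M) \<longlonglongrightarrow> 0"
proof -
  have "(\<lambda>n. \<integral>\<^sup>+x. ennreal ((norm (f n x - g x))\<^sup>2) \<partial>M) = (\<lambda>n. ennreal (LINT x|M. (norm (f n x - g x))\<^sup>2))"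
    using square_integrable_diff[OF assms(1,2)] by (intro ext nn_integral_eq_integral) auto
  then show ?thesis using tendsto_ennrealI[OF assms(3)] by simp
qed

lemma H1_weak_gradient: "u \<in> H1 S \<Longrightarrow> has_weak_gradient S u (weak_grad S u)"
  unfolding H1_def weak_grad_def using someI_ex[of "has_weak_gradient S u"] by auto

lemma borel_measurable_lebesgue_on:
  "f \<in> borel_measurable borel \<Longrightarrow> f \<in> borel_measurable (lebesgue_on S)"
  by (intro measurable_restrict_space1 measurable_completion) simp

lemma continuous_square_integrable:
  fixes f :: "'a::euclidean_space \<Rightarrow> 'b::euclidean_space"
  assumes "continuous_on UNIV f" "bounded S" "S \<in> sets borel"
  shows "square_integrable (lebesgue_on S) f"
proof -
  have "compact (f ` closure S)"
    using assms(2) by (intro compact_continuous_image continuous_on_subset[OF assms(1)]) auto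
  then have "bounded (f ` closure S)" by (rule compact_imp_bounded)
  then obtain B where B: "\<And>x. x \<in> closure S \<Longrightarrow> norm (f x) \<le> B"
    unfolding bounded_iff by (metis imageI)
  have "finite_measure (lebesgue_on S)"
    using assms(2,3) by (intro finite_measure_lebesgue_on bounded_set_imp_lmeasurable) auto
  then show ?thesis
    using B closure_subset assms(1)
    by (intro square_integrable_bounded[where B=B] borel_measurable_lebesgue_on borel_measurable_continuous_onI)
      (auto simp: space_restrict_space)
qed

lemma H1_approx_tendsto:
  fixes S :: "'a::euclidean_space set"
  assumes "H1_approx S u \<phi>" "u \<in> H1 S" "bounded S" "S \<in> sets borel"
  shows "(\<lambda>n. \<integral>\<^sup>+x. ennreal ((norm (\<phi> n x - u x))\<^sup>2) \<partial>lebesgue_on S) \<longlonglongrightarrow> 0"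
    and "(\<lambda>n. \<integral>\<^sup>+x. ennreal ((norm (grad (\<phi> n) x - weak_grad S u x))\<^sup>2) \<partial>lebesgue_on S) \<longlonglongrightarrow> 0"
proof -
  have sm: "smooth (\<phi> n)" for n using assms(1) by (simp add: H1_approx_def)
  show "(\<lambda>n. \<integral>\<^sup>+x. ennreal ((norm (\<phi> n x - u x))\<^sup>2) \<partial>lebesgue_on S) \<longlonglongrightarrow> 0"
  proof (rule square_integral_tendsto_0)
    show "square_integrable (lebesgue_on S) (\<phi> n)" for n
      by (intro continuous_square_integrable smooth_continuous sm assms(3,4))
    show "square_integrable (lebesgue_on S) u" using assms(2) by (simp add: H1_def)
  qed (use assms(1) in \<open>simp add: H1_approx_def\<close>)
  show "(\<lambda>n. \<integral>\<^sup>+x. ennreal ((norm (grad (\<phi> n) x - weak_grad S u x))\<^sup>2) \<partial>lebesgue_on S) \<longlonglongrightarrow> 0"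
  proof (rule square_integral_tendsto_0)
    show "square_integrable (lebesgue_on S) (grad (\<phi> n))" for n
      by (intro continuous_square_integrable continuous_on_grad sm assms(3,4))
    show "square_integrable (lebesgue_on S) (weak_grad S u)"
      using H1_weak_gradient[OF assms(2)] by (simp add: has_weak_gradient_def)
  qed (use assms(1) in \<open>simp add: H1_approx_def\<close>)
qed

lemma ennreal_tendsto_0_cmult:
  "(f \<longlongrightarrow> (0::ennreal)) F \<Longrightarrow> c < top \<Longrightarrow> ((\<lambda>x. c * f x) \<longlongrightarrow> 0) F"
  using ennreal_tendsto_cmult[of c f 0 F] by simp

lemma ennreal_tendsto_0_add:
  "(f \<longlongrightarrow> (0::ennreal)) F \<Longrightarrow> (g \<longlongrightarrow> 0) F \<Longrightarrow> ((\<lambda>x. f x + g x) \<longlongrightarrow> 0) F"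
  using tendsto_add[of f 0 F g 0] by simp

lemma ennreal_tendsto_0_le:
  fixes f g :: "nat \<Rightarrow> ennreal"
  assumes "g \<longlonglongrightarrow> 0" "\<And>n. f n \<le> g n"
  shows "f \<longlonglongrightarrow> 0"
  using assms by (intro tendsto_sandwich[OF _ _ tendsto_const assms(1)]) auto

lemma ennreal_le_limit:
  fixes a :: "nat \<Rightarrow> ennreal"
  assumes "a \<longlonglongrightarrow> 0" "\<And>n. c \<le> a n + b"
  shows "c \<le> b"
  using tendsto_add[OF assms(1) tendsto_const[of b]] assms(2)
  by (intro LIMSEQ_le_const[of "\<lambda>n. a n + b" b c]) auto

text \<open>The definition of a trace provides some approximating sequence; the claim holds for
  every one. Two sequences approximating \<open>u\<close> have a difference tending to 0 in H1, so
  by the slice estimate their slices approach each other.\<close>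

lemma time_trace_tendsto:
  fixes \<Omega> :: "'a::euclidean_space set"
  assumes "open \<Omega>" "bounded \<Omega>" "0 < T" "\<tau> \<in> {0..T}" and u: "u \<in> H1 (cylinder \<Omega> T)"
    and \<phi>: "H1_approx (cylinder \<Omega> T) u \<phi>" and h: "time_trace \<Omega> T u \<tau> h"
  shows "(\<lambda>n. \<integral>\<^sup>+x. ennreal ((norm (\<phi> n (x, \<tau>) - h x))\<^sup>2) \<partial>lebesgue_on \<Omega>) \<longlonglongrightarrow> 0"
proof -
  let ?Q = "cylinder \<Omega> T" and ?c = "ennreal (exp T * (1 + 1 / T))"
  have Q: "?Q \<in> sets borel" "bounded ?Q"
    using cylinder_borel[OF assms(1)] assms(2) by (auto simp: cylinder_def bounded_Times)
  have \<Omega>_borel: "\<Omega> \<in> sets borel" using assms(1) by simp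
  obtain \<psi> where \<psi>: "H1_approx ?Q u \<psi>" and lim: "(\<lambda>n. LINT x|lebesgue_on \<Omega>. (\<psi> n (x, \<tau>) - h x)\<^sup>2) \<longlonglongrightarrow> 0"
    and h2: "square_integrable (lebesgue_on \<Omega>) h"
    using h unfolding time_trace_def by blast
  have sm: "smooth (\<phi> n)" "smooth (\<psi> n)" for n using \<phi> \<psi> by (auto simp: H1_approx_def)
  note L\<phi> = H1_approx_tendsto[OF \<phi> u Q(2,1)] and L\<psi> = H1_approx_tendsto[OF \<psi> u Q(2,1)]
  have u_meas: "u \<in> borel_measurable (lebesgue_on ?Q)" using u by (simp add: H1_def square_integrable_def)
  have g_meas: "weak_grad ?Q u \<in> borel_measurable (lebesgue_on ?Q)"
    using H1_weak_gradient[OF u] by (simp add: has_weak_gradient_def square_integrable_def)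
  have slice_meas: "(\<lambda>x. f (x, \<tau>)) \<in> borel_measurable (lebesgue_on \<Omega>)" if "smooth f" for f :: "'a \<times> real \<Rightarrow> real"
    by (intro borel_measurable_lebesgue_on smooth_slice_measurable that)
  have slice_int: "square_integrable (lebesgue_on \<Omega>) (\<lambda>x. f (x, \<tau>))" if "smooth f" for f :: "'a \<times> real \<Rightarrow> real"
    by (intro continuous_square_integrable[OF continuous_on_compose2[OF smooth_continuous[OF that, of UNIV]]]
        continuous_intros assms(2) \<Omega>_borel) auto
  define a where "a n = (\<integral>\<^sup>+p. ennreal ((norm (\<phi> n p - \<psi> n p))\<^sup>2) \<partial>lebesgue_on ?Q)
      + (\<integral>\<^sup>+p. ennreal ((norm (grad (\<phi> n) p - grad (\<psi> n) p))\<^sup>2) \<partial>lebesgue_on ?Q)" for n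
  have "a \<longlonglongrightarrow> 0"
  proof (rule ennreal_tendsto_0_le)
    fix n
    show "a n \<le> (2 * (\<integral>\<^sup>+p. ennreal ((norm (\<phi> n p - u p))\<^sup>2) \<partial>lebesgue_on ?Q)
          + 2 * (\<integral>\<^sup>+p. ennreal ((norm (\<psi> n p - u p))\<^sup>2) \<partial>lebesgue_on ?Q))
        + (2 * (\<integral>\<^sup>+p. ennreal ((norm (grad (\<phi> n) p - weak_grad ?Q u p))\<^sup>2) \<partial>lebesgue_on ?Q)
          + 2 * (\<integral>\<^sup>+p. ennreal ((norm (grad (\<psi> n) p - weak_grad ?Q u p))\<^sup>2) \<partial>lebesgue_on ?Q))"
      unfolding a_def
      by (intro add_mono nn_integral_square_triangle u_meas g_meas borel_measurable_lebesgue_on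
          smooth_measurable sm borel_measurable_continuous_onI continuous_on_grad)
  qed (intro ennreal_tendsto_0_add ennreal_tendsto_0_cmult L\<phi> L\<psi>; simp)
  have bound: "(\<integral>\<^sup>+x. ennreal ((norm (\<phi> n (x, \<tau>) - \<psi> n (x, \<tau>)))\<^sup>2) \<partial>lebesgue_on \<Omega>) \<le> ?c * a n" for n
    using time_slice_estimate[OF assms(1,3) smooth_diff[OF sm(1)[of n] sm(2)[of n]] assms(4)]
    by (simp add: a_def grad_diff sm)
  have lim': "(\<lambda>n. \<integral>\<^sup>+x. ennreal ((norm (\<psi> n (x, \<tau>) - h x))\<^sup>2) \<partial>lebesgue_on \<Omega>) \<longlonglongrightarrow> 0"
    using square_integral_tendsto_0[OF slice_int[OF sm(2)] h2] lim by simp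
  show ?thesis
  proof (rule ennreal_tendsto_0_le)
    fix n
    have "(\<integral>\<^sup>+x. ennreal ((norm (\<phi> n (x, \<tau>) - h x))\<^sup>2) \<partial>lebesgue_on \<Omega>)
        \<le> 2 * (\<integral>\<^sup>+x. ennreal ((norm (\<phi> n (x, \<tau>) - \<psi> n (x, \<tau>)))\<^sup>2) \<partial>lebesgue_on \<Omega>)
          + 2 * (\<integral>\<^sup>+x. ennreal ((norm (h x - \<psi> n (x, \<tau>)))\<^sup>2) \<partial>lebesgue_on \<Omega>)"
      using h2 by (intro nn_integral_square_triangle slice_meas sm) (simp add: square_integrable_def)
    also have "\<dots> \<le> 2 * (?c * a n) + 2 * (\<integral>\<^sup>+x. ennreal ((norm (\<psi> n (x, \<tau>) - h x))\<^sup>2) \<partial>lebesgue_on \<Omega>)"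
      by (intro add_mono mult_left_mono bound) (auto simp: power2_commute)
    finally show "(\<integral>\<^sup>+x. ennreal ((norm (\<phi> n (x, \<tau>) - h x))\<^sup>2) \<partial>lebesgue_on \<Omega>)
      \<le> 2 * (?c * a n) + 2 * (\<integral>\<^sup>+x. ennreal ((norm (\<psi> n (x, \<tau>) - h x))\<^sup>2) \<partial>lebesgue_on \<Omega>)" .
  qed (intro ennreal_tendsto_0_add ennreal_tendsto_0_cmult lim' \<open>a \<longlonglongrightarrow> 0\<close>; simp)
qed

section \<open>From smooth functions to solutions and their traces\<close>

lemma finite_measure_lateral_measure:
  fixes \<Omega> :: "'a::euclidean_space set"
  assumes "open \<Omega>" "bounded \<Omega>" "smooth_boundary \<Omega>"
  shows "finite_measure (lateral_measure \<Omega> T)"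
proof
  interpret finite_measure "lateral_product \<Omega> T" by (rule finite_measure_lateral_product[OF assms])
  show "emeasure (lateral_measure \<Omega> T) (space (lateral_measure \<Omega> T)) \<noteq> \<infinity>"
    by (simp add: lateral_measure_def emeasure_completion)
qed

lemma smooth_square_integrable_lateral:
  fixes \<Omega> :: "'a::euclidean_space set"
  assumes "open \<Omega>" "bounded \<Omega>" "smooth_boundary \<Omega>" and \<phi>: "smooth \<phi>"
  shows "square_integrable (lateral_measure \<Omega> T) \<phi>"
proof -
  have "compact (frontier \<Omega> \<times> {0..T})"
    using assms(2) by (intro compact_Times compact_frontier_bounded compact_Icc)
  then have "bounded (\<phi> ` (frontier \<Omega> \<times> {0..T}))"
    by (intro compact_imp_bounded compact_continuous_image smooth_continuous[OF \<phi>])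
  then obtain B where B: "\<And>p. p \<in> frontier \<Omega> \<times> {0..T} \<Longrightarrow> norm (\<phi> p) \<le> B"
    unfolding bounded_iff by (metis imageI)
  show ?thesis
  proof (rule square_integrable_bounded[OF finite_measure_lateral_measure[OF assms(1-3)]])
    show "\<phi> \<in> borel_measurable (lateral_measure \<Omega> T)"
      unfolding lateral_measure_def
      by (intro measurable_completion measurable_lateral_product_borel smooth_measurable \<phi>)
    show "norm (\<phi> p) \<le> B" if "p \<in> space (lateral_measure \<Omega> T)" for p
      using that B unfolding lateral_measure_def space_completion space_lateral_product by auto
  qed
qed

lemma nn_integral_cylinder:
  fixes \<Omega> :: "'a::euclidean_space set"
  assumes "open \<Omega>" "f \<in> borel_measurable borel"
  shows "(\<integral>\<^sup>+p. f p \<partial>lebesgue_on (cylinder \<Omega> T))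
    = (\<integral>\<^sup>+\<tau>. (\<integral>\<^sup>+x. f (x, \<tau>) \<partial>lebesgue_on \<Omega>) * indicator {0<..<T} \<tau> \<partial>lborel)"
proof -
  let ?Q = "cylinder \<Omega> T"
  note [measurable] = assms(2) cylinder_borel[OF assms(1), of T]
  have meas: "(\<lambda>p. f p * indicator ?Q p) \<in> borel_measurable (lborel \<Otimes>\<^sub>M lborel)"
    unfolding lborel_prod by measurable
  have "(\<integral>\<^sup>+p. f p \<partial>lebesgue_on ?Q) = (\<integral>\<^sup>+p. f p * indicator ?Q p \<partial>(lborel \<Otimes>\<^sub>M lborel))"
    using nn_integral_lebesgue_on[OF cylinder_borel[OF assms(1)]] by (simp add: lborel_prod)
  also have "\<dots> = (\<integral>\<^sup>+\<tau>. \<integral>\<^sup>+x. f (x, \<tau>) * indicator ?Q (x, \<tau>) \<partial>lborel \<partial>lborel)"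
    by (rule lborel_pair.nn_integral_snd[OF meas, symmetric])
  also have "\<dots> = (\<integral>\<^sup>+\<tau>. (\<integral>\<^sup>+x. f (x, \<tau>) \<partial>lebesgue_on \<Omega>) * indicator {0<..<T} \<tau> \<partial>lborel)"
  proof (rule nn_integral_cong)
    fix \<tau> :: real
    have "\<Omega> \<in> sets borel" using assms(1) by simp
    then show "(\<integral>\<^sup>+x. f (x, \<tau>) * indicator ?Q (x, \<tau>) \<partial>lborel)
        = (\<integral>\<^sup>+x. f (x, \<tau>) \<partial>lebesgue_on \<Omega>) * indicator {0<..<T} \<tau>"
      by (subst nn_integral_lebesgue_on) (auto simp: cylinder_def indicator_times indicator_def intro!: nn_integral_cong)
  qed
  finally show ?thesis .
qed

text \<open>Since \<open>P u\<close> vanishes at the point, \<open>P \<phi>\<close> there equals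
  \<open>P\<close> applied to the gradient error, which Cauchy-Schwarz bounds.\<close>

lemma transport_of_diff_le:
  assumes "transport \<Omega> T H u (x, \<tau>) = 0" "norm (H \<tau>) \<le> L"
  shows "(transport_of H \<phi> (x, \<tau>))\<^sup>2
    \<le> (1 + L)\<^sup>2 * (norm (grad \<phi> (x, \<tau>) - weak_grad (cylinder \<Omega> T) u (x, \<tau>)))\<^sup>2"
proof -
  define d where "d = grad \<phi> (x, \<tau>) - weak_grad (cylinder \<Omega> T) u (x, \<tau>)"
  have "transport_of H \<phi> (x, \<tau>) = snd d + H \<tau> \<bullet> fst d"
    using assms(1) by (simp add: transport_of_def transport_def d_def inner_diff_right)
  also have "\<bar>\<dots>\<bar> \<le> \<bar>snd d\<bar> + norm (H \<tau>) * norm (fst d)"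
    using Cauchy_Schwarz_ineq2[of "H \<tau>" "fst d"] by linarith
  also have "\<dots> \<le> norm d + L * norm d"
  proof (intro add_mono mult_mono)
    show "\<bar>snd d\<bar> \<le> norm d" using norm_snd_le[of "snd d" "fst d"] by simp
    show "norm (fst d) \<le> norm d" using norm_fst_le[of "fst d" "snd d"] by simp
    show "0 \<le> L" using assms(2) norm_ge_zero order_trans by blast
  qed (use assms(2) in auto)
  also have "\<dots> = (1 + L) * norm d" by (simp add: algebra_simps)
  finally have "\<bar>transport_of H \<phi> (x, \<tau>)\<bar>\<^sup>2 \<le> ((1 + L) * norm d)\<^sup>2"
    by (intro power_mono) auto
  then show ?thesis by (simp add: power_mult_distrib d_def)
qed

text \<open>The smooth estimate is applied to one approximating sequence, whose \<open>P\<close>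
  tends to 0 because \<open>P u = 0\<close>. The bound for \<open>u\<close> itself follows by
  integrating the slice bounds over time.\<close>

lemma energy_estimate_traces:
  fixes \<Omega> :: "'a::euclidean_space set" and H :: "real \<Rightarrow> 'a"
  assumes \<Omega>: "open \<Omega>" "bounded \<Omega>" "smooth_boundary \<Omega>" and "0 < T" and H: "continuous_on {0..T} H"
  obtains K where "0 < K"
    "\<And>u g hT \<tau> h. \<lbrakk>u \<in> H1 (cylinder \<Omega> T); AE p in lebesgue_on (cylinder \<Omega> T). transport \<Omega> T H u p = 0;
        lateral_trace \<Omega> T u g; time_trace \<Omega> T u T hT; \<tau> \<in> {0..T}; time_trace \<Omega> T u \<tau> h\<rbrakk> \<Longrightarrow>
      (\<integral>\<^sup>+x. ennreal ((h x)\<^sup>2) \<partial>lebesgue_on \<Omega>) \<le> ennreal K *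
        ((\<integral>\<^sup>+p. ennreal ((g p)\<^sup>2) * indicator (outflow_boundary \<Omega> T H) p \<partial>lateral_measure \<Omega> T)
          + (\<integral>\<^sup>+x. ennreal ((hT x)\<^sup>2) \<partial>lebesgue_on \<Omega>))"
    "\<And>u g hT. \<lbrakk>u \<in> H1 (cylinder \<Omega> T); AE p in lebesgue_on (cylinder \<Omega> T). transport \<Omega> T H u p = 0;
        lateral_trace \<Omega> T u g; time_trace \<Omega> T u T hT\<rbrakk> \<Longrightarrow>
      (\<integral>\<^sup>+p. ennreal ((u p)\<^sup>2) \<partial>lebesgue_on (cylinder \<Omega> T)) \<le> ennreal K *
        ((\<integral>\<^sup>+p. ennreal ((g p)\<^sup>2) * indicator (outflow_boundary \<Omega> T H) p \<partial>lateral_measure \<Omega> T)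
          + (\<integral>\<^sup>+x. ennreal ((hT x)\<^sup>2) \<partial>lebesgue_on \<Omega>))"
proof -
  let ?Q = "cylinder \<Omega> T" and ?\<Sigma> = "outflow_boundary \<Omega> T H" and ?lat = "lateral_measure \<Omega> T"
  have Q: "?Q \<in> sets borel" "bounded ?Q"
    using cylinder_borel[OF \<Omega>(1)] \<Omega>(2) by (auto simp: cylinder_def bounded_Times)
  have \<Omega>_borel: "\<Omega> \<in> sets borel" using \<Omega>(1) by simp
  obtain K where K: "0 < K" "\<And>\<phi> \<tau>. \<lbrakk>smooth \<phi>; \<tau> \<in> {0..T}\<rbrakk> \<Longrightarrow>
    (\<integral>\<^sup>+x. ennreal ((\<phi> (x, \<tau>))\<^sup>2) \<partial>lebesgue_on \<Omega>) \<le> ennreal K *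
      ((\<integral>\<^sup>+p. ennreal ((transport_of H \<phi> p)\<^sup>2) \<partial>lebesgue_on ?Q)
        + (\<integral>\<^sup>+x. ennreal ((\<phi> (x, T))\<^sup>2) \<partial>lebesgue_on \<Omega>)
        + (\<integral>\<^sup>+p. ennreal ((\<phi> p)\<^sup>2) * indicator ?\<Sigma> p \<partial>?lat))"
    using energy_estimate_smooth[OF \<Omega> \<open>0 < T\<close> H] by blast
  have "bounded (H ` {0..T})" by (intro compact_imp_bounded compact_continuous_image H compact_Icc)
  then obtain L where L: "\<And>\<tau>. \<tau> \<in> {0..T} \<Longrightarrow> norm (H \<tau>) \<le> L"
    unfolding bounded_iff by (metis imageI)
  have \<Sigma>_sets: "?\<Sigma> \<in> sets ?lat"
    unfolding lateral_measure_def
    by (intro sets_completionI_sets sets_lateral_product outflow_boundary_borel \<Omega> H)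
      (auto simp: outflow_boundary_def)
  \<comment> \<open>The sequence is the one behind the lateral trace, and its slices at time
    \<open>T\<close> follow by \<open>time_trace_tendsto\<close>. The error \<open>a n\<close> does
    not depend on \<open>\<tau>\<close>, which permits integrating over \<open>\<tau>\<close>
    later.\<close>
  have key: "\<exists>\<phi> a. H1_approx ?Q u \<phi> \<and> a \<longlonglongrightarrow> 0 \<and> (\<forall>n. \<forall>\<tau>\<in>{0..T}.
      (\<integral>\<^sup>+x. ennreal ((\<phi> n (x, \<tau>))\<^sup>2) \<partial>lebesgue_on \<Omega>) \<le> a n + ennreal (2 * K) *
        ((\<integral>\<^sup>+p. ennreal ((g p)\<^sup>2) * indicator ?\<Sigma> p \<partial>?lat) + (\<integral>\<^sup>+x. ennreal ((hT x)\<^sup>2) \<partial>lebesgue_on \<Omega>)))"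
    if u: "u \<in> H1 ?Q" and Pu: "AE p in lebesgue_on ?Q. transport \<Omega> T H u p = 0"
      and g: "lateral_trace \<Omega> T u g" and hT: "time_trace \<Omega> T u T hT" for u g hT
  proof -
    obtain \<phi> where \<phi>: "H1_approx ?Q u \<phi>" and lim: "(\<lambda>n. LINT p|?lat. (\<phi> n p - g p)\<^sup>2) \<longlonglongrightarrow> 0"
      and g2: "square_integrable ?lat g"
      using g unfolding lateral_trace_def by blast
    have sm: "smooth (\<phi> n)" for n using \<phi> by (simp add: H1_approx_def)
    have [measurable]: "g \<in> borel_measurable ?lat" using g2 by (simp add: square_integrable_def)
    have [measurable]: "hT \<in> borel_measurable (lebesgue_on \<Omega>)"
      using hT by (simp add: time_trace_def square_integrable_def)
    have [measurable]: "weak_grad ?Q u \<in> borel_measurable (lebesgue_on ?Q)"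
      using H1_weak_gradient[OF u] by (simp add: has_weak_gradient_def square_integrable_def)
    note [measurable] = \<Sigma>_sets
    let ?B1 = "\<integral>\<^sup>+p. ennreal ((g p)\<^sup>2) * indicator ?\<Sigma> p \<partial>?lat" and ?B2 = "\<integral>\<^sup>+x. ennreal ((hT x)\<^sup>2) \<partial>lebesgue_on \<Omega>"
    define eg where "eg n = (\<integral>\<^sup>+p. ennreal ((norm (grad (\<phi> n) p - weak_grad ?Q u p))\<^sup>2) \<partial>lebesgue_on ?Q)" for n
    define et where "et n = (\<integral>\<^sup>+x. ennreal ((norm (\<phi> n (x, T) - hT x))\<^sup>2) \<partial>lebesgue_on \<Omega>)" for n
    define el where "el n = (\<integral>\<^sup>+p. ennreal ((norm (\<phi> n p - g p))\<^sup>2) \<partial>?lat)" for n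
    have "eg \<longlonglongrightarrow> 0" unfolding eg_def by (rule H1_approx_tendsto(2)[OF \<phi> u Q(2,1)])
    moreover have "et \<longlonglongrightarrow> 0"
      unfolding et_def using \<open>0 < T\<close> by (intro time_trace_tendsto[OF \<Omega>(1,2) _ _ u \<phi> hT]) auto
    moreover have "el \<longlonglongrightarrow> 0"
      unfolding el_def using lim
      by (intro square_integral_tendsto_0 smooth_square_integrable_lateral \<Omega> sm g2) simp
    ultimately have lim_a: "(\<lambda>n. ennreal K * (ennreal ((1 + L)\<^sup>2) * eg n + 2 * et n + 2 * el n)) \<longlonglongrightarrow> 0"
      by (intro ennreal_tendsto_0_cmult ennreal_tendsto_0_add) auto
    have "(\<integral>\<^sup>+x. ennreal ((\<phi> n (x, \<tau>))\<^sup>2) \<partial>lebesgue_on \<Omega>)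
        \<le> ennreal K * (ennreal ((1 + L)\<^sup>2) * eg n + 2 * et n + 2 * el n) + ennreal (2 * K) * (?B1 + ?B2)"
      if \<tau>: "\<tau> \<in> {0..T}" for n \<tau>
    proof -
      have [measurable]: "\<phi> n \<in> borel_measurable ?lat"
        unfolding lateral_measure_def by (intro measurable_completion measurable_lateral_product_borel smooth_measurable sm)
      have [measurable]: "(\<lambda>x. \<phi> n (x, T)) \<in> borel_measurable (lebesgue_on \<Omega>)"
        by (intro borel_measurable_lebesgue_on smooth_slice_measurable sm)
      have [measurable]: "grad (\<phi> n) \<in> borel_measurable (lebesgue_on ?Q)"
        by (intro borel_measurable_lebesgue_on borel_measurable_continuous_onI continuous_on_grad sm)
      have 1: "(\<integral>\<^sup>+p. ennreal ((transport_of H (\<phi> n) p)\<^sup>2) \<partial>lebesgue_on ?Q) \<le> ennreal ((1 + L)\<^sup>2) * eg n"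
      proof -
        have "AE p in lebesgue_on ?Q. p \<in> ?Q"
          by (rule AE_I2) (simp add: space_restrict_space)
        with Pu have "AE p in lebesgue_on ?Q. ennreal ((transport_of H (\<phi> n) p)\<^sup>2)
            \<le> ennreal ((1 + L)\<^sup>2) * ennreal ((norm (grad (\<phi> n) p - weak_grad ?Q u p))\<^sup>2)"
        proof eventually_elim
          fix p assume p: "transport \<Omega> T H u p = 0" "p \<in> ?Q"
          obtain x \<sigma> where eq: "p = (x, \<sigma>)" by force
          have "norm (H \<sigma>) \<le> L" using p(2) by (intro L) (simp add: cylinder_def eq)
          with p(1) show "ennreal ((transport_of H (\<phi> n) p)\<^sup>2)
              \<le> ennreal ((1 + L)\<^sup>2) * ennreal ((norm (grad (\<phi> n) p - weak_grad ?Q u p))\<^sup>2)"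
            unfolding eq using ennreal_leI[OF transport_of_diff_le[of \<Omega> T H u x \<sigma> L "\<phi> n"]]
            by (simp add: ennreal_mult)
        qed
        then have "(\<integral>\<^sup>+p. ennreal ((transport_of H (\<phi> n) p)\<^sup>2) \<partial>lebesgue_on ?Q)
            \<le> (\<integral>\<^sup>+p. ennreal ((1 + L)\<^sup>2) * ennreal ((norm (grad (\<phi> n) p - weak_grad ?Q u p))\<^sup>2) \<partial>lebesgue_on ?Q)"
          by (rule nn_integral_mono_AE)
        also have "\<dots> = ennreal ((1 + L)\<^sup>2) * eg n"
          unfolding eg_def by (rule nn_integral_cmult) measurable
        finally show ?thesis .
      qed
      have 2: "(\<integral>\<^sup>+x. ennreal ((\<phi> n (x, T))\<^sup>2) \<partial>lebesgue_on \<Omega>) \<le> 2 * et n + 2 * ?B2"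
        using nn_integral_square_triangle[of "\<lambda>x. \<phi> n (x, T)" "lebesgue_on \<Omega>" hT "\<lambda>_. 0"] by (simp add: et_def)
      have 3: "(\<integral>\<^sup>+p. ennreal ((\<phi> n p)\<^sup>2) * indicator ?\<Sigma> p \<partial>?lat) \<le> 2 * el n + 2 * ?B1"
      proof -
        have "(\<integral>\<^sup>+p. ennreal ((\<phi> n p)\<^sup>2) * indicator ?\<Sigma> p \<partial>?lat)
            \<le> (\<integral>\<^sup>+p. 2 * ennreal ((norm (\<phi> n p - g p))\<^sup>2) + 2 * (ennreal ((g p)\<^sup>2) * indicator ?\<Sigma> p) \<partial>?lat)"
        proof (rule nn_integral_mono)
          fix p
          have "ennreal ((\<phi> n p)\<^sup>2) \<le> ennreal (2 * (norm (\<phi> n p - g p))\<^sup>2 + 2 * (g p)\<^sup>2)"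
            using norm_diff_square_le[of "\<phi> n p - g p" "- g p"] by (intro ennreal_leI) simp
          also have "\<dots> = 2 * ennreal ((norm (\<phi> n p - g p))\<^sup>2) + 2 * ennreal ((g p)\<^sup>2)"
            by (simp add: ennreal_mult')
          finally show "ennreal ((\<phi> n p)\<^sup>2) * indicator ?\<Sigma> p
              \<le> 2 * ennreal ((norm (\<phi> n p - g p))\<^sup>2) + 2 * (ennreal ((g p)\<^sup>2) * indicator ?\<Sigma> p)"
            by (auto simp: indicator_def)
        qed
        also have "\<dots> = 2 * el n + 2 * ?B1"
          unfolding el_def by (subst nn_integral_add) (measurable, simp add: nn_integral_cmult)
        finally show ?thesis .
      qed
      have "(\<integral>\<^sup>+x. ennreal ((\<phi> n (x, \<tau>))\<^sup>2) \<partial>lebesgue_on \<Omega>)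
          \<le> ennreal K * (ennreal ((1 + L)\<^sup>2) * eg n + (2 * et n + 2 * ?B2) + (2 * el n + 2 * ?B1))"
        by (rule order_trans[OF K(2)[OF sm \<tau>]]) (intro mult_left_mono add_mono 1 2 3; simp)
      also have "\<dots> = ennreal K * ((ennreal ((1 + L)\<^sup>2) * eg n + 2 * et n + 2 * el n) + 2 * (?B1 + ?B2))"
        by (simp only: distrib_left ac_simps)
      also have "\<dots> = ennreal K * (ennreal ((1 + L)\<^sup>2) * eg n + 2 * et n + 2 * el n) + ennreal (2 * K) * (?B1 + ?B2)"
        using K(1) by (simp only: distrib_left[of "ennreal K"]) (simp add: ennreal_mult mult_ac)
      finally show ?thesis .
    qed
    then show ?thesis using \<phi> lim_a by blast
  qed
  \<comment> \<open>The 4 comes from bounding a square of a sum by twice the squares, once in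
    \<open>key\<close> and once when passing from the sequence to its limit. The summand
    \<open>T\<close> serves the integration over time.\<close>
  define K' where "K' = 4 * K * (1 + T)"
  have K': "0 < K'" "4 * K \<le> K'" "4 * K * T \<le> K'" using K(1) \<open>0 < T\<close>
    by (simp add: K'_def, simp_all add: K'_def distrib_left)
  have "(\<integral>\<^sup>+x. ennreal ((h x)\<^sup>2) \<partial>lebesgue_on \<Omega>) \<le> ennreal K' *
        ((\<integral>\<^sup>+p. ennreal ((g p)\<^sup>2) * indicator ?\<Sigma> p \<partial>?lat) + (\<integral>\<^sup>+x. ennreal ((hT x)\<^sup>2) \<partial>lebesgue_on \<Omega>))"
    (is "_ \<le> _ * ?B")
    if u: "u \<in> H1 ?Q" and Pu: "AE p in lebesgue_on ?Q. transport \<Omega> T H u p = 0"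
      and g: "lateral_trace \<Omega> T u g" and hT: "time_trace \<Omega> T u T hT"
      and \<tau>: "\<tau> \<in> {0..T}" and h: "time_trace \<Omega> T u \<tau> h" for u g hT \<tau> h
  proof -
    obtain \<phi> a where \<phi>: "H1_approx ?Q u \<phi>" and a: "a \<longlonglongrightarrow> 0"
      and le: "\<And>n \<tau>. \<tau> \<in> {0..T} \<Longrightarrow> (\<integral>\<^sup>+x. ennreal ((\<phi> n (x, \<tau>))\<^sup>2) \<partial>lebesgue_on \<Omega>) \<le> a n + ennreal (2 * K) * ?B"
      using key[OF u Pu g hT] by blast
    have sm: "smooth (\<phi> n)" for n using \<phi> by (simp add: H1_approx_def)
    have [measurable]: "h \<in> borel_measurable (lebesgue_on \<Omega>)"
      using h by (simp add: time_trace_def square_integrable_def)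
    define e where "e n = (\<integral>\<^sup>+x. ennreal ((norm (\<phi> n (x, \<tau>) - h x))\<^sup>2) \<partial>lebesgue_on \<Omega>)" for n
    have e: "e \<longlonglongrightarrow> 0" unfolding e_def by (rule time_trace_tendsto[OF \<Omega>(1,2) \<open>0 < T\<close> \<tau> u \<phi> h])
    have "(\<integral>\<^sup>+x. ennreal ((h x)\<^sup>2) \<partial>lebesgue_on \<Omega>) \<le> ennreal (4 * K) * ?B"
    proof (rule ennreal_le_limit)
      show "(\<lambda>n. 2 * e n + 2 * a n) \<longlonglongrightarrow> 0"
        by (intro ennreal_tendsto_0_add ennreal_tendsto_0_cmult a e) auto
      fix n
      have [measurable]: "(\<lambda>x. \<phi> n (x, \<tau>)) \<in> borel_measurable (lebesgue_on \<Omega>)"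
        by (intro borel_measurable_lebesgue_on smooth_slice_measurable sm)
      have "(\<integral>\<^sup>+x. ennreal ((h x)\<^sup>2) \<partial>lebesgue_on \<Omega>)
          \<le> 2 * e n + 2 * (\<integral>\<^sup>+x. ennreal ((\<phi> n (x, \<tau>))\<^sup>2) \<partial>lebesgue_on \<Omega>)"
        using nn_integral_square_triangle[of h "lebesgue_on \<Omega>" "\<lambda>x. \<phi> n (x, \<tau>)" "\<lambda>_. 0"]
        by (simp add: e_def power2_commute)
      also have "\<dots> \<le> 2 * e n + 2 * (a n + ennreal (2 * K) * ?B)"
        by (intro add_left_mono mult_left_mono le \<tau>) simp
      also have "\<dots> = (2 * e n + 2 * a n) + ennreal (4 * K) * ?B"
      proof -
        have "ennreal (4 * K) = 2 * ennreal (2 * K)" using K(1) by (simp add: ennreal_mult')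
        then show ?thesis by (simp only: distrib_left[of 2] ac_simps)
      qed
      finally show "(\<integral>\<^sup>+x. ennreal ((h x)\<^sup>2) \<partial>lebesgue_on \<Omega>) \<le> (2 * e n + 2 * a n) + ennreal (4 * K) * ?B" .
    qed
    also have "\<dots> \<le> ennreal K' * ?B" using K' by (intro mult_right_mono ennreal_leI) auto
    finally show ?thesis .
  qed
  moreover have "(\<integral>\<^sup>+p. ennreal ((u p)\<^sup>2) \<partial>lebesgue_on ?Q) \<le> ennreal K' *
        ((\<integral>\<^sup>+p. ennreal ((g p)\<^sup>2) * indicator ?\<Sigma> p \<partial>?lat) + (\<integral>\<^sup>+x. ennreal ((hT x)\<^sup>2) \<partial>lebesgue_on \<Omega>))"
    (is "_ \<le> _ * ?B")
    if u: "u \<in> H1 ?Q" and Pu: "AE p in lebesgue_on ?Q. transport \<Omega> T H u p = 0"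
      and g: "lateral_trace \<Omega> T u g" and hT: "time_trace \<Omega> T u T hT" for u g hT
  proof -
    obtain \<phi> a where \<phi>: "H1_approx ?Q u \<phi>" and a: "a \<longlonglongrightarrow> 0"
      and le: "\<And>n \<tau>. \<tau> \<in> {0..T} \<Longrightarrow> (\<integral>\<^sup>+x. ennreal ((\<phi> n (x, \<tau>))\<^sup>2) \<partial>lebesgue_on \<Omega>) \<le> a n + ennreal (2 * K) * ?B"
      using key[OF u Pu g hT] by blast
    have sm: "smooth (\<phi> n)" for n using \<phi> by (simp add: H1_approx_def)
    have [measurable]: "u \<in> borel_measurable (lebesgue_on ?Q)"
      using u by (simp add: H1_def square_integrable_def)
    define e where "e n = (\<integral>\<^sup>+p. ennreal ((norm (\<phi> n p - u p))\<^sup>2) \<partial>lebesgue_on ?Q)" for n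
    have e: "e \<longlonglongrightarrow> 0" unfolding e_def by (rule H1_approx_tendsto(1)[OF \<phi> u Q(2,1)])
    have "(\<integral>\<^sup>+p. ennreal ((u p)\<^sup>2) \<partial>lebesgue_on ?Q) \<le> ennreal (4 * K * T) * ?B"
    proof (rule ennreal_le_limit)
      show "(\<lambda>n. 2 * e n + ennreal (2 * T) * a n) \<longlonglongrightarrow> 0"
        by (intro ennreal_tendsto_0_add ennreal_tendsto_0_cmult a e) auto
      fix n
      have \<phi>_meas: "\<phi> n \<in> borel_measurable borel" by (rule smooth_measurable[OF sm])
      then have square_meas: "(\<lambda>p. ennreal ((\<phi> n p)\<^sup>2)) \<in> borel_measurable borel" by measurable
      have [measurable]: "\<phi> n \<in> borel_measurable (lebesgue_on ?Q)"
        by (rule borel_measurable_lebesgue_on[OF \<phi>_meas])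
      have "(\<integral>\<^sup>+p. ennreal ((\<phi> n p)\<^sup>2) \<partial>lebesgue_on ?Q)
          = (\<integral>\<^sup>+\<tau>. (\<integral>\<^sup>+x. ennreal ((\<phi> n (x, \<tau>))\<^sup>2) \<partial>lebesgue_on \<Omega>) * indicator {0<..<T} \<tau> \<partial>lborel)"
        by (rule nn_integral_cylinder[OF \<Omega>(1) square_meas])
      also have "\<dots> \<le> (\<integral>\<^sup>+\<tau>. (a n + ennreal (2 * K) * ?B) * indicator {0<..<T} \<tau> \<partial>lborel)"
      proof (rule nn_integral_mono)
        fix \<tau>
        show "(\<integral>\<^sup>+x. ennreal ((\<phi> n (x, \<tau>))\<^sup>2) \<partial>lebesgue_on \<Omega>) * indicator {0<..<T} \<tau>
            \<le> (a n + ennreal (2 * K) * ?B) * indicator {0<..<T} \<tau>"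
          using le[of \<tau> n] by (cases "\<tau> \<in> {0<..<T}") auto
      qed
      also have "\<dots> = ennreal T * (a n + ennreal (2 * K) * ?B)"
        using \<open>0 < T\<close> by (subst nn_integral_cmult_indicator) (auto simp: mult.commute)
      finally have slices: "(\<integral>\<^sup>+p. ennreal ((\<phi> n p)\<^sup>2) \<partial>lebesgue_on ?Q) \<le> ennreal T * (a n + ennreal (2 * K) * ?B)" .
      have "(\<integral>\<^sup>+p. ennreal ((u p)\<^sup>2) \<partial>lebesgue_on ?Q)
          \<le> 2 * e n + 2 * (\<integral>\<^sup>+p. ennreal ((\<phi> n p)\<^sup>2) \<partial>lebesgue_on ?Q)"
        using nn_integral_square_triangle[of u "lebesgue_on ?Q" "\<phi> n" "\<lambda>_. 0"]
        by (simp add: e_def power2_commute)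
      also have "\<dots> \<le> 2 * e n + 2 * (ennreal T * (a n + ennreal (2 * K) * ?B))"
        by (intro add_left_mono mult_left_mono slices) simp
      also have "\<dots> = (2 * e n + ennreal (2 * T) * a n) + ennreal (4 * K * T) * ?B"
      proof -
        have "ennreal (2 * T) = 2 * ennreal T" using \<open>0 < T\<close> by (simp add: ennreal_mult')
        moreover have "ennreal (4 * K * T) = 2 * (ennreal T * ennreal (2 * K))"
        proof -
          have "ennreal (4 * K * T) = ennreal (2 * (T * (2 * K)))" by (simp add: mult_ac)
          also have "\<dots> = 2 * (ennreal T * ennreal (2 * K))"
            using K(1) \<open>0 < T\<close> by (subst ennreal_mult, simp, simp, subst ennreal_mult) auto
          finally show ?thesis .
        qed
        ultimately show ?thesis by (simp only: distrib_left mult.assoc ac_simps)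
      qed
      finally show "(\<integral>\<^sup>+p. ennreal ((u p)\<^sup>2) \<partial>lebesgue_on ?Q)
        \<le> (2 * e n + ennreal (2 * T) * a n) + ennreal (4 * K * T) * ?B" .
    qed
    also have "\<dots> \<le> ennreal K' * ?B" using K' by (intro mult_right_mono ennreal_leI) auto
    finally show ?thesis .
  qed
  ultimately show thesis using that[OF K'(1)] by blast
qed

subsection \<open>The Carleman estimate\<close>

text \<open>The weight may jump at the nodes, but it consists of finitely many pieces, each bounded
  on the bounded cylinder; the sum of the nonnegative bounds dominates every one of them.\<close>

lemma weight_bounded_above:
  fixes \<Omega> :: "'a::euclidean_space set"
  assumes "bounded \<Omega>" "is_partition T m t" "0 < T"
  obtains M where "0 \<le> M" "\<And>p. p \<in> cylinder \<Omega> T \<Longrightarrow> weight \<Omega> T H m t S r p \<le> M"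
proof -
  obtain R where R: "\<And>x. x \<in> \<Omega> \<Longrightarrow> norm x \<le> R"
    using assms(1) unfolding bounded_iff by blast
  define \<beta> where "\<beta> = weight_slope \<Omega> T H t S r"
  define c where "c j = center \<Omega> H t S r j" for j
  define b where "b j = \<bar>\<beta>\<bar> * (T + \<bar>t j\<bar>) + (R + norm (c j))\<^sup>2" for j
  have b: "0 \<le> b j" for j using \<open>0 < T\<close> by (simp add: b_def)
  have "t 0 = 0" "t m = T" using assms(2) by (auto simp: is_partition_def)
  then have "0 < m" using \<open>0 < T\<close> by (cases m) auto
  have "weight \<Omega> T H m t S r p \<le> (\<Sum>j<m. b j)" if "p \<in> cylinder \<Omega> T" for p
  proof -
    obtain x \<tau> where p: "p = (x, \<tau>)" "x \<in> \<Omega>" "0 < \<tau>" "\<tau> < T"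
      using \<open>p \<in> cylinder \<Omega> T\<close> by (auto simp: cylinder_def)
    define j where "j = part_index m t \<tau>"
    have "j \<in> {j. j < m \<and> t j \<le> \<tau>}"
      unfolding j_def part_index_def using \<open>0 < m\<close> \<open>t 0 = 0\<close> p(3) by (intro Max_in) auto
    then have "j < m" by simp
    have "\<bar>\<beta> * (\<tau> - t j)\<bar> \<le> \<bar>\<beta>\<bar> * (T + \<bar>t j\<bar>)"
      unfolding abs_mult using p by (intro mult_left_mono) auto
    moreover have "(norm (x - c j))\<^sup>2 \<le> (R + norm (c j))\<^sup>2"
      using R[OF p(2)] norm_triangle_ineq4[of x "c j"] by (intro power_mono) auto
    ultimately have "- \<beta> * (\<tau> - t j) + (norm (x - c j))\<^sup>2 \<le> b j"
      unfolding b_def by linarith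
    also have "\<dots> \<le> (\<Sum>j<m. b j)"
      using \<open>j < m\<close> b by (intro member_le_sum) auto
    finally show ?thesis
      by (simp add: weight_def p(1) j_def[symmetric] \<beta>_def[symmetric] c_def[symmetric] Let_def)
  qed
  then show thesis using that[of "\<Sum>j<m. b j"] b by (simp add: sum_nonneg)
qed

lemma is_partition_range:
  assumes "is_partition T m t" "j \<le> m"
  shows "t j \<in> {0..T}"
proof -
  have mono: "t i \<le> t k" if "i \<le> k" "k \<le> m" for i k
    using that
  proof (induction k rule: dec_induct)
    case (step k)
    then have "t i \<le> t k" "k < m" by auto
    moreover have "t k < t (Suc k)" using assms(1) \<open>k < m\<close> by (simp add: is_partition_def)
    ultimately show ?case by simp
  qed simp
  show ?thesis using mono[of 0 j] mono[of j m] assms by (auto simp: is_partition_def)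
qed

text \<open>The traces \<open>g\<close> and \<open>h j\<close> are universally quantified, so the
  estimate holds for every choice of representatives. The constants are chosen before
  \<open>u\<close>, \<open>g\<close> and \<open>h\<close>, which expresses their independence of the
  solution.\<close>

theorem theorem1p5:
  fixes \<Omega> :: "(real ^ 'n) set" and T S r :: real and H :: "real \<Rightarrow> real ^ 'n"
    and m :: nat and t :: "nat \<Rightarrow> real"
  assumes "0 < T"
    and "open \<Omega>" and "connected \<Omega>" and "bounded \<Omega>" and "smooth_boundary \<Omega>" and "0 \<in> closure \<Omega>"
    and "1 / sqrt 2 < S" and "S < 1" and "0 < r"
    and "C1_on_interval T H" and "0 < min_speed T H"
    and "is_partition T m t"
    and "\<And>j \<tau>. j < m \<Longrightarrow> \<tau> \<in> {t j..t (Suc j)} \<Longrightarrow> direction H \<tau> \<bullet> direction H (t j) \<ge> S"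
  shows "\<exists>s\<^sub>0>0. \<exists>C\<^sub>0>0. \<exists>C>0. \<forall>u \<in> H1 (cylinder \<Omega> T). \<forall>g h.
      (AE p in lebesgue_on (cylinder \<Omega> T). transport \<Omega> T H u p = 0) \<longrightarrow>
      lateral_trace \<Omega> T u g \<longrightarrow> (\<forall>j\<le>m. time_trace \<Omega> T u (t j) (h j)) \<longrightarrow>
      (\<forall>s>s\<^sub>0.
        s\<^sup>2 * (LINT p|lebesgue_on (cylinder \<Omega> T). \<bar>u p\<bar>\<^sup>2 * exp (2 * s * weight \<Omega> T H m t S r p))
          + s * exp (- C\<^sub>0 * s) * (\<Sum>j<m. LINT x|lebesgue_on \<Omega>. \<bar>h j x\<bar>\<^sup>2)
        \<le> C * (LINT p|lebesgue_on (cylinder \<Omega> T).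
                \<bar>transport \<Omega> T H u p\<bar>\<^sup>2 * exp (2 * s * weight \<Omega> T H m t S r p))
          + C * s * exp (C * s) *
              (LINT p:outflow_boundary \<Omega> T H|lateral_measure \<Omega> T. \<bar>g p\<bar>\<^sup>2)
          + C * s * exp (C * s) * (LINT x|lebesgue_on \<Omega>. \<bar>h m x\<bar>\<^sup>2))"
proof -
  let ?Q = "cylinder \<Omega> T" and ?\<Sigma> = "outflow_boundary \<Omega> T H" and ?lat = "lateral_measure \<Omega> T"
  let ?w = "weight \<Omega> T H m t S r"
  have H: "continuous_on {0..T} H"
    using assms(10) unfolding C1_on_interval_def
    by (metis continuous_on_eq_continuous_within has_vector_derivative_continuous)
  have tm: "t m = T" and tj: "\<And>j. j \<le> m \<Longrightarrow> t j \<in> {0..T}"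
    using assms(12) is_partition_range by (auto simp: is_partition_def)
  obtain M where M: "0 \<le> M" "\<And>p. p \<in> ?Q \<Longrightarrow> ?w p \<le> M"
    using weight_bounded_above[OF assms(4,12,1)] by blast
  obtain K where K: "0 < K"
    and K1: "\<And>u g hT \<tau> h. \<lbrakk>u \<in> H1 ?Q; AE p in lebesgue_on ?Q. transport \<Omega> T H u p = 0;
        lateral_trace \<Omega> T u g; time_trace \<Omega> T u T hT; \<tau> \<in> {0..T}; time_trace \<Omega> T u \<tau> h\<rbrakk> \<Longrightarrow>
      (\<integral>\<^sup>+x. ennreal ((h x)\<^sup>2) \<partial>lebesgue_on \<Omega>) \<le> ennreal K *
        ((\<integral>\<^sup>+p. ennreal ((g p)\<^sup>2) * indicator ?\<Sigma> p \<partial>?lat) + (\<integral>\<^sup>+x. ennreal ((hT x)\<^sup>2) \<partial>lebesgue_on \<Omega>))"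
    and K2: "\<And>u g hT. \<lbrakk>u \<in> H1 ?Q; AE p in lebesgue_on ?Q. transport \<Omega> T H u p = 0;
        lateral_trace \<Omega> T u g; time_trace \<Omega> T u T hT\<rbrakk> \<Longrightarrow>
      (\<integral>\<^sup>+p. ennreal ((u p)\<^sup>2) \<partial>lebesgue_on ?Q) \<le> ennreal K *
        ((\<integral>\<^sup>+p. ennreal ((g p)\<^sup>2) * indicator ?\<Sigma> p \<partial>?lat) + (\<integral>\<^sup>+x. ennreal ((hT x)\<^sup>2) \<partial>lebesgue_on \<Omega>))"
    using energy_estimate_traces[OF assms(2,4,5,1) H] by blast
  have \<Sigma>_sets: "?\<Sigma> \<in> sets ?lat"
    unfolding lateral_measure_def
    by (intro sets_completionI_sets sets_lateral_product outflow_boundary_borel assms(2,5) H)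
      (auto simp: outflow_boundary_def)
  \<comment> \<open>\<open>K * (1 + real m)\<close> bounds the interior norm and the
    \<open>m\<close> slices together; \<open>1 + 2 * M\<close> is the exponent that absorbs the
    weight and one surplus factor \<open>s\<close>.\<close>
  define C where "C = K * (1 + real m) + 1 + 2 * M"
  have C: "0 < C" "K * (1 + real m) \<le> C" "1 + 2 * M \<le> C" using K M(1) by (auto simp: C_def add_pos_nonneg)
  show ?thesis
  \<comment> \<open>The witness 1 for \<open>s\<^sub>0\<close> makes \<open>s\<close> positive, and
    the witness 1 for \<open>C\<^sub>0\<close> makes the factor of the slices at most
    \<open>exp (C * s)\<close>.\<close>
  proof (rule exI[of _ 1], rule conjI[OF zero_less_one], rule exI[of _ 1], rule conjI[OF zero_less_one],
      rule exI[of _ C], rule conjI[OF C(1)], intro ballI allI impI)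
    fix u g h and s :: real
    assume u: "u \<in> H1 ?Q" and Pu: "AE p in lebesgue_on ?Q. transport \<Omega> T H u p = 0"
      and g: "lateral_trace \<Omega> T u g" and h: "\<forall>j\<le>m. time_trace \<Omega> T u (t j) (h j)" and s: "1 < s"
    have hT: "time_trace \<Omega> T u T (h m)" using h tm by auto
    have u_int: "integrable (lebesgue_on ?Q) (\<lambda>p. \<bar>u p\<bar>\<^sup>2)"
      using u by (simp add: H1_def square_integrable_def)
    have g_int: "integrable ?lat (\<lambda>p. indicator ?\<Sigma> p *\<^sub>R \<bar>g p\<bar>\<^sup>2)"
      using g \<Sigma>_sets by (intro integrable_mult_indicator) (auto simp: lateral_trace_def square_integrable_def)
    have h_int: "integrable (lebesgue_on \<Omega>) (\<lambda>x. \<bar>h j x\<bar>\<^sup>2)" if "j \<le> m" for j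
      using h that by (simp add: time_trace_def square_integrable_def)
    define G where "G = (LINT p:?\<Sigma>|?lat. \<bar>g p\<bar>\<^sup>2)"
    define N where "N j = (LINT x|lebesgue_on \<Omega>. \<bar>h j x\<bar>\<^sup>2)" for j
    define U where "U = (LINT p|lebesgue_on ?Q. \<bar>u p\<bar>\<^sup>2)"
    have nonneg: "0 \<le> G" "0 \<le> N j" for j
      unfolding G_def N_def set_lebesgue_integral_def by (auto intro!: integral_nonneg_AE)
    have G: "(\<integral>\<^sup>+p. ennreal ((g p)\<^sup>2) * indicator ?\<Sigma> p \<partial>?lat) = ennreal G"
    proof -
      have "(\<integral>\<^sup>+p. ennreal ((g p)\<^sup>2) * indicator ?\<Sigma> p \<partial>?lat)
          = (\<integral>\<^sup>+p. ennreal (indicator ?\<Sigma> p *\<^sub>R \<bar>g p\<bar>\<^sup>2) \<partial>?lat)"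
        by (intro nn_integral_cong) (auto simp: indicator_def)
      also have "\<dots> = ennreal G"
        unfolding G_def set_lebesgue_integral_def by (rule nn_integral_eq_integral[OF g_int]) simp
      finally show ?thesis .
    qed
    have N: "(\<integral>\<^sup>+x. ennreal ((h j x)\<^sup>2) \<partial>lebesgue_on \<Omega>) = ennreal (N j)" if "j \<le> m" for j
      using nn_integral_eq_integral[OF h_int[OF that]] by (simp add: N_def)
    have U: "(\<integral>\<^sup>+p. ennreal ((u p)\<^sup>2) \<partial>lebesgue_on ?Q) = ennreal U"
      using nn_integral_eq_integral[OF u_int] by (simp add: U_def)
    have U_le: "U \<le> K * (G + N m)"
    proof -
      have "ennreal U \<le> ennreal (K * (G + N m))"
        using K2[OF u Pu g hT] K nonneg by (simp add: U G N ennreal_mult)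
      then show ?thesis using K nonneg by (subst (asm) ennreal_le_iff) auto
    qed
    have N_le: "N j \<le> K * (G + N m)" if "j \<le> m" for j
    proof -
      have "ennreal (N j) \<le> ennreal (K * (G + N m))"
        using K1[OF u Pu g hT tj[OF that] h[rule_format, OF that]] K nonneg
        by (simp add: N that G ennreal_mult)
      then show ?thesis using K nonneg by (subst (asm) ennreal_le_iff) auto
    qed
    have "(LINT p|lebesgue_on ?Q. \<bar>u p\<bar>\<^sup>2 * exp (2 * s * ?w p))
        \<le> (LINT p|lebesgue_on ?Q. \<bar>u p\<bar>\<^sup>2 * exp (2 * s * M))"
    \<comment> \<open>This rule asks for integrability of the dominating function, a constant
      multiple of the square of \<open>u\<close>; were the smaller one not integrable, its integral
      would be 0 by default.\<close>
    proof (rule integral_mono')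
      show "integrable (lebesgue_on ?Q) (\<lambda>p. \<bar>u p\<bar>\<^sup>2 * exp (2 * s * M))"
        using u_int by (rule integrable_mult_left)
      show "\<bar>u p\<bar>\<^sup>2 * exp (2 * s * ?w p) \<le> \<bar>u p\<bar>\<^sup>2 * exp (2 * s * M)" if "p \<in> space (lebesgue_on ?Q)" for p
        using that s M(2)[of p] by (intro mult_left_mono) (auto simp: space_restrict_space)
    qed simp
    also have "\<dots> = U * exp (2 * s * M)" using u_int by (simp add: U_def)
    also have "\<dots> \<le> (K * (G + N m)) * exp (2 * s * M)" by (intro mult_right_mono U_le) simp
    finally have 1: "(LINT p|lebesgue_on ?Q. \<bar>u p\<bar>\<^sup>2 * exp (2 * s * ?w p)) \<le> (K * (G + N m)) * exp (2 * s * M)" .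
    have KR: "0 \<le> K * (G + N m)" using K nonneg by simp
    have "s\<^sup>2 * (LINT p|lebesgue_on ?Q. \<bar>u p\<bar>\<^sup>2 * exp (2 * s * ?w p)) \<le> s\<^sup>2 * ((K * (G + N m)) * exp (2 * s * M))"
      by (intro mult_left_mono 1) simp
    \<comment> \<open>The left side carries \<open>s\<^sup>2\<close> but the right side only
      \<open>s\<close>; the second factor is absorbed into the exponential by
      \<open>s \<le> exp s\<close>.\<close>
    also have "\<dots> = (s * (K * (G + N m))) * (s * exp (2 * s * M))"
      by (simp add: power2_eq_square)
    also have "\<dots> \<le> (s * (K * (G + N m))) * exp (C * s)"
    proof (rule mult_left_mono)
      have "s \<le> exp s" using exp_ge_add_one_self[of s] by linarith
      then have "s * exp (2 * s * M) \<le> exp s * exp (2 * s * M)" by (intro mult_right_mono) auto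
      also have "\<dots> = exp ((1 + 2 * M) * s)" by (simp add: exp_add[symmetric] algebra_simps)
      also have "\<dots> \<le> exp (C * s)" using C(3) s by (simp add: mult_right_mono)
      finally show "s * exp (2 * s * M) \<le> exp (C * s)" .
    qed (use s KR in simp)
    finally have first: "s\<^sup>2 * (LINT p|lebesgue_on ?Q. \<bar>u p\<bar>\<^sup>2 * exp (2 * s * ?w p))
        \<le> s * exp (C * s) * (K * (G + N m))" by (simp only: ac_simps)
    have "(\<Sum>j<m. N j) \<le> (\<Sum>j<m. K * (G + N m))"
      by (intro sum_mono N_le) simp
    then have sum: "(\<Sum>j<m. N j) \<le> real m * (K * (G + N m))" by simp
    have "s * exp (- 1 * s) * (\<Sum>j<m. N j) \<le> s * exp (C * s) * (real m * (K * (G + N m)))"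
    proof (intro mult_mono sum mult_left_mono)
      have "- 1 * s \<le> 0" "0 \<le> C * s" using s C(1) by auto
      then show "exp (- 1 * s) \<le> exp (C * s)" by (subst exp_le_cancel_iff) linarith
    qed (use s nonneg in \<open>auto intro: sum_nonneg\<close>)
    with first have "s\<^sup>2 * (LINT p|lebesgue_on ?Q. \<bar>u p\<bar>\<^sup>2 * exp (2 * s * ?w p)) + s * exp (- 1 * s) * (\<Sum>j<m. N j)
        \<le> s * exp (C * s) * (K * (1 + real m) * (G + N m))"
      by (simp add: algebra_simps)
    also have "\<dots> \<le> s * exp (C * s) * (C * (G + N m))"
      using s nonneg by (intro mult_left_mono mult_right_mono C(2)) auto
    also have "\<dots> = C * s * exp (C * s) * G + C * s * exp (C * s) * N m"
      by (simp add: algebra_simps)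
    \<comment> \<open>The weighted integral of the squared \<open>P u\<close> is nonnegative, so
      adding it only enlarges the right-hand side.\<close>
    also have "\<dots> \<le> C * (LINT p|lebesgue_on ?Q. \<bar>transport \<Omega> T H u p\<bar>\<^sup>2 * exp (2 * s * ?w p))
        + C * s * exp (C * s) * G + C * s * exp (C * s) * N m"
      using C(1) by (simp add: integral_nonneg_AE)
    finally show "s\<^sup>2 * (LINT p|lebesgue_on ?Q. \<bar>u p\<bar>\<^sup>2 * exp (2 * s * ?w p))
          + s * exp (- 1 * s) * (\<Sum>j<m. LINT x|lebesgue_on \<Omega>. \<bar>h j x\<bar>\<^sup>2)
        \<le> C * (LINT p|lebesgue_on ?Q. \<bar>transport \<Omega> T H u p\<bar>\<^sup>2 * exp (2 * s * ?w p))
          + C * s * exp (C * s) * (LINT p:?\<Sigma>|?lat. \<bar>g p\<bar>\<^sup>2)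
          + C * s * exp (C * s) * (LINT x|lebesgue_on \<Omega>. \<bar>h m x\<bar>\<^sup>2)"
      by (simp only: G_def N_def)
  qed
qed

end
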